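(* Let $H$ be a complex separable Hilbert space and let $\mathcal{G}$ be a countably infinite abelian group of unitary operators on $H$. Let $X = \{x_1,\dots,x_r\}$ and $Y = \{y_1,\dots,y_s\}$ be finite subsets of $H$ with $r < s$, let $V_0 = \overline{\mathrm{span}}\, \mathcal{G}(X)$ and $V_1 = \overline{\mathrm{span}}\, \mathcal{G}(Y)$, and assume $V_0 \subset V_1$. Let $W_0$ be a closed linear subspace of $V_1$ such that $V_0 \oplus W_0 = V_1$. Suppose that $\mathcal{G}(X)$ and $\mathcal{G}(Y)$ are Riesz bases for $V_0$ and $V_1$ respectively. Then there exists a subset $\Gamma = \{z_1,\dots,z_{s-r}\}$ of $W_0$ such that $\mathcal{G}(\Gamma)$ is a Riesz basis for $W_0$ if and only if $g(W_0) \subseteq W_0$ for every $g \in \mathcal{G}$.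
   Context: For a finite set $S=\{v_1,\dots,v_k\}\subset H$, $\mathcal{G}(S)$ denotes the indexed family $\{g v_j : g \in \mathcal{G},\ j=1,\dots,k\}$. A countable indexed family $\{v_n\}_{n\in J}$ is a Riesz basis for its closed linear span $V$ if there are constants $0<A\le B$ with $A\sum|a_n|^2 \le \|\sum a_n v_n\|^2 \le B\sum |a_n|^2$ for all $\{a_n\}\in\ell^2(J)$. For closed subspaces $V, W$, the notation $V_1 = V \oplus W$ means $V \cap W = \{0\}$ and the vector sum $V + W$ is closed and equals $V_1$ (a not necessarily orthogonal direct sum). *)

theory Defs
  imports "HOL-Analysis.Analysis"
begin

class scaleC =
  fixes scaleC :: "complex \<Rightarrow> 'a \<Rightarrow> 'a" (infixr \<open>*\<^sub>C\<close> 75)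

class complex_vector = scaleC + real_vector +
  assumes scaleC_add_right: "a *\<^sub>C (x + y) = a *\<^sub>C x + a *\<^sub>C y"
    and scaleC_add_left: "(a + b) *\<^sub>C x = a *\<^sub>C x + b *\<^sub>C x"
    and scaleC_scaleC: "a *\<^sub>C (b *\<^sub>C x) = (a * b) *\<^sub>C x"
    and scaleC_one: "1 *\<^sub>C x = x"
    and scaleR_scaleC: "r *\<^sub>R x = complex_of_real r *\<^sub>C x"

class complex_inner = complex_vector + real_normed_vector +
  fixes cinner :: "'a \<Rightarrow> 'a \<Rightarrow> complex"
  assumes cinner_commute: "cinner x y = cnj (cinner y x)"
    and cinner_add_left: "cinner (x + y) z = cinner x z + cinner y z"
    and cinner_scaleC_left: "cinner (a *\<^sub>C x) y = cnj a * cinner x y"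
    and cinner_real_nonneg: "Im (cinner x x) = 0 \<and> 0 \<le> Re (cinner x x)"
    and cinner_eq_zero_iff: "cinner x x = 0 \<longleftrightarrow> x = 0"
    and norm_eq_sqrt_cinner: "norm x = sqrt (Re (cinner x x))"

class chilbert_space = complex_inner + complete_space

definition clinear :: "('a::complex_vector \<Rightarrow> 'b::complex_vector) \<Rightarrow> bool" where
  "clinear f \<longleftrightarrow> (\<forall>x y. f (x + y) = f x + f y) \<and> (\<forall>c x. f (c *\<^sub>C x) = c *\<^sub>C f x)"

definition csubspace :: "'a::complex_vector set \<Rightarrow> bool" where
  "csubspace S \<longleftrightarrow> 0 \<in> S \<and> (\<forall>x\<in>S. \<forall>y\<in>S. x + y \<in> S) \<and> (\<forall>c. \<forall>x\<in>S. c *\<^sub>C x \<in> S)"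

definition cspan :: "'a::complex_vector set \<Rightarrow> 'a set" where
  "cspan S = {x. \<exists>F c. finite F \<and> F \<subseteq> S \<and> x = (\<Sum>v\<in>F. c v *\<^sub>C v)}"

definition ccspan :: "'a::complex_inner set \<Rightarrow> 'a set" where
  "ccspan S = closure (cspan S)"

definition unitary :: "('a::complex_inner \<Rightarrow> 'a) \<Rightarrow> bool" where
  "unitary U \<longleftrightarrow> clinear U \<and> surj U \<and> (\<forall>x y. cinner (U x) (U y) = cinner x y)"

definition abelian_operator_group :: "('a \<Rightarrow> 'a) set \<Rightarrow> bool" where
  "abelian_operator_group G \<longleftrightarrow>
     id \<in> G \<and> (\<forall>g\<in>G. \<forall>h\<in>G. g \<circ> h \<in> G)
     \<and> (\<forall>g\<in>G. \<exists>h\<in>G. g \<circ> h = id \<and> h \<circ> g = id)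
     \<and> (\<forall>g\<in>G. \<forall>h\<in>G. g \<circ> h = h \<circ> g)"

text \<open>Closed subspaces V, W with V \<oplus> W = U (not necessarily orthogonal).\<close>
definition direct_sum_eq :: "'a::complex_inner set \<Rightarrow> 'a set \<Rightarrow> 'a set \<Rightarrow> bool" where
  "direct_sum_eq V W U \<longleftrightarrow> V \<inter> W = {0} \<and> closed {v + w | v w. v \<in> V \<and> w \<in> W}
     \<and> {v + w | v w. v \<in> V \<and> w \<in> W} = U"

definition riesz_basis_for :: "('i \<Rightarrow> 'a::chilbert_space) \<Rightarrow> 'i set \<Rightarrow> 'a set \<Rightarrow> bool" where
  "riesz_basis_for v J V \<longleftrightarrow>
     countable J \<and> V = ccspan (v ` J) \<and>
     (\<exists>A B. 0 < A \<and> A \<le> B \<and>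
        (\<forall>a :: 'i \<Rightarrow> complex. (\<lambda>n. (cmod (a n))\<^sup>2) summable_on J \<longrightarrow>
           (\<exists>s. ((\<lambda>n. a n *\<^sub>C v n) has_sum s) J \<and>
              A * (\<Sum>\<^sub>\<infinity>n\<in>J. (cmod (a n))\<^sup>2) \<le> (norm s)\<^sup>2 \<and>
              (norm s)\<^sup>2 \<le> B * (\<Sum>\<^sub>\<infinity>n\<in>J. (cmod (a n))\<^sup>2))))"

text \<open>For S = {v_0,...,v_{k-1}} (given by v and k), the family G(S) = {g v_j},
indexed by pairs (g, j) with g \<in> G and j < k.\<close>
definition orbit_family :: "('a \<Rightarrow> 'a) set \<Rightarrow> (nat \<Rightarrow> 'a) \<Rightarrow> nat \<Rightarrow> (('a \<Rightarrow> 'a) \<times> nat \<Rightarrow> 'a)" where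
  "orbit_family G v k = (\<lambda>(g, j). g (v j))"

definition orbit_index :: "('a \<Rightarrow> 'a) set \<Rightarrow> nat \<Rightarrow> (('a \<Rightarrow> 'a) \<times> nat) set" where
  "orbit_index G k = G \<times> {..<k}"

end

theory Submission
  imports Defs
begin

text \<open>Let \<open>R\<close> be the ring of bounded operators commuting with \<open>G\<close> and let \<open>q\<close> project onto the
  closed span \<open>L\<close> of the orbit of one basis vector \<open>y 0\<close>. A \<open>G\<close>-Riesz basis with \<open>k\<close> generators of
  the range of an idempotent \<open>p\<close> in \<open>R\<close> amounts to a factorization \<open>p = (\<Sum>j<k. \<alpha> j * \<beta> j)\<close> with
  \<open>\<beta> i * \<alpha> j = (if i = j then q else 0)\<close>, that is, to an isomorphism of the range with \<open>L\<^sup>k\<close>. So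
  \<open>V1\<close> is isomorphic to \<open>L\<^sup>s\<close> and to \<open>L\<^sup>r \<oplus> W0\<close>, and \<open>r\<close> cancellations of \<open>L\<close> give \<open>W0\<close> isomorphic to
  \<open>L\<^sup>s\<^sup>-\<^sup>r\<close>. Cancellation is possible because \<open>q R q\<close> has stable range one: it is a commutative
  *-algebra, \<open>L\<close> being cyclic for an abelian group, and as it contains spectral projections one can
  add to any \<open>a\<close> a multiple of \<open>q - a u\<close> living where \<open>a\<close> is small, making it invertible.\<close>

subsection \<open>The real inner product and orthogonal projections\<close>

text \<open>Only the passage from invariance to a basis has content; conversely, a closed span of
  full orbits is invariant. Invariance of \<open>W0\<close> is what puts the oblique projection of
  \<open>V1\<close> onto \<open>V0\<close> along \<open>W0\<close> into \<open>R\<close>, so that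
  the problem becomes one about idempotents of \<open>R\<close>. The two decompositions of
  \<open>V1\<close> need not have any copy of \<open>L\<close> in common, so the generators of
  \<open>W0\<close> cannot be picked from \<open>Y\<close>. Cancellation has to tilt a copy of
  \<open>L\<close> until it is complementary to both remainders at once, and stable range one is
  what permits the tilting. Boundedness is tested on elements \<open>u\<close> of the group algebra
  alone: by the Riesz bounds, the norm of \<open>u y\<close> is comparable to the l2 norm of the
  coefficients of \<open>u\<close>, for every basis vector \<open>y\<close>, so that
  \<open>u y\<close> and \<open>u z\<close> correspond under an isomorphism of cyclic subspaces. The
  group algebra is never closed in an operator topology: commutativity of \<open>q R q\<close> comes
  from approximation at the single vector \<open>y 0\<close>, and spectral projections come from a
  power series for the square root.\<close>

instance chilbert_space \<subseteq> banach ..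

text \<open>Only the real part of the inner product is used. Scalars and unitaries have adjoints for it, so
  orthogonal projections onto complex subspaces and adjoints of complex linear operators are the same
  for both forms, and complex linearity becomes commutation with the scalar operators.\<close>

definition ip :: "'a::complex_inner \<Rightarrow> 'a \<Rightarrow> real" where
  "ip x y = Re (cinner x y)"

lemma ip_commute: "ip x y = ip y x"
  unfolding ip_def by (subst cinner_commute) simp

lemma ip_self: "ip x x = (norm x)\<^sup>2"
  unfolding ip_def using cinner_real_nonneg[of x] by (simp add: norm_eq_sqrt_cinner)

lemma ip_add_left: "ip (x + y) z = ip x z + ip y z"
  unfolding ip_def by (simp add: cinner_add_left)

lemma ip_add_right: "ip z (x + y) = ip z x + ip z y"
  by (metis ip_commute ip_add_left)

lemma ip_scaleC_left: "ip (c *\<^sub>C x) y = ip x (cnj c *\<^sub>C y)"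
proof -
  have "cinner x (cnj c *\<^sub>C y) = cnj c * cinner x y"
    by (subst (1 2) cinner_commute) (simp add: cinner_scaleC_left)
  then show ?thesis
    unfolding ip_def by (simp add: cinner_scaleC_left)
qed

lemma ip_scaleR_left: "ip (r *\<^sub>R x) y = r * ip x y"
  unfolding ip_def by (simp add: scaleR_scaleC cinner_scaleC_left)

lemma ip_scaleR_right: "ip y (r *\<^sub>R x) = r * ip y x"
  by (metis ip_commute ip_scaleR_left)

lemma norm_scaleC: "norm (c *\<^sub>C x) = cmod c * norm (x::'a::complex_inner)"
proof -
  have "(norm (c *\<^sub>C x))\<^sup>2 = ip x ((cnj c * c) *\<^sub>C x)"
    by (simp add: ip_self[symmetric] ip_scaleC_left scaleC_scaleC)
  also have "cnj c * c = complex_of_real ((cmod c)\<^sup>2)"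
    by (metis complex_norm_square mult.commute)
  also have "ip x (complex_of_real ((cmod c)\<^sup>2) *\<^sub>C x) = (cmod c * norm x)\<^sup>2"
    by (simp only: scaleR_scaleC[symmetric] ip_scaleR_right ip_self power_mult_distrib)
  finally show ?thesis
    by (simp add: power2_eq_iff_nonneg)
qed

lemma norm_add_sq: "(norm (x + y))\<^sup>2 = (norm x)\<^sup>2 + 2 * ip x y + (norm y)\<^sup>2"
  by (simp add: ip_self[symmetric] ip_add_left ip_add_right ip_commute[of y x])

lemma ip_Cauchy_Schwarz: "\<bar>ip x y\<bar> \<le> norm x * norm y"
proof (cases "y = 0")
  case True
  then show ?thesis
    using ip_scaleR_right[of x 0 0] by simp
next
  case False
  define t where "t = - ip x y / (norm y)\<^sup>2"
  have n: "(norm y)\<^sup>2 > 0"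
    using False by simp
  have "0 \<le> (norm (x + t *\<^sub>R y))\<^sup>2"
    by simp
  also have "\<dots> = (norm x)\<^sup>2 + 2 * t * ip x y + t\<^sup>2 * (norm y)\<^sup>2"
    by (simp add: norm_add_sq ip_scaleR_right power_mult_distrib)
  also have "\<dots> = (norm x)\<^sup>2 - (ip x y)\<^sup>2 / (norm y)\<^sup>2"
    using n by (simp add: t_def field_simps power2_eq_square)
  finally have "(ip x y)\<^sup>2 \<le> (norm x * norm y)\<^sup>2"
    using n by (simp add: field_simps power_mult_distrib)
  then show ?thesis
    by (metis abs_le_square_iff abs_mult abs_norm_cancel)
qed

interpretation ip: bounded_bilinear ip
  by unfold_locales
    (auto simp: ip_add_left ip_add_right ip_scaleR_left ip_scaleR_right
      intro!: exI[of _ 1] ip_Cauchy_Schwarz)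

lemma norm_diff_sq: "(norm (x - y))\<^sup>2 = (norm x)\<^sup>2 - 2 * ip x y + (norm y)\<^sup>2"
  by (simp add: ip_self[symmetric] ip.diff_left ip.diff_right ip_commute[of y x])

lemma ip_eqI: "(\<And>z. ip x z = ip y z) \<Longrightarrow> x = y"
  by (metis eq_iff_diff_eq_0 ip.diff_left ip_self norm_eq_zero power_eq_0_iff)

text \<open>The first-order condition at a minimum. As \<open>b\<close> may have either sign, it is
  replaced by the positive bound \<open>c\<close>, whose parabola is negative at its vertex
  \<open>t = - a / c\<close> unless \<open>a = 0\<close>.\<close>

lemma quadratic_nonneg_imp_zero:
  fixes a b :: real
  assumes "\<And>t. 0 \<le> 2 * t * a + t\<^sup>2 * b"
  shows "a = 0"
proof (rule ccontr)
  assume a: "a \<noteq> 0"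
  define c where "c = \<bar>b\<bar> + 1"
  have c: "c > 0" "b \<le> c"
    by (auto simp: c_def)
  have "0 \<le> 2 * (- a / c) * a + (- a / c)\<^sup>2 * b"
    by (rule assms)
  also have "\<dots> \<le> 2 * (- a / c) * a + (- a / c)\<^sup>2 * c"
    using c by (intro add_left_mono mult_left_mono) auto
  also have "\<dots> = - (a\<^sup>2 / c)"
    using c by (simp add: field_simps power2_eq_square)
  finally show False
    using a c by (simp add: field_simps)
qed

lemma nearest_point_exists:
  fixes V :: "'a::chilbert_space set"
  assumes V: "subspace V" "closed V"
  shows "\<exists>v\<in>V. \<forall>w\<in>V. ip (x - v) w = 0"
proof -
  define D where "D = (INF v\<in>V. (norm (x - v))\<^sup>2)"
  have bdd: "bdd_below ((\<lambda>v. (norm (x - v))\<^sup>2) ` V)"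
    by (auto intro!: bdd_belowI[of _ 0])
  have ne: "V \<noteq> {}"
    using V(1) subspace_0 by auto
  have D_le: "D \<le> (norm (x - v))\<^sup>2" if "v \<in> V" for v
    unfolding D_def by (rule cINF_lower[OF bdd that])
  have "\<exists>v\<in>V. (norm (x - v))\<^sup>2 < D + 1 / real (Suc n)" for n
  proof -
    have "D < D + 1 / real (Suc n)"
      by simp
    then show ?thesis
      unfolding D_def using cINF_less_iff[OF ne bdd] by blast
  qed
  then obtain v where v: "\<And>n. v n \<in> V" "\<And>n. (norm (x - v n))\<^sup>2 < D + 1 / real (Suc n)"
    by metis
  \<comment> \<open>Parallelogram law for \<open>x - v n\<close> and \<open>x - v m\<close>: their
    midpoint is \<open>x - w\<close> with \<open>w\<close> in \<open>V\<close>, so its norm is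
    bounded below through \<open>D\<close>.\<close>
  have est: "(norm (v n - v m))\<^sup>2 \<le> 2 / real (Suc n) + 2 / real (Suc m)" for n m
  proof -
    define w where "w = (1/2) *\<^sub>R (v n + v m)"
    have "w \<in> V"
      unfolding w_def using v(1) V(1) by (simp add: subspace_add subspace_scale)
    then have D: "D \<le> (norm (x - w))\<^sup>2"
      by (rule D_le)
    define p q where "p = x - v n" and "q = x - v m"
    have xw: "x - w = (1/2) *\<^sub>R (p + q)"
      by (simp add: w_def p_def q_def algebra_simps flip: scaleR_add_left)
    have "4 * (norm (x - w))\<^sup>2 = (norm (p + q))\<^sup>2"
      by (simp add: xw power_mult_distrib power2_eq_square)
    moreover have "v n - v m = q - p"
      by (simp add: p_def q_def)
    ultimately have "(norm (v n - v m))\<^sup>2 = 2 * (norm p)\<^sup>2 + 2 * (norm q)\<^sup>2 - 4 * (norm (x - w))\<^sup>2"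
      by (simp add: norm_add_sq norm_diff_sq ip_commute[of q p])
    then show ?thesis
      using D v(2)[of n] v(2)[of m] by (simp add: p_def q_def)
  qed
  have "Cauchy v"
  proof (rule CauchyI)
    fix e :: real
    assume e: "0 < e"
    obtain N where N: "4 / real (Suc N) < e\<^sup>2"
      using reals_Archimedean[of "e\<^sup>2 / 4"] e by (auto simp: field_simps)
    have "norm (v m - v n) < e" if "m \<ge> N" "n \<ge> N" for m n
    proof -
      have "(norm (v m - v n))\<^sup>2 \<le> 2 / real (Suc m) + 2 / real (Suc n)"
        by (rule est)
      also have "\<dots> \<le> 2 / real (Suc N) + 2 / real (Suc N)"
        using that by (intro add_mono divide_left_mono) auto
      also have "\<dots> < e\<^sup>2"
        using N by simp
      finally show ?thesis
        using e by (meson less_eq_real_def power_less_imp_less_base)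
    qed
    then show "\<exists>M. \<forall>m\<ge>M. \<forall>n\<ge>M. norm (v m - v n) < e"
      by blast
  qed
  then obtain l where l: "v \<longlonglongrightarrow> l"
    using Cauchy_convergent convergent_def by blast
  have lV: "l \<in> V"
    using V(2) v(1) l closed_sequentially by blast
  have "(\<lambda>n. (norm (x - v n))\<^sup>2) \<longlonglongrightarrow> (norm (x - l))\<^sup>2"
    by (intro tendsto_intros l)
  moreover have "(\<lambda>n. D + 1 / real (Suc n)) \<longlonglongrightarrow> D + 0"
    by (intro tendsto_intros LIMSEQ_Suc[OF lim_1_over_n])
  ultimately have "(norm (x - l))\<^sup>2 \<le> D"
    using v(2) by (intro LIMSEQ_le[where X = "\<lambda>n. (norm (x - v n))\<^sup>2"]) (auto intro: less_imp_le)
  then have min: "(norm (x - l))\<^sup>2 \<le> (norm (x - w))\<^sup>2" if "w \<in> V" for w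
    using order_trans D_le[OF that] by blast
  have "ip (x - l) w = 0" if w: "w \<in> V" for w
  proof -
    have "0 \<le> 2 * t * ip (x - l) w + t\<^sup>2 * (norm w)\<^sup>2" for t
    proof -
      have "l - t *\<^sub>R w \<in> V"
        using w lV V(1) by (simp add: subspace_diff subspace_scale)
      from min[OF this] have "(norm (x - l))\<^sup>2 \<le> (norm ((x - l) + t *\<^sub>R w))\<^sup>2"
        by (simp add: algebra_simps)
      then show ?thesis
        unfolding norm_add_sq by (simp add: ip_scaleR_right power_mult_distrib)
    qed
    then show ?thesis
      by (rule quadratic_nonneg_imp_zero)
  qed
  with lV show ?thesis
    by blast
qed

definition orth_proj :: "'a::chilbert_space set \<Rightarrow> 'a \<Rightarrow> 'a" where
  "orth_proj V x = (SOME v. v \<in> V \<and> (\<forall>w\<in>V. ip (x - v) w = 0))"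

context
  fixes V :: "'a::chilbert_space set"
  assumes V: "subspace V" "closed V"
begin

lemma orth_proj_in: "orth_proj V x \<in> V"
  and orth_proj_orth: "w \<in> V \<Longrightarrow> ip (x - orth_proj V x) w = 0"
  using someI_ex[of "\<lambda>v. v \<in> V \<and> (\<forall>w\<in>V. ip (x - v) w = 0)"] nearest_point_exists[OF V, of x]
  unfolding orth_proj_def by blast+

lemma orth_proj_unique:
  assumes "v \<in> V" "\<And>w. w \<in> V \<Longrightarrow> ip (x - v) w = 0"
  shows "orth_proj V x = v"
proof -
  let ?d = "orth_proj V x - v"
  have d: "?d \<in> V"
    using assms(1) orth_proj_in V(1) by (simp add: subspace_diff)
  have "ip ?d ?d = ip (x - v) ?d - ip (x - orth_proj V x) ?d"
    by (simp add: ip.diff_left)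
  also have "\<dots> = 0"
    using assms(2)[OF d] orth_proj_orth[OF d] by simp
  finally show ?thesis
    by (simp add: ip_self)
qed

lemma orth_proj_fixes: "x \<in> V \<Longrightarrow> orth_proj V x = x"
  by (rule orth_proj_unique) (auto simp: ip.zero_left)

lemma orth_proj_selfadjoint: "ip (orth_proj V x) y = ip x (orth_proj V y)"
proof -
  have "ip (orth_proj V x) y = ip (orth_proj V x) (orth_proj V y)"
    using orth_proj_orth[OF orth_proj_in, of y x] by (simp add: ip_commute ip.diff_left ip.diff_right)
  also have "\<dots> = ip x (orth_proj V y)"
    using orth_proj_orth[OF orth_proj_in, of x y] by (simp add: ip.diff_left)
  finally show ?thesis .
qed

lemma norm_orth_proj_le: "norm (orth_proj V x) \<le> norm x"
proof -
  have "(norm (orth_proj V x))\<^sup>2 = ip x (orth_proj V x)"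
    by (metis ip_self orth_proj_fixes orth_proj_in orth_proj_selfadjoint)
  also have "\<dots> \<le> norm x * norm (orth_proj V x)"
    using ip_Cauchy_Schwarz[of x "orth_proj V x"] by linarith
  finally show ?thesis
    by (cases "orth_proj V x = 0") (simp_all add: power2_eq_square)
qed

lemma bounded_linear_orth_proj: "bounded_linear (orth_proj V)"
proof (rule bounded_linear_intro[where K = 1])
  show "orth_proj V (x + y) = orth_proj V x + orth_proj V y" for x y
  proof (rule orth_proj_unique)
    show "orth_proj V x + orth_proj V y \<in> V"
      using orth_proj_in V(1) by (simp add: subspace_add)
    fix w
    assume "w \<in> V"
    then have "ip ((x - orth_proj V x) + (y - orth_proj V y)) w = 0"
      by (simp only: ip_add_left orth_proj_orth)
    then show "ip (x + y - (orth_proj V x + orth_proj V y)) w = 0"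
      by (simp add: algebra_simps)
  qed
  show "orth_proj V (r *\<^sub>R x) = r *\<^sub>R orth_proj V x" for r x
  proof (rule orth_proj_unique)
    show "r *\<^sub>R orth_proj V x \<in> V"
      using orth_proj_in V(1) by (simp add: subspace_scale)
    fix w
    assume "w \<in> V"
    then show "ip (r *\<^sub>R x - r *\<^sub>R orth_proj V x) w = 0"
      by (simp only: scaleR_diff_right[symmetric] ip_scaleR_left orth_proj_orth)
  qed
  show "norm (orth_proj V x) \<le> norm x * 1" for x
    using norm_orth_proj_le by simp
qed

end

text \<open>The kernel of a nonzero \<open>f\<close> has codimension one, and the component
  \<open>u\<close> of any \<open>x0\<close> outside it spans its orthogonal complement; only the
  scale of \<open>u\<close> has to be adjusted.\<close>

lemma riesz_representation:
  fixes f :: "'a::chilbert_space \<Rightarrow> real"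
  assumes f: "bounded_linear f"
  shows "\<exists>v. \<forall>x. f x = ip v x"
proof (cases "\<forall>x. f x = 0")
  case True
  then show ?thesis
    by (intro exI[of _ 0]) (simp add: ip.zero_left)
next
  case False
  interpret f: bounded_linear f
    by (rule f)
  define K where "K = {x. f x = 0}"
  have K: "subspace K"
    unfolding K_def by (auto simp: subspace_def f.zero f.add f.scaleR)
  have cK: "closed K"
    unfolding K_def by (intro closed_Collect_eq continuous_intros linear_continuous_on f)
  obtain x0 where x0: "f x0 \<noteq> 0"
    using False by blast
  define u where "u = x0 - orth_proj K x0"
  have fu: "f u \<noteq> 0"
    using x0 orth_proj_in[OF K cK, of x0] by (simp add: u_def f.diff K_def)
  have u0: "norm u \<noteq> 0"
    using fu f.zero by auto
  have "f x = ip ((f u / (norm u)\<^sup>2) *\<^sub>R u) x" for x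
  proof -
    have "x - (f x / f u) *\<^sub>R u \<in> K"
      using fu by (simp add: K_def f.diff f.scaleR)
    then have "ip u (x - (f x / f u) *\<^sub>R u) = 0"
      unfolding u_def by (rule orth_proj_orth[OF K cK])
    then have "ip u x = (f x / f u) * (norm u)\<^sup>2"
      by (simp add: ip.diff_right ip.scaleR_right ip_self)
    then show ?thesis
      using fu u0 by (simp add: ip.scaleR_left)
  qed
  then show ?thesis
    by blast
qed

subsection \<open>The Banach algebra of bounded operators\<close>

text \<open>A copy of the bounded endomorphisms in which composition is the ring multiplication, so
  that powers, Cauchy products and ring simplification apply to operators.\<close>

typedef (overloaded) 'a bop = "UNIV :: ('a::real_normed_vector \<Rightarrow>\<^sub>L 'a) set"
  morphisms blin Op ..

lemma blin_Op [simp]: "blin (Op f) = f"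
  by (simp add: Op_inverse)

lemma bop_eq_iff: "S = T \<longleftrightarrow> blin S = blin T"
  by (simp add: blin_inject)

instantiation bop :: (real_normed_vector) real_normed_algebra
begin

definition "0 = Op 0"
definition "S + T = Op (blin S + blin T)"
definition "- T = Op (- blin T)"
definition "S - T = Op (blin S - blin T)"
definition "S * T = Op (blin S o\<^sub>L blin T)"
definition "r *\<^sub>R T = Op (r *\<^sub>R blin T)"
definition "norm T = norm (blin T)"
definition "dist S T = norm (blin S - blin T)"
definition "sgn T = Op (sgn (blin T))"
definition "uniformity = (INF e\<in>{0<..}. principal {(S, T :: 'a bop). dist S T < e})"
definition "open U = (\<forall>S\<in>U. eventually (\<lambda>(S', T :: 'a bop). S' = S \<longrightarrow> T \<in> U) uniformity)"

lemmas bop_ops = zero_bop_def plus_bop_def uminus_bop_def minus_bop_def times_bop_def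
  scaleR_bop_def norm_bop_def dist_bop_def sgn_bop_def

instance
proof
  fix S T P :: "'a bop" and a b :: real
  show "norm (S * T) \<le> norm S * norm T"
    by (simp add: bop_ops norm_blinfun_compose)
  show "S * T * P = S * (T * P)"
    by (auto simp: bop_ops bop_eq_iff intro!: blinfun_eqI)
  show "(S + T) * P = S * P + T * P" "P * (S + T) = P * S + P * T"
    "a *\<^sub>R S * T = a *\<^sub>R (S * T)" "S * a *\<^sub>R T = a *\<^sub>R (S * T)"
    by (auto simp: bop_ops bop_eq_iff blinfun.bilinear_simps intro!: blinfun_eqI)
  show "norm (S + T) \<le> norm S + norm T"
    by (simp add: bop_ops norm_triangle_ineq)
  show "sgn T = inverse (norm T) *\<^sub>R T"
    by (simp add: bop_ops sgn_div_norm)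
qed (auto simp: bop_ops bop_eq_iff algebra_simps uniformity_bop_def open_bop_def)

end

text \<open>The unit comes from \<open>monoid_mult\<close> and not from a unital normed algebra
  class, because \<open>0 = 1\<close> when the underlying space is trivial.\<close>

instantiation bop :: (real_normed_vector) monoid_mult
begin

definition "1 = Op id_blinfun"

instance
  by standard (auto simp: one_bop_def times_bop_def bop_eq_iff intro!: blinfun_eqI)

end

instance bop :: (banach) banach
proof
  fix X :: "nat \<Rightarrow> 'a bop"
  assume "Cauchy X"
  then have "Cauchy (\<lambda>n. blin (X n))"
    unfolding Cauchy_def by (simp add: dist_bop_def dist_norm)
  then obtain L where "(\<lambda>n. blin (X n)) \<longlonglongrightarrow> L"
    using Cauchy_convergent convergent_def by blast
  then have "X \<longlonglongrightarrow> Op L"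
    unfolding lim_sequentially by (simp add: dist_bop_def dist_norm)
  then show "convergent X"
    using convergent_def by blast
qed

definition app :: "'a::real_normed_vector bop \<Rightarrow> 'a \<Rightarrow> 'a" where
  "app T = blinfun_apply (blin T)"

definition Bop :: "('a::real_normed_vector \<Rightarrow> 'a) \<Rightarrow> 'a bop" where
  "Bop f = Op (Blinfun f)"

lemma app_Bop: "bounded_linear f \<Longrightarrow> app (Bop f) = f"
  by (simp add: app_def Bop_def bounded_linear_Blinfun_apply)

lemma bop_eqI: "(\<And>x. app S x = app T x) \<Longrightarrow> S = T"
  by (simp add: bop_eq_iff app_def blinfun_eqI)

lemma app_times [simp]: "app (S * T) x = app S (app T x)"
  by (simp add: app_def times_bop_def)

lemma app_one [simp]: "app 1 x = x"
  by (simp add: app_def one_bop_def)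

lemma norm_app_le: "norm (app T x) \<le> norm T * norm x"
  by (simp add: app_def norm_bop_def norm_blinfun)

interpretation app: bounded_bilinear app
  by unfold_locales
    (auto simp: app_def plus_bop_def scaleR_bop_def blinfun.bilinear_simps
      intro!: exI[of _ 1] norm_app_le[unfolded app_def])

lemma norm_bop_bound:
  assumes "0 \<le> K" "\<And>x. norm (app T x) \<le> K * norm x"
  shows "norm T \<le> K"
  unfolding norm_bop_def using assms by (intro norm_blinfun_bound) (auto simp: app_def)

lemma norm_bop_one_le: "norm (1 :: 'a::real_normed_vector bop) \<le> 1"
  by (rule norm_bop_bound) auto

lemma norm_bop_power_le:
  assumes "norm (C :: 'a::real_normed_vector bop) \<le> 1"
  shows "norm (C ^ k) \<le> 1"
proof (induction k)
  case (Suc k)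
  have "norm (C ^ Suc k) \<le> norm C * norm (C ^ k)"
    by (simp add: norm_mult_ineq)
  also have "\<dots> \<le> 1 * 1"
    using Suc assms by (intro mult_mono) auto
  finally show ?case
    by simp
qed (simp add: norm_bop_one_le)

lemma app_if: "app (if b then S else T) x = (if b then app S x else app T x)"
  by simp

lemma app_eq_on_closure:
  assumes "\<And>x. x \<in> D \<Longrightarrow> app S x = app T x" "x \<in> closure D"
  shows "app S x = app T x"
proof -
  have "closure D \<subseteq> {z. app S z = app T z}"
  proof (rule closure_minimal)
    show "closed {z. app S z = app T z}"
      by (intro closed_Collect_eq continuous_intros linear_continuous_on app.bounded_linear_right)
  qed (use assms in auto)
  then show ?thesis
    using assms by blast
qed

lemma app_in_closure:
  assumes "\<And>x. x \<in> D \<Longrightarrow> app T x \<in> D'" "x \<in> closure D"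
  shows "app T x \<in> closure D'"
proof -
  have "app T ` closure D \<subseteq> closure D'"
  proof (rule image_closure_subset)
    show "continuous_on (closure D) (app T)"
      by (intro linear_continuous_on app.bounded_linear_right)
    show "app T ` D \<subseteq> closure D'"
      using assms(1) closure_subset by blast
  qed simp
  then show ?thesis
    using assms by blast
qed

lemma subspace_closure:
  fixes S :: "'a::real_normed_vector set"
  assumes "subspace S"
  shows "subspace (closure S)"
  unfolding subspace_def
proof (intro conjI ballI allI)
  show "0 \<in> closure S"
    using assms closure_subset subspace_0 by blast
  show "x + y \<in> closure S" if x: "x \<in> closure S" and y: "y \<in> closure S" for x y
  proof -
    obtain f g where f: "\<And>n. f n \<in> S" "f \<longlonglongrightarrow> x" and g: "\<And>n. g n \<in> S" "g \<longlonglongrightarrow> y"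
      using x y unfolding closure_sequential by blast
    have "(\<lambda>n. f n + g n) \<longlonglongrightarrow> x + y"
      by (intro tendsto_intros f g)
    moreover have "f n + g n \<in> S" for n
      by (intro subspace_add assms f g)
    ultimately show ?thesis
      unfolding closure_sequential by (intro exI[of _ "\<lambda>n. f n + g n"]) simp
  qed
  show "c *\<^sub>R x \<in> closure S" if x: "x \<in> closure S" for c x
  proof -
    obtain f where f: "\<And>n. f n \<in> S" "f \<longlonglongrightarrow> x"
      using x unfolding closure_sequential by blast
    have "(\<lambda>n. c *\<^sub>R f n) \<longlonglongrightarrow> c *\<^sub>R x"
      by (intro tendsto_intros f)
    moreover have "c *\<^sub>R f n \<in> S" for n
      by (intro subspace_scale assms f)
    ultimately show ?thesis
      unfolding closure_sequential by (intro exI[of _ "\<lambda>n. c *\<^sub>R f n"]) simp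
  qed
qed

section \<open>Adjoint operators\<close>

definition adj :: "'a::chilbert_space bop \<Rightarrow> 'a bop" where
  "adj T = (SOME S. \<forall>x y. ip (app T x) y = ip x (app S y))"

lemma adjoint_exists:
  fixes T :: "'a::chilbert_space bop"
  shows "\<exists>S. \<forall>x y. ip (app T x) y = ip x (app S y)"
proof -
  have "\<exists>v. \<forall>x. ip (app T x) y = ip v x" for y
    by (rule riesz_representation)
      (intro bounded_linear_compose[OF ip.bounded_linear_left] app.bounded_linear_right)
  then obtain f where f: "\<And>x y. ip (app T x) y = ip x (f y)"
    by (metis ip_commute)
  have "bounded_linear f"
  proof (rule bounded_linear_intro[where K = "norm T"])
    show "f (x + y) = f x + f y" for x y
      by (rule ip_eqI) (metis f ip_add_right ip_commute)
    show "f (r *\<^sub>R x) = r *\<^sub>R f x" for r x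
      by (rule ip_eqI) (metis f ip_scaleR_right ip_commute)
    show "norm (f x) \<le> norm x * norm T" for x
    proof (cases "f x = 0")
      case False
      have "norm (f x) * norm (f x) = ip (app T (f x)) x"
        by (simp add: f ip_self power2_eq_square)
      also have "\<dots> \<le> norm (app T (f x)) * norm x"
        using ip_Cauchy_Schwarz[of "app T (f x)" x] by linarith
      also have "\<dots> \<le> norm T * norm (f x) * norm x"
        by (intro mult_right_mono norm_app_le) auto
      finally show ?thesis
        using False by (simp add: mult_ac)
    qed auto
  qed
  then have "app (Bop f) = f"
    by (rule app_Bop)
  then show ?thesis
    using f by (intro exI[of _ "Bop f"]) simp
qed

lemma ip_adj: "ip (app T x) y = ip x (app (adj T) y)"
  using someI_ex[OF adjoint_exists, of T] unfolding adj_def by blast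

lemma ip_adj2: "ip (app (adj T) x) y = ip x (app T y)"
  by (metis ip_adj ip_commute)

lemma adj_unique:
  assumes "\<And>x y. ip (app T x) y = ip x (app S y)"
  shows "adj T = S"
proof (rule bop_eqI)
  show "app (adj T) y = app S y" for y
    by (rule ip_eqI) (metis assms ip_adj ip_commute)
qed

lemma adj_adj [simp]: "adj (adj T) = T"
  by (rule adj_unique) (rule ip_adj2)

lemma adj_times: "adj (S * T) = adj T * adj S"
  by (rule adj_unique) (simp add: ip_adj)

lemma adj_add: "adj (S + T) = adj S + adj T"
  by (rule adj_unique) (simp add: ip_adj app.add_left ip.add_left ip.add_right)

lemma adj_diff: "adj (S - T) = adj S - adj T"
  by (rule adj_unique) (simp add: ip_adj app.diff_left ip.diff_left ip.diff_right)

lemma adj_scaleR: "adj (r *\<^sub>R T) = r *\<^sub>R adj T"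
  by (rule adj_unique) (simp add: ip_adj app.scaleR_left ip.scaleR_left ip.scaleR_right)

lemma adj_one [simp]: "adj 1 = 1"
  by (rule adj_unique) simp

lemma adj_power: "adj (T ^ k) = adj T ^ k"
  by (induction k) (simp_all add: adj_times power_commutes)

section \<open>The binomial series of sqrt(1 - t) and positive square roots\<close>

definition sqrt_coeff :: "nat \<Rightarrow> real" where
  "sqrt_coeff k = (1/2 gchoose k) * (-1) ^ k"

lemma gbinomial_Suc_ratio:
  "(a gchoose Suc k) = (a gchoose k) * (a - real k) / (real k + 1)"
  using gbinomial_mult_1[of a k] by (simp add: field_simps)

lemma sqrt_coeff_Suc: "sqrt_coeff (Suc k) = sqrt_coeff k * (real k - 1/2) / (real k + 1)"
  by (simp add: sqrt_coeff_def gbinomial_Suc_ratio field_simps)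

lemma sqrt_coeff_0: "sqrt_coeff 0 = 1"
  by (simp add: sqrt_coeff_def)

text \<open>The ratio \<open>(k - 1/2) / (k + 1)\<close> is negative only at \<open>k = 0\<close>,
  so the sign changes once and never again.\<close>

lemma sqrt_coeff_Suc_nonpos: "sqrt_coeff (Suc k) \<le> 0"
proof (induction k)
  case (Suc k)
  then show ?case
    by (subst sqrt_coeff_Suc) (simp add: divide_nonpos_pos mult_nonpos_nonneg)
qed (simp add: sqrt_coeff_Suc sqrt_coeff_0)

text \<open>The partial sums of the coefficients are the coefficients of (1 - t)^(1/2) / (1 - t) =
  (1 - t)^(-1/2), all of which are positive.\<close>

lemma sum_sqrt_coeff_nonneg: "0 \<le> (\<Sum>k\<le>n. sqrt_coeff k)"
proof -
  have "0 \<le> (-1) ^ n * (- (1/2) gchoose n :: real)"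
  proof (induction n)
    case (Suc n)
    have "(-1) ^ Suc n * (- (1/2) gchoose Suc n :: real)
        = ((-1) ^ n * (- (1/2) gchoose n)) * ((real n + 1/2) / (real n + 1))"
      by (simp add: gbinomial_Suc_ratio field_simps)
    then show ?case
      using Suc by simp
  qed simp
  then show ?thesis
    unfolding sqrt_coeff_def gbinomial_sum_lower_neg by simp
qed

text \<open>Only the coefficient at 0 is positive, so the absolute sums equal 2 minus the plain
  sums. Absolute convergence on the boundary of the unit disc is what lets
  \<open>positive_sqrt_exists\<close> allow \<open>norm C = 1\<close>.\<close>

lemma summable_abs_sqrt_coeff: "summable (\<lambda>k. \<bar>sqrt_coeff k\<bar>)"
proof (rule summableI_nonneg_bounded)
  have *: "(\<Sum>k\<le>n. \<bar>sqrt_coeff k\<bar>) = 2 - (\<Sum>k\<le>n. sqrt_coeff k)" for n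
    by (induction n) (use sqrt_coeff_Suc_nonpos in \<open>auto simp: sqrt_coeff_0 abs_of_nonpos\<close>)
  show "(\<Sum>k<n. \<bar>sqrt_coeff k\<bar>) \<le> 2" for n
  proof -
    have "(\<Sum>k<n. \<bar>sqrt_coeff k\<bar>) \<le> (\<Sum>k\<le>n. \<bar>sqrt_coeff k\<bar>)"
      by (rule sum_mono2) auto
    then show ?thesis
      using *[of n] sum_sqrt_coeff_nonneg[of n] by linarith
  qed
qed auto

text \<open>The square of the series is 1 - t, by Vandermonde's identity with both upper indices
  1/2.\<close>

lemma sqrt_coeff_convolution:
  "(\<Sum>i\<le>k. sqrt_coeff i * sqrt_coeff (k - i)) = (if k = 0 then 1 else if k = 1 then -1 else 0)"
proof -
  have "(\<Sum>i\<le>k. sqrt_coeff i * sqrt_coeff (k - i))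
      = (\<Sum>i\<le>k. (1/2 gchoose i) * (1/2 gchoose (k - i)) * (-1) ^ k)"
    by (intro sum.cong refl) (simp add: sqrt_coeff_def flip: power_add)
  also have "\<dots> = (1 gchoose k) * (-1) ^ k"
    using gbinomial_Vandermonde[of "1/2 :: real" "1/2" k]
    by (simp add: atMost_atLeast0 flip: sum_distrib_right)
  also have "(1 gchoose k :: real) = of_nat (1 choose k)"
    by (simp add: binomial_gbinomial)
  finally show ?thesis
    by (cases k rule: nat.exhaust) (auto simp: binomial_eq_0)
qed

text \<open>\<open>B\<close> is the binomial series evaluated at \<open>C\<close>. Self-adjointness,
  positivity and the commutation property all pass to the limit from the partial sums.\<close>

lemma positive_sqrt_exists:
  fixes C :: "'a::chilbert_space bop"
  assumes C: "adj C = C" "norm C \<le> 1"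
  obtains B where "adj B = B" "B * B = 1 - C" "\<And>x. 0 \<le> ip (app B x) x"
    "\<And>T. T * C = C * T \<Longrightarrow> T * B = B * T"
proof -
  define F where "F k = sqrt_coeff k *\<^sub>R C ^ k" for k
  define B where "B = (\<Sum>k. F k)"
  have nF: "summable (\<lambda>k. norm (F k))"
  proof (rule summable_comparison_test[OF _ summable_abs_sqrt_coeff])
    have "norm (norm (F k)) \<le> \<bar>sqrt_coeff k\<bar>" for k
      using mult_left_mono[OF norm_bop_power_le[OF C(2), of k], of "\<bar>sqrt_coeff k\<bar>"]
      by (simp add: F_def)
    then show "\<exists>N. \<forall>k\<ge>N. norm (norm (F k)) \<le> \<bar>sqrt_coeff k\<bar>"
      by blast
  qed
  have sF: "summable F"
    using nF by (rule summable_norm_cancel)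
  have lim: "(\<lambda>n. \<Sum>k\<le>n. F k) \<longlonglongrightarrow> B"
    unfolding B_def using summable_LIMSEQ'[OF sF] .
  have "B * B = (\<Sum>k. \<Sum>i\<le>k. F i * F (k - i))"
    unfolding B_def by (rule Cauchy_product[OF nF nF])
  also have "\<dots> = (\<Sum>k. (if k = 0 then 1 else if k = 1 then -1 else 0) *\<^sub>R C ^ k)"
  proof (rule arg_cong[where f = suminf], rule ext)
    fix k
    have "(\<Sum>i\<le>k. F i * F (k - i)) = (\<Sum>i\<le>k. (sqrt_coeff i * sqrt_coeff (k - i)) *\<^sub>R C ^ k)"
      by (intro sum.cong refl) (simp add: F_def flip: power_add)
    then show "(\<Sum>i\<le>k. F i * F (k - i)) = (if k = 0 then 1 else if k = 1 then -1 else 0) *\<^sub>R C ^ k"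
      by (simp only: sqrt_coeff_convolution flip: scaleR_sum_left)
  qed
  also have "\<dots> = (\<Sum>k\<in>{0, 1}. (if k = 0 then 1 else if k = 1 then -1 else 0) *\<^sub>R C ^ k)"
    by (rule suminf_finite) auto
  also have "\<dots> = 1 - C"
    by simp
  finally have sq: "B * B = 1 - C" .
  have sa: "adj B = B"
  proof (rule adj_unique)
    fix x y
    have "(\<lambda>n. ip (app (\<Sum>k\<le>n. F k) x) y) \<longlonglongrightarrow> ip (app B x) y"
      by (intro tendsto_intros ip.tendsto app.tendsto lim)
    moreover have "(\<lambda>n. ip x (app (\<Sum>k\<le>n. F k) y)) \<longlonglongrightarrow> ip x (app B y)"
      by (intro tendsto_intros ip.tendsto app.tendsto lim)
    moreover have "ip (app (\<Sum>k\<le>n. F k) x) y = ip x (app (\<Sum>k\<le>n. F k) y)" for n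
      by (simp add: app.sum_left ip.sum_left ip.sum_right F_def app.scaleR_left ip.scaleR_left
          ip.scaleR_right ip_adj adj_power C(1))
    ultimately show "ip (app B x) y = ip x (app B y)"
      using LIMSEQ_unique by auto
  qed
  have pos: "0 \<le> ip (app B x) x" for x
  proof -
    have "(\<lambda>n. ip (app (\<Sum>k\<le>n. F k) x) x) \<longlonglongrightarrow> ip (app B x) x"
      by (intro tendsto_intros ip.tendsto app.tendsto lim)
    moreover have "0 \<le> ip (app (\<Sum>k\<le>n. F k) x) x" for n
    proof -
      have "0 \<le> (\<Sum>k\<le>n. sqrt_coeff k) * (norm x)\<^sup>2"
        using sum_sqrt_coeff_nonneg by simp
      also have "\<dots> = (\<Sum>k\<le>n. sqrt_coeff k * (norm x)\<^sup>2)"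
        by (simp add: sum_distrib_right)
      \<comment> \<open>Termwise: equality at \<open>k = 0\<close>; for larger \<open>k\<close> the
        coefficient is nonpositive, so it reverses the bound of \<open>ip (app (C ^ k) x) x\<close>
        by the square of \<open>norm x\<close>.\<close>
      also have "\<dots> \<le> (\<Sum>k\<le>n. sqrt_coeff k * ip (app (C ^ k) x) x)"
      proof (rule sum_mono)
        fix k
        have "ip (app (C ^ k) x) x \<le> norm (app (C ^ k) x) * norm x"
          using ip_Cauchy_Schwarz[of "app (C ^ k) x" x] by linarith
        also have "\<dots> \<le> (1 * norm x) * norm x"
          by (intro mult_right_mono order_trans[OF norm_app_le] norm_bop_power_le C) auto
        finally have "ip (app (C ^ k) x) x \<le> (norm x)\<^sup>2"
          by (simp add: power2_eq_square)
        then show "sqrt_coeff k * (norm x)\<^sup>2 \<le> sqrt_coeff k * ip (app (C ^ k) x) x"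
          by (cases k) (auto simp: sqrt_coeff_0 ip_self intro: mult_left_mono_neg sqrt_coeff_Suc_nonpos)
      qed
      also have "\<dots> = ip (app (\<Sum>k\<le>n. F k) x) x"
        by (simp add: app.sum_left ip.sum_left F_def app.scaleR_left ip.scaleR_left)
      finally show ?thesis .
    qed
    ultimately show ?thesis
      by (intro LIMSEQ_le_const) auto
  qed
  have comm: "T * B = B * T" if T: "T * C = C * T" for T
  proof -
    have "T * C ^ k = C ^ k * T" for k
      by (induction k) (auto simp: T simp flip: mult.assoc, simp add: T mult.assoc)
    then have "T * F k = F k * T" for k
      by (simp add: F_def)
    then show ?thesis
      unfolding B_def by (simp flip: suminf_mult[OF sF] suminf_mult2[OF sF])
  qed
  show thesis
    using that[OF sa sq pos comm] .
qed

subsection \<open>Spectral splitting of self-adjoint operators\<close>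

definition Proj :: "'a::chilbert_space set \<Rightarrow> 'a bop" where
  "Proj V = Bop (orth_proj V)"

context
  fixes V :: "'a::chilbert_space set"
  assumes V: "subspace V" "closed V"
begin

lemma app_Proj: "app (Proj V) = orth_proj V"
  unfolding Proj_def by (rule app_Bop[OF bounded_linear_orth_proj[OF V]])

lemma app_Proj_in: "app (Proj V) x \<in> V"
  by (simp add: app_Proj orth_proj_in[OF V])

lemma app_Proj_eq_iff: "app (Proj V) x = x \<longleftrightarrow> x \<in> V"
  using app_Proj_in[of x] by (auto simp: app_Proj orth_proj_fixes[OF V])

lemma adj_Proj: "adj (Proj V) = Proj V"
  by (rule adj_unique) (simp add: app_Proj orth_proj_selfadjoint[OF V])

lemma Proj_idem: "Proj V * Proj V = Proj V"
  by (rule bop_eqI) (simp add: app_Proj_eq_iff app_Proj_in)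

lemma Proj_commute:
  assumes "\<And>x. x \<in> V \<Longrightarrow> app T x \<in> V" "\<And>x. x \<in> V \<Longrightarrow> app (adj T) x \<in> V"
  shows "T * Proj V = Proj V * T"
proof (rule bop_eqI)
  fix x
  have "orth_proj V (app T x) = app T (orth_proj V x)"
  proof (rule orth_proj_unique[OF V])
    show "app T (orth_proj V x) \<in> V"
      by (intro assms orth_proj_in V)
    fix w
    assume "w \<in> V"
    then have "ip (x - orth_proj V x) (app (adj T) w) = 0"
      by (intro orth_proj_orth[OF V] assms)
    then show "ip (app T x - app T (orth_proj V x)) w = 0"
      by (simp only: ip_adj[symmetric] app.diff_right)
  qed
  then show "app (T * Proj V) x = app (Proj V * T) x"
    by (simp add: app_Proj)
qed

end

lemma subspace_app_kernel: "subspace {x. app T x = 0}"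
  by (auto simp: subspace_def app.zero_right app.add_right app.scaleR_right)

lemma closed_app_kernel: "closed {x. app T x = 0}"
  by (intro closed_Collect_eq continuous_intros linear_continuous_on app.bounded_linear_right)

text \<open>Here \<open>k\<close> times \<open>B\<close> is the absolute value |S|, and (|S| +
  S)(|S| - S) = S^2 - S^2 = 0. Let \<open>E\<close> project onto the kernel of |S| + S. On that
  kernel S = -|S|. The kernel contains the range of |S| - S, so on its orthogonal complement S =
  |S|. A spectral projection is thus obtained without a spectral measure, and it commutes with all
  that commutes with \<open>S\<close>.\<close>

lemma spectral_split:
  fixes S :: "'a::chilbert_space bop"
  assumes S: "adj S = S"
  obtains E where "adj E = E" "E * E = E"
    "\<And>T. T * S = S * T \<Longrightarrow> T * E = E * T"
    "\<And>x. app E x = x \<Longrightarrow> ip (app S x) x \<le> 0"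
    "\<And>x. app E x = 0 \<Longrightarrow> 0 \<le> ip (app S x) x"
proof -
  \<comment> \<open>The summand 1 keeps \<open>k\<close> positive for \<open>S = 0\<close>. The
    division by k^2 makes \<open>norm C \<le> 1\<close>, as the square root series requires.\<close>
  define k where "k = norm S + 1"
  have k: "k > 0" "norm S \<le> k"
    by (auto simp: k_def add_nonneg_pos)
  define C where "C = 1 - (1 / k\<^sup>2) *\<^sub>R (S * S)"
  have adjC: "adj C = C"
    by (simp add: C_def adj_diff adj_scaleR adj_times S)
  have "norm C \<le> 1"
  proof (rule norm_bop_bound)
    fix x
    define p where "p = app S x"
    have Sp: "(norm (app S p))\<^sup>2 \<le> k\<^sup>2 * (norm p)\<^sup>2"
    proof -
      have "norm (app S p) \<le> k * norm p"
        by (rule order_trans[OF norm_app_le]) (simp add: k mult_right_mono)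
      then show ?thesis
        by (metis norm_ge_zero power_mono power_mult_distrib)
    qed
    have "(norm (app C x))\<^sup>2 = (norm (x - (1 / k\<^sup>2) *\<^sub>R app S p))\<^sup>2"
      by (simp add: C_def app.diff_left app.scaleR_left p_def)
    also have "\<dots> = (norm x)\<^sup>2 - 2 * (1 / k\<^sup>2) * ip x (app S p) + (1 / k\<^sup>2)\<^sup>2 * (norm (app S p))\<^sup>2"
      by (simp add: norm_diff_sq ip.scaleR_right power_mult_distrib power_divide)
    also have "ip x (app S p) = (norm p)\<^sup>2"
      by (metis S ip_adj ip_self p_def)
    also have "(norm x)\<^sup>2 - 2 * (1 / k\<^sup>2) * (norm p)\<^sup>2 + (1 / k\<^sup>2)\<^sup>2 * (norm (app S p))\<^sup>2
        \<le> (norm x)\<^sup>2 - 2 * (1 / k\<^sup>2) * (norm p)\<^sup>2 + (1 / k\<^sup>2)\<^sup>2 * (k\<^sup>2 * (norm p)\<^sup>2)"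
      by (intro add_left_mono mult_left_mono Sp) simp
    also have "\<dots> = (norm x)\<^sup>2 - (1 / k\<^sup>2) * (norm p)\<^sup>2"
      using k by (simp add: field_simps power2_eq_square)
    also have "\<dots> \<le> (norm x)\<^sup>2"
      by simp
    finally show "norm (app C x) \<le> 1 * norm x"
      by (simp add: power2_le_iff_abs_le)
  qed simp
  with adjC obtain B where B: "adj B = B" "B * B = 1 - C" "\<And>x. 0 \<le> ip (app B x) x"
    "\<And>T. T * C = C * T \<Longrightarrow> T * B = B * T"
    using positive_sqrt_exists by blast
  have commB: "T * B = B * T" if "T * S = S * T" for T
  proof (rule B(4))
    have "T * (S * S) = (S * S) * T"
      by (metis that mult.assoc)
    then show "T * C = C * T"
      by (simp add: C_def algebra_simps)
  qed
  define D where "D = k *\<^sub>R B + S"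
  have adjD: "adj D = D"
    by (simp add: D_def adj_add adj_scaleR B S)
  have DD: "D * (k *\<^sub>R B - S) = 0"
    using k B(2) commB[of S] by (simp add: D_def C_def algebra_simps power2_eq_square)
  define N where "N = {x. app D x = 0}"
  have N: "subspace N" "closed N"
    by (simp_all add: N_def subspace_app_kernel closed_app_kernel)
  have inv: "app T x \<in> N" if "T * S = S * T" "x \<in> N" for T x
  proof -
    have "T * D = D * T"
      using that(1) commB[OF that(1)] by (simp add: D_def algebra_simps)
    then have "app D (app T x) = app T (app D x)"
      by (metis app_times)
    then show ?thesis
      using that(2) by (simp add: N_def app.zero_right)
  qed
  show thesis
  proof (rule that[of "Proj N"])
    show "adj (Proj N) = Proj N" "Proj N * Proj N = Proj N"
      by (simp_all add: adj_Proj Proj_idem N)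
    show "T * Proj N = Proj N * T" if T: "T * S = S * T" for T
    proof (rule Proj_commute[OF N])
      \<comment> \<open>Commuting with a projection needs invariance of its range under the adjoint
        too, which holds because \<open>S\<close> is self-adjoint.\<close>
      have "adj T * S = S * adj T"
        by (metis S T adj_times)
      then show "app (adj T) x \<in> N" if "x \<in> N" for x
        using inv that by blast
    qed (use inv T in blast)
    show "ip (app S x) x \<le> 0" if "app (Proj N) x = x" for x
    proof -
      have "app D x = 0"
        using that app_Proj_eq_iff[OF N, of x] unfolding N_def by blast
      then have "app S x = - (k *\<^sub>R app B x)"
        by (simp add: D_def app.add_left app.scaleR_left add_eq_0_iff)
      then show ?thesis
        using B(3)[of x] k by (simp add: ip.minus_left ip.scaleR_left)
    qed
    show "0 \<le> ip (app S x) x" if "app (Proj N) x = 0" for x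
    proof -
      let ?D' = "k *\<^sub>R B - S"
      have "ip x (app ?D' z) = 0" for z
      proof -
        have "app D (app ?D' z) = 0"
          by (metis DD app_times app.zero_left)
        then have "app ?D' z \<in> N"
          by (simp add: N_def)
        then show ?thesis
          using orth_proj_orth[OF N, of "app ?D' z" x] that by (simp add: app_Proj[OF N])
      qed
      then have "app (adj ?D') x = 0"
        by (metis ip_adj2 ip_self norm_eq_zero power_eq_0_iff)
      then have "app S x = k *\<^sub>R app B x"
        by (simp add: adj_diff adj_scaleR B S app.diff_left app.scaleR_left)
      then show ?thesis
        using B(3)[of x] k by (simp add: ip.scaleR_left)
    qed
  qed
qed

lemma norm_app_adj_normal:
  assumes "M * adj M = adj M * M"
  shows "norm (app (adj M) x) = norm (app M x)"
proof -
  have "(norm (app (adj M) x))\<^sup>2 = ip x (app (M * adj M) x)"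
    by (simp add: ip_self[symmetric] ip_adj2)
  also have "\<dots> = (norm (app M x))\<^sup>2"
    by (simp add: assms ip_self[symmetric] ip_adj)
  finally show ?thesis
    by simp
qed

text \<open>A lower bound gives injectivity and closed range. Normality gives \<open>adj M\<close>
  the same kernel as \<open>M\<close>, so nothing nonzero is orthogonal to the range.\<close>

lemma normal_bounded_below_invertible:
  fixes M :: "'a::chilbert_space bop"
  assumes M: "M * adj M = adj M * M" and e: "0 < e" "\<And>x. e * norm x \<le> norm (app M x)"
  obtains N where "N * M = 1" "M * N = 1"
proof -
  let ?V = "range (app M)"
  have inj: "x = 0" if "app M x = 0" for x
    using e(2)[of x] e(1) that by (simp add: mult_le_0_iff)
  have bl: "bounded_linear (app M)"
    by (rule app.bounded_linear_right)
  have lin: "linear (app M)"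
    by (rule bounded_linear.linear[OF bl])
  have V: "subspace ?V"
    by (rule linear_subspace_image[OF lin]) simp
  have cV: "closed ?V"
    using complete_isometric_image[OF e(1) subspace_UNIV bl] e(2)
    by (simp add: complete_UNIV complete_imp_closed)
  have surj: "x \<in> ?V" for x
  proof -
    define d where "d = x - orth_proj ?V x"
    have "ip d (app M z) = 0" for z
      unfolding d_def by (rule orth_proj_orth[OF V cV]) simp
    then have "app (adj M) d = 0"
      by (metis ip_adj2 ip_self norm_eq_zero power_eq_0_iff)
    then have "d = 0"
      using norm_app_adj_normal[OF M, of d] inj by simp
    then show ?thesis
      using orth_proj_in[OF V cV, of x] by (simp add: d_def)
  qed
  have "\<exists>f. \<forall>x. app M (f x) = x"
    using surj by (intro choice) (metis imageE)
  then obtain f where f: "\<And>x. app M (f x) = x"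
    by blast
  have cancel: "x = y" if "app M x = app M y" for x y
    using inj[of "x - y"] that by (simp add: app.diff_right)
  have blf: "bounded_linear f"
  proof (rule bounded_linear_intro[where K = "1 / e"])
    show "f (x + y) = f x + f y" for x y
      by (rule cancel) (simp add: f app.add_right)
    show "f (r *\<^sub>R x) = r *\<^sub>R f x" for r x
      by (rule cancel) (simp add: f app.scaleR_right)
    show "norm (f x) \<le> norm x * (1 / e)" for x
      using e(2)[of "f x"] e(1) by (simp add: f field_simps)
  qed
  show thesis
  proof (rule that[of "Bop f"])
    show "M * Bop f = 1"
      by (rule bop_eqI) (simp add: app_Bop[OF blf] f)
    show "Bop f * M = 1"
      by (rule bop_eqI) (simp add: app_Bop[OF blf], rule cancel, simp add: f)
  qed
qed

subsection \<open>The commutant of a commutative *-algebra of operators\<close>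

text \<open>The instance will be the complex group algebra. Real scalars suffice here, as the
  complex ones occur there as elements of \<open>U\<close>; membership in the commutant then
  includes complex linearity.\<close>

locale commutative_star_algebra =
  fixes U :: "'a::chilbert_space bop set"
  assumes U_one: "1 \<in> U"
    and U_add: "u \<in> U \<Longrightarrow> v \<in> U \<Longrightarrow> u + v \<in> U"
    and U_scaleR: "u \<in> U \<Longrightarrow> r *\<^sub>R u \<in> U"
    and U_mult: "u \<in> U \<Longrightarrow> v \<in> U \<Longrightarrow> u * v \<in> U"
    and U_comm: "u \<in> U \<Longrightarrow> v \<in> U \<Longrightarrow> u * v = v * u"
    and U_adj: "u \<in> U \<Longrightarrow> adj u \<in> U"
begin

lemma U_diff: "u \<in> U \<Longrightarrow> v \<in> U \<Longrightarrow> u - v \<in> U"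
  using U_add[of u "(-1) *\<^sub>R v"] U_scaleR[of v "-1"] by simp

lemma U_zero: "0 \<in> U"
  using U_scaleR[OF U_one, of 0] by simp

definition commutant :: "'a bop set" where
  "commutant = {T. \<forall>u\<in>U. T * u = u * T}"

lemma commutantD: "T \<in> commutant \<Longrightarrow> u \<in> U \<Longrightarrow> T * u = u * T"
  by (simp add: commutant_def)

lemma commutant_app: "T \<in> commutant \<Longrightarrow> u \<in> U \<Longrightarrow> app T (app u x) = app u (app T x)"
  by (metis app_times commutantD)

lemma commutant_one: "1 \<in> commutant"
  and commutant_zero: "0 \<in> commutant"
  and commutant_add: "S \<in> commutant \<Longrightarrow> T \<in> commutant \<Longrightarrow> S + T \<in> commutant"
  and commutant_diff: "S \<in> commutant \<Longrightarrow> T \<in> commutant \<Longrightarrow> S - T \<in> commutant"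
  by (simp_all add: commutant_def algebra_simps)

lemma commutant_mult: "S \<in> commutant \<Longrightarrow> T \<in> commutant \<Longrightarrow> S * T \<in> commutant"
  by (simp add: commutant_def) (metis mult.assoc)

lemma commutant_adj:
  assumes "T \<in> commutant"
  shows "adj T \<in> commutant"
  unfolding commutant_def
proof safe
  fix u
  assume "u \<in> U"
  then have "T * adj u = adj u * T"
    using assms U_adj commutantD by blast
  then have "adj (T * adj u) = adj (adj u * T)"
    by simp
  then show "adj T * u = u * adj T"
    by (simp add: adj_times)
qed

lemma Proj_in_commutant:
  assumes V: "subspace V" "closed V" and inv: "\<And>u x. u \<in> U \<Longrightarrow> x \<in> V \<Longrightarrow> app u x \<in> V"
  shows "Proj V \<in> commutant"
  unfolding commutant_def
  using Proj_commute[OF V] inv U_adj by fastforce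

definition orbit :: "'a \<Rightarrow> 'a set" where
  "orbit y = (\<lambda>u. app u y) ` U"

definition cyclic :: "'a \<Rightarrow> 'a set" where
  "cyclic y = closure (orbit y)"

lemma subspace_orbit: "subspace (orbit y)"
  unfolding subspace_def orbit_def
proof (intro conjI ballI allI)
  show "0 \<in> (\<lambda>u. app u y) ` U"
    using U_zero by (force simp: app.zero_left intro: image_eqI[where x = 0])
  show "a + b \<in> (\<lambda>u. app u y) ` U" if "a \<in> (\<lambda>u. app u y) ` U" "b \<in> (\<lambda>u. app u y) ` U" for a b
    using that by (auto simp flip: app.add_left intro: U_add)
  show "c *\<^sub>R a \<in> (\<lambda>u. app u y) ` U" if "a \<in> (\<lambda>u. app u y) ` U" for a c
    using that by (auto simp flip: app.scaleR_left intro: U_scaleR)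
qed

lemma cyclic_closed: "closed (cyclic y)"
  by (simp add: cyclic_def)

lemma cyclic_subspace: "subspace (cyclic y)"
  unfolding cyclic_def by (rule subspace_closure[OF subspace_orbit])

lemma orbit_subset_cyclic: "orbit y \<subseteq> cyclic y"
  by (simp add: cyclic_def closure_subset)

lemma app_in_cyclic: "u \<in> U \<Longrightarrow> app u y \<in> cyclic y"
  using orbit_subset_cyclic by (auto simp: orbit_def)

lemma self_in_cyclic: "y \<in> cyclic y"
  using app_in_cyclic[OF U_one, of y] by simp

lemma cyclic_invariant: "u \<in> U \<Longrightarrow> x \<in> cyclic y \<Longrightarrow> app u x \<in> cyclic y"
  unfolding cyclic_def
  by (rule app_in_closure) (use U_mult in \<open>auto simp: orbit_def simp flip: app_times\<close>)

lemma Proj_cyclic_commutant: "Proj (cyclic y) \<in> commutant"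
  by (rule Proj_in_commutant[OF cyclic_subspace cyclic_closed cyclic_invariant])

lemma cyclic_eqI:
  assumes x: "x \<in> cyclic y" "x' \<in> cyclic y"
    and eq: "\<And>h. h \<in> U \<Longrightarrow> ip x (app h y) = ip x' (app h y)"
  shows "x = x'"
proof -
  define d where "d = x - x'"
  have d: "d \<in> closure (orbit y)"
    using x cyclic_subspace subspace_diff unfolding d_def cyclic_def[symmetric] by blast
  have "closure (orbit y) \<subseteq> {z. ip d z = 0}"
  proof (rule closure_minimal)
    show "orbit y \<subseteq> {z. ip d z = 0}"
      using eq by (auto simp: orbit_def d_def ip.diff_left)
    show "closed {z. ip d z = 0}"
      by (intro closed_Collect_eq continuous_intros linear_continuous_on ip.bounded_linear_right)
  qed
  then have "ip d d = 0"
    using d by blast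
  then show ?thesis
    by (simp add: ip_self d_def)
qed

end

section \<open>The corner of the commutant at a cyclic subspace\<close>

locale cyclic_corner = commutative_star_algebra +
  fixes y :: 'a
begin

definition q :: "'a bop" where
  "q = Proj (cyclic y)"

definition corner :: "'a bop set" where
  "corner = {T \<in> commutant. q * T = T \<and> T * q = T}"

lemma q_commutant: "q \<in> commutant"
  by (simp add: q_def Proj_cyclic_commutant)

lemma q_idem: "q * q = q"
  by (simp add: q_def Proj_idem[OF cyclic_subspace cyclic_closed])

lemma adj_q: "adj q = q"
  by (simp add: q_def adj_Proj[OF cyclic_subspace cyclic_closed])

lemma app_q_in: "app q x \<in> cyclic y"
  by (simp add: q_def app_Proj_in[OF cyclic_subspace cyclic_closed])

lemma app_q_eq: "x \<in> cyclic y \<Longrightarrow> app q x = x"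
  by (simp add: q_def app_Proj_eq_iff[OF cyclic_subspace cyclic_closed])

lemma q_left_iff: "q * T = T \<longleftrightarrow> (\<forall>x. app T x \<in> cyclic y)"
  by (metis app_q_eq app_q_in app_times bop_eqI)

text \<open>Commuting with \<open>U\<close> fixes both operators on the orbit of \<open>y\<close>,
  which is dense in the range of \<open>q\<close>; both vanish on the orthogonal complement.\<close>

lemma eq_on_generator:
  assumes "S \<in> commutant" "T \<in> commutant" "S * q = S" "T * q = T" "app S y = app T y"
  shows "S = T"
proof (rule bop_eqI)
  fix x
  have "app S (app q x) = app T (app q x)"
  proof (rule app_eq_on_closure[of "orbit y"])
    show "app S z = app T z" if "z \<in> orbit y" for z
      using that assms by (auto simp: orbit_def commutant_app)
    show "app q x \<in> closure (orbit y)"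
      using app_q_in by (simp add: cyclic_def)
  qed
  then show "app S x = app T x"
    by (metis app_times assms(3,4))
qed

lemma corner_commutant: "T \<in> corner \<Longrightarrow> T \<in> commutant"
  and corner_left: "T \<in> corner \<Longrightarrow> q * T = T"
  and corner_right: "T \<in> corner \<Longrightarrow> T * q = T"
  by (simp_all add: corner_def)

lemma corner_app_in: "T \<in> corner \<Longrightarrow> app T x \<in> cyclic y"
  using corner_left q_left_iff by blast

lemma corner_q: "q \<in> corner"
  by (simp add: corner_def q_commutant q_idem)

lemma corner_add: "S \<in> corner \<Longrightarrow> T \<in> corner \<Longrightarrow> S + T \<in> corner"
  and corner_diff: "S \<in> corner \<Longrightarrow> T \<in> corner \<Longrightarrow> S - T \<in> corner"
  by (simp_all add: corner_def commutant_add commutant_diff algebra_simps)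

lemma corner_mult: "S \<in> corner \<Longrightarrow> T \<in> corner \<Longrightarrow> S * T \<in> corner"
  unfolding corner_def by (simp add: commutant_mult) (metis mult.assoc)

lemma corner_adj: "T \<in> corner \<Longrightarrow> adj T \<in> corner"
  unfolding corner_def using adj_times[of q T] adj_times[of T q] by (simp add: commutant_adj adj_q)

text \<open>If $u_n y \to T y$ with $u_n$ in the algebra, then normality of the $u_n$ forces
  $u_n^* y \to T^* y$; this replaces the $*$-strong approximation of $T$ by algebra elements.\<close>

lemma corner_approx:
  assumes T: "T \<in> corner"
  obtains u where "\<And>n. u n \<in> U" "(\<lambda>n. app (u n) y) \<longlonglongrightarrow> app T y"
    "(\<lambda>n. app (adj (u n)) y) \<longlonglongrightarrow> app (adj T) y"
proof -
  have "app T y \<in> closure (orbit y)"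
    using corner_app_in[OF T] by (simp add: cyclic_def)
  then obtain v where v: "\<And>n. v n \<in> orbit y" "v \<longlonglongrightarrow> app T y"
    unfolding closure_sequential by blast
  then have "\<forall>n. \<exists>u\<in>U. v n = app u y"
    by (auto simp: orbit_def)
  then obtain u where u: "\<And>n. u n \<in> U" "\<And>n. v n = app (u n) y"
    by metis
  have lim: "(\<lambda>n. app (u n) y) \<longlonglongrightarrow> app T y"
    using v(2) by (simp flip: u(2))
  have nrm: "norm (app (adj (u m)) y - app (adj (u n)) y) = norm (app (u m) y - app (u n) y)" for m n
  proof -
    have "(u m - u n) * adj (u m - u n) = adj (u m - u n) * (u m - u n)"
      by (intro U_comm U_adj U_diff u)
    from norm_app_adj_normal[OF this] show ?thesis
      by (simp add: adj_diff app.diff_left)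
  qed
  have "Cauchy (\<lambda>n. app (u n) y)"
    using lim by (rule LIMSEQ_imp_Cauchy)
  then have "Cauchy (\<lambda>n. app (adj (u n)) y)"
    unfolding Cauchy_def by (simp add: dist_norm nrm)
  then obtain w where w: "(\<lambda>n. app (adj (u n)) y) \<longlonglongrightarrow> w"
    using Cauchy_convergent convergent_def by blast
  have "w = app (adj T) y"
  proof (rule cyclic_eqI)
    show "w \<in> cyclic y"
      using closed_sequentially[OF cyclic_closed _ w] app_in_cyclic u U_adj by blast
    show "app (adj T) y \<in> cyclic y"
      using corner_app_in[OF corner_adj[OF T]] .
    fix h
    assume h: "h \<in> U"
    have "(\<lambda>n. ip (app (adj (u n)) y) (app h y)) \<longlonglongrightarrow> ip w (app h y)"
      by (intro tendsto_intros ip.tendsto w)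
    moreover have "(\<lambda>n. ip y (app h (app (u n) y))) \<longlonglongrightarrow> ip y (app h (app T y))"
      by (intro tendsto_intros ip.tendsto app.tendsto lim)
    moreover have "ip (app (adj (u n)) y) (app h y) = ip y (app h (app (u n) y))" for n
      using U_comm[OF u(1) h, of n] by (metis app_times ip_adj2)
    ultimately have "ip w (app h y) = ip y (app h (app T y))"
      using LIMSEQ_unique by auto
    also have "\<dots> = ip (app (adj T) y) (app h y)"
      by (simp add: ip_adj2 commutant_app[OF corner_commutant[OF T] h])
    finally show "ip w (app h y) = ip (app (adj T) y) (app h y)" .
  qed
  then show thesis
    using that u lim w by blast
qed

text \<open>By \<open>eq_on_generator\<close> and \<open>cyclic_eqI\<close> it suffices to compare
  the pairings of \<open>S T y\<close> and \<open>T S y\<close> with \<open>h y\<close>. Replace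
  \<open>T y\<close> by the limit of \<open>u n y\<close>, move \<open>u n\<close> to the other
  side, where its adjoint commutes with \<open>h\<close> and \<open>adj S\<close>, and use that
  \<open>adj (u n) y\<close> tends to \<open>adj T y\<close>.\<close>

lemma corner_comm:
  assumes S: "S \<in> corner" and T: "T \<in> corner"
  shows "S * T = T * S"
proof (rule eq_on_generator)
  note ST = corner_mult[OF S T] and TS = corner_mult[OF T S]
  show "S * T \<in> commutant" "T * S \<in> commutant" "S * T * q = S * T" "T * S * q = T * S"
    using ST TS corner_commutant corner_right by blast+
  obtain u where u: "\<And>n. u n \<in> U" "(\<lambda>n. app (u n) y) \<longlonglongrightarrow> app T y"
    "(\<lambda>n. app (adj (u n)) y) \<longlonglongrightarrow> app (adj T) y"
    using corner_approx[OF T] by blast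
  have S': "adj S \<in> commutant" and T': "adj T \<in> commutant"
    using S T corner_adj corner_commutant by blast+
  show "app (S * T) y = app (T * S) y"
  proof (rule cyclic_eqI)
    fix h
    assume h: "h \<in> U"
    have "(\<lambda>n. ip (app (u n) y) (app (adj S) (app h y))) \<longlonglongrightarrow> ip (app T y) (app (adj S) (app h y))"
      by (intro tendsto_intros ip.tendsto u)
    moreover have "(\<lambda>n. ip y (app (adj S) (app h (app (adj (u n)) y))))
        \<longlonglongrightarrow> ip y (app (adj S) (app h (app (adj T) y)))"
      by (intro tendsto_intros ip.tendsto app.tendsto u)
    moreover have "ip (app (u n) y) (app (adj S) (app h y)) = ip y (app (adj S) (app h (app (adj (u n)) y)))" for n
    proof -
      have "app (adj (u n)) (app (adj S) (app h y)) = app (adj S) (app h (app (adj (u n)) y))"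
        using commutant_app[OF S' U_adj[OF u(1)]] U_comm[OF U_adj[OF u(1)] h] by (metis app_times)
      then show ?thesis
        by (simp add: ip_adj)
    qed
    ultimately have "ip (app T y) (app (adj S) (app h y)) = ip y (app (adj S) (app h (app (adj T) y)))"
      using LIMSEQ_unique by auto
    moreover have "app (adj T) (app h y) = app h (app (adj T) y)"
      by (rule commutant_app[OF T' h])
    ultimately show "ip (app (S * T) y) (app h y) = ip (app (T * S) y) (app h y)"
      by (simp add: ip_adj)
  qed (use corner_app_in ST TS in blast)+
qed

end

context cyclic_corner
begin

text \<open>The required \<open>t\<close> is the spectral projection of \<open>adj a * a\<close> for a small
  interval at 0: on its range \<open>a\<close> is small, so that \<open>a + (q - a * u)\<close> is close to
  \<open>q\<close>; on its kernel \<open>a\<close> is bounded below.\<close>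

lemma corner_stable_range:
  assumes a: "a \<in> corner" and u: "u \<in> corner"
  obtains t d where "t \<in> corner" "d \<in> corner"
    "(a + (q - a * u) * t) * d = q" "d * (a + (q - a * u) * t) = q"
proof -
  \<comment> \<open>Both constants serve one estimate: where the norm of \<open>a\<close> is at most
    \<open>e\<close>, the perturbation \<open>(q - u) * a\<close> has norm at most
    \<open>c * e = 1 / 2\<close>.\<close>
  define c where "c = norm (q - u) + 1"
  have c: "c \<ge> 1" "norm (q - u) \<le> c"
    by (auto simp: c_def)
  define e where "e = 1 / (2 * c)"
  have e: "0 < e" "e \<le> 1 / 2" "c * e = 1 / 2"
    using c by (auto simp: e_def field_simps)
  \<comment> \<open>The quadratic form of \<open>S\<close> is nonpositive at \<open>x\<close>
    exactly when \<open>norm (app a x) \<le> e * norm x\<close>.\<close>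
  define S where "S = adj a * a - e\<^sup>2 *\<^sub>R 1"
  have ip_S: "ip (app S x) x = (norm (app a x))\<^sup>2 - e\<^sup>2 * (norm x)\<^sup>2" for x
    by (simp add: S_def app.diff_left app.scaleR_left ip.diff_left ip.scaleR_left ip_adj2 ip_self)
  have "adj S = S"
    by (simp add: S_def adj_diff adj_times adj_scaleR)
  then obtain E where E: "adj E = E" "E * E = E" "\<And>T. T * S = S * T \<Longrightarrow> T * E = E * T"
    "\<And>x. app E x = x \<Longrightarrow> ip (app S x) x \<le> 0" "\<And>x. app E x = 0 \<Longrightarrow> 0 \<le> ip (app S x) x"
    using spectral_split by blast
  have a': "adj a * a \<in> corner"
    using a corner_adj corner_mult by blast
  \<comment> \<open>\<open>E\<close> commutes with whatever commutes with \<open>adj a * a\<close>,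
    and commutativity of the corner puts all its elements among these.\<close>
  have E_corner: "T * E = E * T" if "T \<in> corner" for T
    using corner_comm[OF that a'] by (intro E(3)) (simp add: S_def algebra_simps)
  have "E \<in> commutant"
    unfolding commutant_def
  proof safe
    fix v
    assume "v \<in> U"
    then have "v * (adj a * a) = (adj a * a) * v"
      using commutantD[OF corner_commutant[OF a']] by simp
    then have "v * E = E * v"
      by (intro E(3)) (simp add: S_def algebra_simps)
    then show "E * v = v * E"
      by simp
  qed
  define t where "t = q * E"
  have qE: "q * E = E * q"
    using E_corner[OF corner_q] .
  have t: "t \<in> corner"
    unfolding corner_def t_def using q_commutant \<open>E \<in> commutant\<close> commutant_mult q_idem qE
    by (simp, metis mult.assoc)
  define m where "m = a + (q - a * u) * t"
  have m: "m \<in> corner"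
    unfolding m_def by (intro corner_add corner_mult corner_diff corner_q a u t)
  have below: "e * norm h \<le> norm (app m h)" if h: "app q h = h" for h
  proof -
    define h1 h2 where "h1 = app t h" and "h2 = h - h1"
    have h1: "h1 = app E h"
      using h by (simp add: h1_def t_def qE)
    have q1: "app q h1 = h1"
      by (metis app_times corner_left h1_def t)
    have q2: "app q h2 = h2"
      by (simp add: h2_def app.diff_right h q1)
    have E1: "app E h1 = h1"
      by (metis app_times E(2) h1)
    have E2: "app E h2 = 0"
      by (simp add: h2_def app.diff_right E1 flip: h1)
    have t1: "app t h1 = h1" and t2: "app t h2 = 0"
      using q1 q2 E1 E2 by (simp_all add: t_def app.zero_right)
    \<comment> \<open>Where \<open>t\<close> is the identity, \<open>m\<close> is
      \<open>a + q - a * u = q + (q - u) * a\<close>, again by commutativity of the corner.\<close>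
    have m1: "app m h1 = h1 + app (q - u) (app a h1)"
    proof -
      have "app m h1 = app a h1 + (app q h1 - app (a * u) h1)"
        by (simp add: m_def app.add_left app.diff_left t1)
      also have "app (a * u) h1 = app u (app a h1)"
        by (simp add: corner_comm[OF a u])
      finally have "app m h1 = app a h1 + (app q h1 - app u (app a h1))" .
      moreover have "app q (app a h1) = app a h1"
        by (metis app_times corner_left[OF a])
      ultimately show ?thesis
        by (simp add: app.diff_left q1)
    qed
    have m2: "app m h2 = app a h2"
      by (simp add: m_def app.add_left t2 app.zero_right)
    have "norm (app a h1) \<le> e * norm h1"
    proof -
      have "(norm (app a h1))\<^sup>2 \<le> (e * norm h1)\<^sup>2"
        using E(4)[OF E1] by (simp add: ip_S power_mult_distrib)
      then show ?thesis
        using e by (simp add: power2_le_iff_abs_le)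
    qed
    then have "norm (q - u) * norm (app a h1) \<le> c * (e * norm h1)"
      using c by (intro mult_mono) auto
    then have "norm (app (q - u) (app a h1)) \<le> c * (e * norm h1)"
      using norm_app_le order_trans by blast
    then have "norm (app (q - u) (app a h1)) \<le> norm h1 / 2"
      using e(3) by (simp add: mult.assoc[symmetric])
    moreover have "norm h1 \<le> norm (app m h1) + norm (app (q - u) (app a h1))"
      using norm_triangle_ineq4[of "app m h1" "app (q - u) (app a h1)"] by (simp add: m1)
    ultimately have "norm h1 / 2 \<le> norm (app m h1)"
      by linarith
    moreover have "e * norm h1 \<le> norm h1 / 2"
      using e(2) mult_right_mono[of e "1/2" "norm h1"] by simp
    ultimately have b1: "e * norm h1 \<le> norm (app m h1)"
      by linarith
    have b2: "e * norm h2 \<le> norm (app m h2)"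
    proof -
      have "(e * norm h2)\<^sup>2 \<le> (norm (app a h2))\<^sup>2"
        using E(5)[OF E2] by (simp add: ip_S power_mult_distrib)
      then show ?thesis
        by (simp add: m2 power2_le_iff_abs_le)
    qed
    have orth: "ip h1 h2 = 0"
      by (metis E(1) E1 E2 ip_adj ip.zero_right)
    \<comment> \<open>As \<open>m\<close> commutes with \<open>E\<close>, the images of
      \<open>h1\<close> and \<open>h2\<close> remain orthogonal, so their separate lower bounds add
      up by Pythagoras.\<close>
    have "app E (app m h1) = app m h1" "app E (app m h2) = 0"
      using E_corner[OF m] by (metis app_times E1, metis app_times E2 app.zero_right)
    then have orth': "ip (app m h1) (app m h2) = 0"
      by (metis E(1) ip_adj ip.zero_right)
    have hh: "h = h1 + h2"
      by (simp add: h2_def)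
    have "(e * norm h)\<^sup>2 = (e * norm h1)\<^sup>2 + (e * norm h2)\<^sup>2"
      by (simp add: hh norm_add_sq orth power_mult_distrib algebra_simps)
    also have "\<dots> \<le> (norm (app m h1))\<^sup>2 + (norm (app m h2))\<^sup>2"
      using b1 b2 e by (intro add_mono power_mono) auto
    also have "\<dots> = (norm (app m h))\<^sup>2"
      by (simp add: hh app.add_right norm_add_sq orth')
    finally show ?thesis
      by (simp add: power2_le_iff_abs_le)
  qed
  \<comment> \<open>Extending \<open>m\<close> by the identity on the orthogonal complement of
    \<open>L\<close> gives a normal operator bounded below on the whole space. The inverse of
    \<open>m\<close> in the corner is then \<open>q\<close> times the inverse of
    \<open>M\<close>.\<close>
  define M where "M = m + (1 - q)"
  have mq: "m * q = m" "q * m = m"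
    using m corner_left corner_right by blast+
  have mm: "m * adj m = adj m * m"
    by (intro corner_comm corner_adj m)
  have m'q: "adj m * q = adj m" "q * adj m = adj m"
    using m corner_adj corner_left corner_right by blast+
  have adjM: "adj M = adj m + (1 - q)"
    by (simp add: M_def adj_add adj_diff adj_q)
  have normal: "M * adj M = adj M * M"
    unfolding adjM by (simp add: M_def algebra_simps mm mq m'q)
  have Mbelow: "e * norm x \<le> norm (app M x)" for x
  proof -
    define x1 x2 where "x1 = app q x" and "x2 = x - x1"
    have q1: "app q x1 = x1"
      by (metis app_times q_idem x1_def)
    have q2: "app q x2 = 0"
      by (simp add: x2_def app.diff_right q1 flip: x1_def)
    have "app M x = app m x1 + x2"
    proof -
      have "app m x1 = app m x"
        by (metis app_times mq(1) x1_def)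
      then show ?thesis
        by (simp add: M_def app.add_left app.diff_left x2_def flip: x1_def)
    qed
    moreover have "ip (app m x1) x2 = 0"
      by (metis adj_q app_times ip.zero_right ip_adj mq(2) q2)
    moreover have "ip x1 x2 = 0"
      by (metis adj_q ip.zero_right ip_adj q1 q2)
    moreover have "x = x1 + x2"
      by (simp add: x2_def)
    ultimately have eq: "(norm (app M x))\<^sup>2 = (norm (app m x1))\<^sup>2 + (norm x2)\<^sup>2"
      "(norm x)\<^sup>2 = (norm x1)\<^sup>2 + (norm x2)\<^sup>2"
      by (simp_all add: norm_add_sq)
    have "(e * norm x)\<^sup>2 = (e * norm x1)\<^sup>2 + (e * norm x2)\<^sup>2"
      by (simp add: power_mult_distrib eq algebra_simps)
    also have "\<dots> \<le> (norm (app m x1))\<^sup>2 + (norm x2)\<^sup>2"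
      using below[OF q1] e mult_right_mono[of e 1 "norm x2"] by (intro add_mono power_mono) auto
    finally show ?thesis
      by (simp add: power2_le_iff_abs_le flip: eq(1))
  qed
  obtain N where N: "N * M = 1" "M * N = 1"
    using normal_bounded_below_invertible[OF normal e(1) Mbelow] by blast
  have commN: "T * N = N * T" if "T * M = M * T" for T
  proof -
    have "T * N = N * (M * T) * N"
      using N(1) by (simp flip: mult.assoc)
    also have "\<dots> = N * T"
      using N(2) by (simp add: mult.assoc flip: that)
    finally show ?thesis .
  qed
  have "M \<in> commutant"
    unfolding M_def by (intro commutant_add commutant_diff commutant_one q_commutant corner_commutant[OF m])
  then have "N \<in> commutant"
    using commN by (simp add: commutant_def)
  have qM: "q * M = m" "M * q = m"
    by (simp_all add: M_def algebra_simps mq q_idem)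
  have qN: "q * N = N * q"
    by (rule commN) (simp add: qM)
  define d where "d = q * N"
  have d: "d \<in> corner"
    unfolding corner_def d_def using q_commutant \<open>N \<in> commutant\<close> commutant_mult q_idem qN
    by (simp, metis mult.assoc)
  have "m * d = q"
  proof -
    have "m * d = (m * q) * N"
      by (simp add: d_def mult.assoc)
    also have "\<dots> = q * (M * N)"
      by (simp only: mq(1)) (simp only: qM(1)[symmetric] mult.assoc)
    finally show ?thesis
      by (simp add: N)
  qed
  moreover from this have "d * m = q"
    using corner_comm[OF m d] by simp
  ultimately show thesis
    using that[OF t d] by (simp add: m_def)
qed

end

subsection \<open>Cancellation over a corner of stable range one\<close>

text \<open>Stable range one for the ring \<open>q R q\<close> with unit \<open>q\<close>: if
  \<open>a * u + b = q\<close>, then some \<open>a + b * t\<close> is a unit. The element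
  \<open>b\<close> is written as \<open>q - a * u\<close>.\<close>

locale stable_range_corner =
  fixes R :: "'r::ring set" and q :: 'r
  assumes R_zero: "0 \<in> R" and R_add: "a \<in> R \<Longrightarrow> b \<in> R \<Longrightarrow> a + b \<in> R"
    and R_diff: "a \<in> R \<Longrightarrow> b \<in> R \<Longrightarrow> a - b \<in> R"
    and R_mult: "a \<in> R \<Longrightarrow> b \<in> R \<Longrightarrow> a * b \<in> R"
    and stable_range: "\<lbrakk>a \<in> R; q * a = a; a * q = a; u \<in> R; q * u = u; u * q = u\<rbrakk> \<Longrightarrow>
      \<exists>t\<in>R. \<exists>d\<in>R. t * q = t \<and> q * t = t \<and> d * q = d \<and> q * d = d
        \<and> (a + (q - a * u) * t) * d = q \<and> d * (a + (q - a * u) * t) = q"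
begin

text \<open>The range of \<open>E\<close> is split as \<open>L\<close> plus \<open>K\<close> and as
  \<open>L\<close> plus \<open>N\<close>, with inclusions \<open>i\<close>, \<open>i'\<close>,
  coordinate maps \<open>f\<close>, \<open>f'\<close>, and complements given by \<open>k\<close>,
  \<open>n\<close>. If a single subspace is complementary to both \<open>K\<close> and
  \<open>N\<close>, the projections along it give mutually inverse maps between them. The range of
  \<open>c\<close> is such a subspace: it is the graph over the first copy of \<open>L\<close> of a
  map into \<open>K\<close>, chosen so that \<open>f' * c\<close> is invertible.\<close>

lemma cancellation:
  assumes f: "f \<in> R" "q * f = f" and i: "i \<in> R" "i * q = i" and fi: "f * i = q"
    and f': "f' \<in> R" "q * f' = f'" and i': "i' \<in> R" "i' * q = i'" and fi': "f' * i' = q"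
    and k: "k \<in> R" "k * k = k" "f * k = 0" "k * i = 0"
    and n: "n \<in> R" "n * n = n" "f' * n = 0" "n * i' = 0"
    and eq: "i * f + k = i' * f' + n"
  obtains \<theta> \<eta> where "\<theta> \<in> R" "\<eta> \<in> R" "\<theta> * \<eta> = k" "\<eta> * \<theta> = n"
proof -
  define E where "E = i * f + k"
  have E': "E = i' * f' + n"
    by (simp add: E_def eq)
  have fE: "f * E = f"
    by (simp add: E_def distrib_left fi k f flip: mult.assoc)
  have f'E: "f' * E = f'"
    by (simp add: E' distrib_left fi' n f' flip: mult.assoc)
  have Ek: "E * k = k" "k * E = k"
    by (simp_all add: E_def distrib_left distrib_right mult.assoc k) (simp add: k flip: mult.assoc)
  have En: "E * n = n" "n * E = n"
    by (simp_all add: E' distrib_left distrib_right mult.assoc n) (simp add: n flip: mult.assoc)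
  have ER: "E \<in> R"
    by (simp add: E_def R_add R_mult f i k)
  define a u where "a = f' * i" and "u = f * i'"
  have b: "q - a * u = f' * k * i'"
  proof -
    have "q = f' * E * i'"
      by (simp add: f'E fi')
    then show ?thesis
      by (simp add: E_def a_def u_def algebra_simps)
  qed
  obtain t d where td: "t \<in> R" "d \<in> R" "t * q = t" "q * t = t" "d * q = d" "q * d = d"
    "(a + f' * k * i' * t) * d = q" "d * (a + f' * k * i' * t) = q"
    using stable_range[of a u, unfolded b] f f' i i'
    by (auto simp: a_def u_def R_mult mult.assoc) (auto simp flip: mult.assoc)
  \<comment> \<open>The graph of \<open>k * i' * t\<close>. Adding terms in \<open>K\<close> keeps
    \<open>f * c = q\<close>, while \<open>f' * c\<close> becomes the unit supplied by the stable
    range condition.\<close>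
  define c where "c = i + k * i' * t"
  have c: "c \<in> R" "c * q = c"
    by (simp_all add: c_def R_add R_mult i i' k td distrib_right mult.assoc)
  have fc: "f * c = q"
    by (simp add: c_def distrib_left fi k flip: mult.assoc)
  have f'c: "f' * c * d = q" "d * (f' * c) = q"
    using td(7,8) by (simp_all add: c_def a_def distrib_left mult.assoc)
  have Ei: "E * i = i"
    by (simp add: E_def distrib_right mult.assoc fi i k)
  have Ec: "E * c = c"
    by (simp add: c_def distrib_left Ei Ek flip: mult.assoc)
  have EE: "E * E = E"
  proof -
    have "E * E = i * (f * E) + k * E"
      by (simp only: E_def[THEN arg_cong[where f = "\<lambda>x. x * E"]] distrib_right mult.assoc)
    also have "\<dots> = E"
      by (simp only: fE Ek) (simp add: E_def)
    finally show ?thesis .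
  qed
  \<comment> \<open>On the range of \<open>E\<close>, \<open>P\<close> and \<open>Q\<close> are the
    projections along the range of \<open>c\<close> onto \<open>K\<close> and \<open>N\<close>;
    \<open>c * d\<close> is a right inverse of \<open>f'\<close>, with the same range as
    \<open>c\<close>.\<close>
  define P Q where "P = E - c * f" and "Q = E - c * d * f'"
  have Pk: "P * k = k"
    by (simp add: P_def left_diff_distrib Ek k mult.assoc)
  have Qn: "Q * n = n"
    by (simp add: Q_def left_diff_distrib En n mult.assoc)
  have EP: "E * P = P" and EQ: "E * Q = Q"
    by (simp_all add: P_def Q_def right_diff_distrib EE Ec flip: mult.assoc)
  have PE: "P * E = P" and QE: "Q * E = Q"
    by (simp_all add: P_def Q_def left_diff_distrib EE fE f'E mult.assoc)
  have kP: "k * P = P"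
  proof -
    have "f * P = 0"
      by (simp add: P_def right_diff_distrib fE fc f flip: mult.assoc)
    then have "E * P = k * P"
      by (simp add: E_def distrib_right mult.assoc)
    then show ?thesis
      by (simp add: EP)
  qed
  have nQ: "n * Q = Q"
  proof -
    have "f' * Q = f' - f' * c * d * f'"
      by (simp add: Q_def right_diff_distrib f'E mult.assoc)
    then have "f' * Q = 0"
      by (simp add: f'c f')
    then have "E * Q = n * Q"
      by (simp add: E' distrib_right mult.assoc)
    then show ?thesis
      by (simp add: EQ)
  qed
  have Pc: "P * c = 0"
    by (simp add: P_def left_diff_distrib mult.assoc fc c Ec)
  have Qc: "Q * c = 0"
    using f'c(2) by (simp add: Q_def left_diff_distrib mult.assoc c Ec)
  show thesis
  proof (rule that)
    show "P * n \<in> R" "Q * k \<in> R"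
      by (simp_all add: P_def Q_def R_diff R_mult ER c f f' td n k)
    have "P * n * (Q * k) = P * (n * Q) * k"
      by (simp add: mult.assoc)
    also have "\<dots> = P * E * k - P * c * d * f' * k"
      by (simp only: nQ) (simp add: Q_def algebra_simps)
    also have "\<dots> = k"
      by (simp add: PE Pc Pk)
    finally show "P * n * (Q * k) = k" .
    have "Q * k * (P * n) = Q * (k * P) * n"
      by (simp add: mult.assoc)
    also have "\<dots> = Q * E * n - Q * c * f * n"
      by (simp only: kP) (simp add: P_def algebra_simps)
    also have "\<dots> = n"
      by (simp add: QE Qc Qn)
    finally show "Q * k * (P * n) = n" .
  qed
qed

text \<open>Unlike the redundant frames of Hilbert space theory, this is a basis: the
  \<open>\<alpha> j\<close> embed copies of \<open>L\<close> into the range of \<open>p\<close>, and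
  the \<open>\<beta> j\<close> are the biorthogonal coordinate maps.\<close>

definition frame :: "nat \<Rightarrow> (nat \<Rightarrow> 'r) \<Rightarrow> (nat \<Rightarrow> 'r) \<Rightarrow> 'r \<Rightarrow> bool" where
  "frame m \<alpha> \<beta> p \<longleftrightarrow> (\<forall>j<m. \<alpha> j \<in> R \<and> \<alpha> j * q = \<alpha> j \<and> \<beta> j \<in> R \<and> q * \<beta> j = \<beta> j)
     \<and> (\<forall>i<m. \<forall>j<m. \<beta> i * \<alpha> j = (if i = j then q else 0))
     \<and> p = (\<Sum>j<m. \<alpha> j * \<beta> j)"

lemma sum_in_R: "(\<And>j. j \<in> A \<Longrightarrow> f j \<in> R) \<Longrightarrow> sum f A \<in> R"
  by (induction A rule: infinite_finite_induct) (auto intro: R_zero R_add)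

lemma frame_in_R: "frame m \<alpha> \<beta> p \<Longrightarrow> p \<in> R"
  by (auto simp: frame_def intro: sum_in_R R_mult)

lemma frame_mult_left:
  assumes "frame m \<alpha> \<beta> p" "j < m"
  shows "p * \<alpha> j = \<alpha> j"
proof -
  have "p * \<alpha> j = (\<Sum>i<m. \<alpha> i * (\<beta> i * \<alpha> j))"
    using assms by (simp add: frame_def sum_distrib_right mult.assoc)
  also have "\<dots> = (\<Sum>i<m. if i = j then \<alpha> j else 0)"
    using assms by (intro sum.cong) (auto simp: frame_def)
  finally show ?thesis
    using assms by simp
qed

lemma frame_mult_right:
  assumes "frame m \<alpha> \<beta> p" "j < m"
  shows "\<beta> j * p = \<beta> j"
proof -
  have "p = (\<Sum>i<m. \<alpha> i * \<beta> i)"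
    using assms by (simp add: frame_def)
  then have "\<beta> j * p = (\<Sum>i<m. (\<beta> j * \<alpha> i) * \<beta> i)"
    by (simp only: sum_distrib_left mult.assoc)
  also have "\<dots> = (\<Sum>i<m. if i = j then \<beta> j else 0)"
    using assms by (intro sum.cong) (auto simp: frame_def)
  finally show ?thesis
    using assms by simp
qed

lemma frame_idem:
  assumes "frame m \<alpha> \<beta> p"
  shows "p * p = p"
proof -
  have "p * p = (\<Sum>j<m. (p * \<alpha> j) * \<beta> j)"
    using assms by (simp add: frame_def sum_distrib_left mult.assoc)
  also have "\<dots> = (\<Sum>j<m. \<alpha> j * \<beta> j)"
    by (intro sum.cong) (simp_all add: frame_mult_left[OF assms])
  finally show ?thesis
    using assms by (simp add: frame_def)
qed

lemma frame_Suc: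
  assumes "frame (Suc m) \<alpha> \<beta> p"
  obtains p' where "frame m \<alpha> \<beta> p'" "p = \<alpha> m * \<beta> m + p'" "\<beta> m * p' = 0" "p' * \<alpha> m = 0"
proof -
  define p' where "p' = (\<Sum>j<m. \<alpha> j * \<beta> j)"
  have "frame m \<alpha> \<beta> p'"
    using assms by (auto simp: frame_def p'_def)
  moreover have "p = \<alpha> m * \<beta> m + p'"
    using assms by (simp add: frame_def p'_def add.commute)
  moreover have "\<beta> m * p' = (\<Sum>j<m. (\<beta> m * \<alpha> j) * \<beta> j)"
    by (simp add: p'_def sum_distrib_left mult.assoc)
  moreover have "\<dots> = 0"
    using assms by (intro sum.neutral) (auto simp: frame_def)
  moreover have "p' * \<alpha> m = (\<Sum>j<m. \<alpha> j * (\<beta> j * \<alpha> m))"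
    by (simp add: p'_def sum_distrib_right mult.assoc)
  moreover have "\<dots> = 0"
    using assms by (intro sum.neutral) (auto simp: frame_def)
  ultimately show thesis
    using that by simp
qed

text \<open>Induction on \<open>r\<close>. One copy of \<open>L\<close> is removed from the
  decomposition by \<open>v\<close> and \<open>w\<close> and one from the frame of \<open>p\<close>;
  \<open>cancellation\<close> identifies the remainders \<open>k = v' + w\<close> and
  \<open>n\<close>, and the frame of \<open>n\<close> is carried over to \<open>k\<close>. At
  \<open>r = 0\<close> nothing is left beside \<open>w\<close>.\<close>

theorem complement_frame:
  assumes "frame r x x' v" "frame s \<alpha> \<beta> p" "r \<le> s" "p = v + w"
    "w \<in> R" "w * w = w" "v * w = 0" "w * v = 0"
  shows "\<exists>\<gamma> \<gamma>'. frame (s - r) \<gamma> \<gamma>' w"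
  using assms
proof (induction r arbitrary: s \<alpha> \<beta> p v)
  case 0
  have "p = w"
    using 0(1,4) by (simp add: frame_def)
  with 0(2) have "frame (s - 0) \<alpha> \<beta> w"
    by simp
  then show ?case
    by blast
next
  case (Suc r)
  obtain s' where s: "s = Suc s'"
    using Suc.prems(3) by (cases s) auto
  obtain v' where v': "frame r x x' v'" "v = x r * x' r + v'" "x' r * v' = 0" "v' * x r = 0"
    using frame_Suc[OF Suc.prems(1)] by blast
  obtain n where n: "frame s' \<alpha> \<beta> n" "p = \<alpha> s' * \<beta> s' + n" "\<beta> s' * n = 0" "n * \<alpha> s' = 0"
    using frame_Suc Suc.prems(2) unfolding s by blast
  note v = frame_mult_left[OF Suc.prems(1), of r] frame_mult_right[OF Suc.prems(1), of r]
  have xw: "x' r * w = 0"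
  proof -
    have "x' r * w = x' r * (v * w)"
      by (simp add: v flip: mult.assoc)
    then show ?thesis
      by (simp add: Suc.prems)
  qed
  have wx: "w * x r = 0"
  proof -
    have "w * x r = (w * v) * x r"
      by (simp add: v mult.assoc)
    then show ?thesis
      by (simp add: Suc.prems)
  qed
  have v'w: "v' * w = 0"
    using Suc.prems(7) by (simp add: v'(2) distrib_right mult.assoc xw)
  have wv': "w * v' = 0"
    using Suc.prems(8) by (simp add: v'(2) distrib_left wx flip: mult.assoc)
  define k where "k = v' + w"
  have kR: "k \<in> R"
    using frame_in_R[OF v'(1)] Suc.prems(5) by (simp add: k_def R_add)
  have kk: "k * k = k"
    by (simp add: k_def distrib_left distrib_right frame_idem[OF v'(1)] v'w wv' Suc.prems)
  obtain \<theta> \<eta> where \<theta>: "\<theta> \<in> R" "\<eta> \<in> R" "\<theta> * \<eta> = k" "\<eta> * \<theta> = n"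
  proof (rule cancellation)
    show "x r * x' r + k = \<alpha> s' * \<beta> s' + n"
      using Suc.prems(4) v'(2) n(2) by (simp add: k_def add.assoc)
    show "k \<in> R" "k * k = k"
      by (fact kR kk)+
    show "x' r * k = 0" "k * x r = 0"
      by (simp_all add: k_def distrib_left distrib_right v' xw wx)
    show "n \<in> R" "n * n = n" "\<beta> s' * n = 0" "n * \<alpha> s' = 0"
      using frame_in_R[OF n(1)] frame_idem[OF n(1)] n by auto
  qed (use Suc.prems(1,2) in \<open>auto simp: frame_def s\<close>)
  \<comment> \<open>Transport along the isomorphism given by \<open>\<theta>\<close> and
    \<open>\<eta>\<close>; biorthogonality survives because \<open>\<eta> * \<theta> = n\<close>
    acts as the identity on each \<open>\<alpha> j\<close>.\<close>
  define \<alpha>' \<beta>' where "\<alpha>' j = \<theta> * \<alpha> j" and "\<beta>' j = \<beta> j * \<eta>" for j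
  have "frame s' \<alpha>' \<beta>' k"
    unfolding frame_def
  proof (intro conjI allI impI)
    fix j
    assume j: "j < s'"
    show "\<alpha>' j \<in> R" "\<alpha>' j * q = \<alpha>' j" "\<beta>' j \<in> R"
      using n(1) j \<theta> by (auto simp: \<alpha>'_def \<beta>'_def frame_def R_mult mult.assoc)
    show "q * \<beta>' j = \<beta>' j"
      using n(1) j by (simp add: \<beta>'_def frame_def flip: mult.assoc)
    fix i
    assume i: "i < s'"
    have "\<beta>' i * \<alpha>' j = \<beta> i * ((\<eta> * \<theta>) * \<alpha> j)"
      by (simp add: \<alpha>'_def \<beta>'_def mult.assoc)
    also have "\<dots> = \<beta> i * \<alpha> j"
      by (simp only: \<theta>(4) frame_mult_left[OF n(1) j])
    finally show "\<beta>' i * \<alpha>' j = (if i = j then q else 0)"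
      using n(1) i j by (simp add: frame_def)
  next
    have "k = k * k"
      by (simp add: kk)
    also have "\<dots> = \<theta> * (\<eta> * \<theta>) * \<eta>"
      by (simp add: \<theta>(3)[symmetric] mult.assoc)
    also have "\<dots> = \<theta> * n * \<eta>"
      by (simp only: \<theta>(4))
    also have "\<dots> = (\<Sum>j<s'. \<alpha>' j * \<beta>' j)"
      using n(1) by (simp add: frame_def \<alpha>'_def \<beta>'_def sum_distrib_left sum_distrib_right mult.assoc)
    finally show "k = (\<Sum>j<s'. \<alpha>' j * \<beta>' j)" .
  qed
  then have "\<exists>\<gamma> \<gamma>'. frame (s' - r) \<gamma> \<gamma>' w"
    using Suc.prems(3,5,6) s by (intro Suc.IH[OF v'(1) _ _ k_def _ _ v'w wv']) auto
  then show ?case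
    by (simp add: s)
qed

end

subsection \<open>Bounded oblique projections and extension by density\<close>

text \<open>An open mapping argument for the addition map from \<open>V \<times> W\<close> onto the
  closed sum \<open>E\<close>: Baire's theorem gives approximate splittings with a uniform bound,
  and iteration on the error makes them exact.\<close>

lemma direct_sum_projection_bound:
  fixes V W :: "'a::banach set"
  assumes V: "subspace V" "closed V" and W: "subspace W" "closed W"
    and VW: "V \<inter> W = {0}" and closed: "closed {v + w | v w. v \<in> V \<and> w \<in> W}"
  obtains C where "0 \<le> C" "\<And>v w. v \<in> V \<Longrightarrow> w \<in> W \<Longrightarrow> norm v \<le> C * norm (v + w)"
proof -
  define E where "E = {v + w | v w. v \<in> V \<and> w \<in> W}"
  have E: "subspace E"
    unfolding E_def by (rule subspace_sums[OF V(1) W(1)])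
  have cE: "closed E"
    using closed by (simp add: E_def)
  define S where "S n = {v + w | v w. v \<in> V \<and> w \<in> W \<and> norm v \<le> real n}" for n :: nat
  have SE: "closure (S n) \<subseteq> E" for n
    by (rule closure_minimal[OF _ cE]) (auto simp: S_def E_def)
  have ES: "E = (\<Union>n. closure (S n))"
  proof
    show "E \<subseteq> (\<Union>n. closure (S n))"
    proof
      fix x
      assume "x \<in> E"
      then obtain v w where vw: "x = v + w" "v \<in> V" "w \<in> W"
        by (auto simp: E_def)
      obtain n where "norm v \<le> real n"
        using real_arch_simple by blast
      then have "x \<in> S n"
        using vw by (auto simp: S_def)
      then show "x \<in> (\<Union>n. closure (S n))"
        using closure_subset by blast
    qed
  qed (use SE in blast)
  have "\<exists>n. top_of_set E interior_of closure (S n) \<noteq> {}"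
  proof (rule ccontr)
    assume "\<not> (\<exists>n. top_of_set E interior_of closure (S n) \<noteq> {})"
    moreover have "closedin (top_of_set E) (closure (S n))" for n
      by (rule closed_subset[OF SE closed_closure])
    ultimately have "top_of_set E interior_of \<Union>(range (\<lambda>n. closure (S n))) = {}"
      by (intro Baire_category_alt disjI1 completely_metrizable_space_closedin
          completely_metrizable_space_euclidean)
        (auto simp: cE)
    then have "top_of_set E interior_of E = {}"
      by (simp flip: ES)
    then show False
      using E subspace_0[of E] interior_of_topspace[of "top_of_set E"] by auto
  qed
  then obtain n x0 T where T: "openin (top_of_set E) T" "x0 \<in> T" "T \<subseteq> closure (S n)"
    unfolding interior_of_def by blast
  then obtain \<rho> where \<rho>: "\<rho> > 0" "ball x0 \<rho> \<inter> E \<subseteq> T"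
    unfolding openin_contains_ball by blast
  have x0: "x0 \<in> E" "x0 \<in> closure (S n)"
    using T SE by blast+
  \<comment> \<open>Two bounds \<open>n\<close> give \<open>norm (v1 - v2) \<le> 2 * n\<close>, and
    rescaling multiplies by \<open>1 / c\<close>, which is 2 / \<open>\<rho>\<close> times
    \<open>norm z\<close>.\<close>
  define K where "K = 4 * real n / \<rho>"
  have K: "K \<ge> 0"
    using \<rho> by (simp add: K_def)
  have step: "\<exists>v w. v \<in> V \<and> w \<in> W \<and> norm v \<le> K * norm z \<and> norm (z - (v + w)) \<le> norm z / 2"
    if z: "z \<in> E" for z
  proof (cases "z = 0")
    case True
    then show ?thesis
      using V(1) W(1) subspace_0 by (intro exI[of _ 0]) auto
  next
    case False
    \<comment> \<open>Then \<open>c *\<^sub>R z\<close> has norm \<open>\<rho> / 2\<close>, so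
      \<open>x0 + c *\<^sub>R z\<close> stays in the ball. The two approximations within
      \<open>\<rho> / 8\<close> cost \<open>\<rho> / 4\<close>, which rescales to half of
      \<open>norm z\<close>.\<close>
    define c where "c = \<rho> / (2 * norm z)"
    have c: "c > 0"
      using False \<rho> by (simp add: c_def)
    have "norm (c *\<^sub>R z) = \<rho> / 2"
      using False \<rho> by (simp add: c_def)
    then have "x0 + c *\<^sub>R z \<in> ball x0 \<rho> \<inter> E"
      using \<rho> z E x0 by (auto simp: dist_norm intro!: subspace_add subspace_scale)
    then have "x0 + c *\<^sub>R z \<in> closure (S n)"
      using \<rho> T by blast
    then obtain a where a: "a \<in> S n" "dist a (x0 + c *\<^sub>R z) < \<rho> / 8"
      using \<rho> unfolding closure_approachable by (meson divide_pos_pos zero_less_numeral)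
    obtain b where b: "b \<in> S n" "dist b x0 < \<rho> / 8"
      using x0(2) \<rho> unfolding closure_approachable by (meson divide_pos_pos zero_less_numeral)
    obtain v1 w1 where 1: "a = v1 + w1" "v1 \<in> V" "w1 \<in> W" "norm v1 \<le> real n"
      using a(1) by (auto simp: S_def)
    obtain v2 w2 where 2: "b = v2 + w2" "v2 \<in> V" "w2 \<in> W" "norm v2 \<le> real n"
      using b(1) by (auto simp: S_def)
    define v w where "v = (1 / c) *\<^sub>R (v1 - v2)" and "w = (1 / c) *\<^sub>R (w1 - w2)"
    have "v \<in> V" "w \<in> W"
      unfolding v_def w_def using 1 2 V W by (auto intro!: subspace_scale subspace_diff)
    moreover have "norm v \<le> K * norm z"
    proof -
      have "norm (v1 - v2) \<le> 2 * real n"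
        using norm_triangle_ineq4[of v1 v2] 1 2 by linarith
      then have "norm v \<le> (1 / c) * (2 * real n)"
        unfolding v_def using c by (simp add: divide_right_mono)
      also have "\<dots> = K * norm z"
        using False \<rho> by (simp add: K_def c_def)
      finally show ?thesis .
    qed
    moreover have "norm (z - (v + w)) \<le> norm z / 2"
    proof -
      have "v + w = (1 / c) *\<^sub>R (a - b)"
        by (simp add: v_def w_def 1 2 algebra_simps)
      then have "z - (v + w) = (1 / c) *\<^sub>R ((x0 + c *\<^sub>R z - a) - (x0 - b))"
        using c by (simp add: algebra_simps)
      then have "norm (z - (v + w)) = (1 / c) * norm ((x0 + c *\<^sub>R z - a) - (x0 - b))"
        using c by (simp only: norm_scaleR) simp
      also have "\<dots> \<le> (1 / c) * (\<rho> / 4)"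
      proof (rule mult_left_mono)
        show "norm ((x0 + c *\<^sub>R z - a) - (x0 - b)) \<le> \<rho> / 4"
          using norm_triangle_ineq4[of "x0 + c *\<^sub>R z - a" "x0 - b"] a(2) b(2)
          by (simp add: dist_norm norm_minus_commute)
      qed (use c in simp)
      also have "\<dots> = norm z / 2"
        using False \<rho> by (simp add: c_def)
      finally show ?thesis .
    qed
    ultimately show ?thesis
      by blast
  qed
  then obtain fv fw where f: "\<And>z. z \<in> E \<Longrightarrow> fv z \<in> V" "\<And>z. z \<in> E \<Longrightarrow> fw z \<in> W"
    "\<And>z. z \<in> E \<Longrightarrow> norm (fv z) \<le> K * norm z"
    "\<And>z. z \<in> E \<Longrightarrow> norm (z - (fv z + fw z)) \<le> norm z / 2"
    by metis
  have split: "\<exists>v\<in>V. z - v \<in> W \<and> norm v \<le> (2 * K) * norm z" if z: "z \<in> E" for z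
  proof -
    \<comment> \<open>The successive errors. They at least halve in norm, so the \<open>V\<close>
      parts form a series dominated by a geometric one with sum
      \<open>2 * K * norm z\<close>.\<close>
    define Z where "Z = rec_nat z (\<lambda>_ z. z - (fv z + fw z))"
    have Z0: "Z 0 = z" and ZS: "Z (Suc k) = Z k - (fv (Z k) + fw (Z k))" for k
      by (simp_all add: Z_def)
    have ZE: "Z k \<in> E" for k
    proof (induction k)
      case (Suc k)
      have "fv (Z k) + fw (Z k) \<in> E"
        using f(1)[OF Suc] f(2)[OF Suc] unfolding E_def by blast
      then show ?case
        using Suc E by (simp add: ZS subspace_diff)
    qed (simp add: Z0 z)
    have Zn: "norm (Z k) \<le> (1/2) ^ k * norm z" for k
    proof (induction k)
      case (Suc k)
      then show ?case
        using f(4)[OF ZE[of k]] by (simp add: ZS)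
    qed (simp add: Z0)
    have sumg: "(\<lambda>k. K * ((1/2) ^ k * norm z)) sums (K * (2 * norm z))"
      using geometric_sums[of "1/2 :: real"] by (intro sums_mult sums_mult2) simp
    have vbound: "norm (fv (Z k)) \<le> K * ((1/2) ^ k * norm z)" for k
      using f(3)[OF ZE[of k]] mult_left_mono[OF Zn[of k] K] by linarith
    have sumv: "summable (\<lambda>k. norm (fv (Z k)))"
      by (rule summable_comparison_test[OF _ sums_summable[OF sumg]]) (use vbound in auto)
    define v where "v = (\<Sum>k. fv (Z k))"
    have limv: "(\<lambda>m. \<Sum>k<m. fv (Z k)) \<longlonglongrightarrow> v"
      unfolding v_def by (rule summable_LIMSEQ[OF summable_norm_cancel[OF sumv]])
    have "norm v \<le> (\<Sum>k. norm (fv (Z k)))"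
      unfolding v_def by (rule summable_norm[OF sumv])
    also have "\<dots> \<le> K * (2 * norm z)"
      using suminf_le[OF vbound sumv sums_summable[OF sumg]] sums_unique[OF sumg] by simp
    finally have nv: "norm v \<le> (2 * K) * norm z"
      by simp
    have "(\<Sum>k<m. fv (Z k)) \<in> V" for m
      using f(1) ZE V(1) by (intro subspace_sum) auto
    then have vV: "v \<in> V"
      using closed_sequentially[OF V(2) _ limv] by blast
    have tel: "(\<Sum>k<m. fw (Z k)) = z - Z m - (\<Sum>k<m. fv (Z k))" for m
      by (induction m) (simp_all add: Z0 ZS)
    have "Z \<longlonglongrightarrow> 0"
    proof (rule Lim_null_comparison)
      show "\<forall>\<^sub>F k in sequentially. norm (Z k) \<le> (1/2) ^ k * norm z"
        using Zn by simp
      have "(\<lambda>k. (1/2) ^ k * norm z) \<longlonglongrightarrow> 0 * norm z"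
        by (intro tendsto_intros LIMSEQ_realpow_zero) auto
      then show "(\<lambda>k. (1/2) ^ k * norm z) \<longlonglongrightarrow> 0"
        by simp
    qed
    then have "(\<lambda>m. z - Z m - (\<Sum>k<m. fv (Z k))) \<longlonglongrightarrow> z - 0 - v"
      by (intro tendsto_intros limv)
    then have limw: "(\<lambda>m. \<Sum>k<m. fw (Z k)) \<longlonglongrightarrow> z - v"
      by (simp add: tel)
    have "(\<Sum>k<m. fw (Z k)) \<in> W" for m
      using f(2) ZE W(1) by (intro subspace_sum) auto
    then have "z - v \<in> W"
      using closed_sequentially[OF W(2) _ limw] by blast
    with vV nv show ?thesis
      by blast
  qed
  show thesis
  proof (rule that[of "2 * K"])
    show "norm v \<le> 2 * K * norm (v + w)" if vw: "v \<in> V" "w \<in> W" for v w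
    proof -
      have "v + w \<in> E"
        using vw by (auto simp: E_def)
      then obtain v' where v': "v' \<in> V" "v + w - v' \<in> W" "norm v' \<le> 2 * K * norm (v + w)"
        using split by blast
      have "(v + w - v') - w \<in> W"
        using v'(2) vw(2) W(1) by (simp only: subspace_diff)
      then have "v - v' \<in> W"
        by simp
      moreover have "v - v' \<in> V"
        using v'(1) vw(1) V(1) by (simp add: subspace_diff)
      ultimately have "v - v' \<in> {0}"
        unfolding VW[symmetric] by blast
      then have "v = v'"
        by simp
      with v'(3) show ?thesis
        by simp
    qed
  qed (use K in simp)
qed

text \<open>Continuous extension to the closure, then by zero to the orthogonal complement. The
  second part is recorded as an equation because it becomes \<open>T * q = T\<close> when
  \<open>D\<close> is an orbit.\<close>

lemma bop_extension:
  fixes f :: "'a::chilbert_space \<Rightarrow> 'a"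
  assumes D: "subspace D"
    and add: "\<And>x y. x \<in> D \<Longrightarrow> y \<in> D \<Longrightarrow> f (x + y) = f x + f y"
    and scale: "\<And>r x. x \<in> D \<Longrightarrow> f (r *\<^sub>R x) = r *\<^sub>R f x"
    and bound: "\<And>x. x \<in> D \<Longrightarrow> norm (f x) \<le> C * norm x"
  obtains T where "\<And>x. x \<in> D \<Longrightarrow> app T x = f x" "T * Proj (closure D) = T"
proof -
  have cD: "subspace (closure D)" "closed (closure D)"
    using subspace_closure[OF D] by auto
  have diff: "f (x - y) = f x - f y" if "x \<in> D" "y \<in> D" for x y
    using add[of x "(-1) *\<^sub>R y"] scale[of y "-1"] that D by (simp add: subspace_scale subspace_neg)
  have "\<bar>C\<bar>-lipschitz_on D f"
  proof (rule lipschitz_onI)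
    fix x y
    assume xy: "x \<in> D" "y \<in> D"
    then have "norm (f x - f y) \<le> C * norm (x - y)"
      using bound[of "x - y"] D by (simp add: diff subspace_diff)
    also have "\<dots> \<le> \<bar>C\<bar> * norm (x - y)"
      by (simp add: mult_right_mono)
    finally show "dist (f x) (f y) \<le> \<bar>C\<bar> * dist x y"
      by (simp add: dist_norm)
  qed simp
  then have "uniformly_continuous_on D f"
    by (rule lipschitz_on_uniformly_continuous)
  then obtain g where "uniformly_continuous_on (closure D) g" and gf: "\<And>x. x \<in> D \<Longrightarrow> f x = g x"
    by (rule uniformly_continuous_on_extension_on_closure) (rule that, assumption, simp)
  then have "continuous_on (closure D) g"
    by (simp add: uniformly_continuous_imp_continuous)
  then have lim: "(\<lambda>n. f (h n)) \<longlonglongrightarrow> g x" if "h \<longlonglongrightarrow> x" "x \<in> closure D" "\<And>n. h n \<in> D" for h x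
    using that closure_subset[of D] by (auto simp: continuous_on_sequentially gf o_def)
  have approx: "\<exists>h. h \<longlonglongrightarrow> x \<and> (\<forall>n. h n \<in> D)" if "x \<in> closure D" for x
    using that unfolding closure_sequential by blast
  have gadd: "g (x + y) = g x + g y" if xy: "x \<in> closure D" "y \<in> closure D" for x y
  proof -
    obtain h k where h: "h \<longlonglongrightarrow> x" "\<And>n. h n \<in> D" and k: "k \<longlonglongrightarrow> y" "\<And>n. k n \<in> D"
      using approx xy by metis
    have "(\<lambda>n. f (h n + k n)) \<longlonglongrightarrow> g (x + y)"
      using h k D cD xy by (intro lim tendsto_intros) (auto intro: subspace_add)
    moreover have "(\<lambda>n. f (h n) + f (k n)) \<longlonglongrightarrow> g x + g y"
      using h k xy by (intro lim tendsto_intros) auto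
    ultimately show ?thesis
      using LIMSEQ_unique by (simp add: add h k)
  qed
  have gscale: "g (r *\<^sub>R x) = r *\<^sub>R g x" if x: "x \<in> closure D" for r x
  proof -
    obtain h where h: "h \<longlonglongrightarrow> x" "\<And>n. h n \<in> D"
      using approx x by metis
    have "(\<lambda>n. f (r *\<^sub>R h n)) \<longlonglongrightarrow> g (r *\<^sub>R x)"
      using h D cD x by (intro lim tendsto_intros) (auto intro: subspace_scale)
    moreover have "(\<lambda>n. r *\<^sub>R f (h n)) \<longlonglongrightarrow> r *\<^sub>R g x"
      using h x by (intro lim tendsto_intros) auto
    ultimately show ?thesis
      using LIMSEQ_unique by (simp add: scale h)
  qed
  have gbound: "norm (g x) \<le> C * norm x" if x: "x \<in> closure D" for x
  proof -
    obtain h where h: "h \<longlonglongrightarrow> x" "\<And>n. h n \<in> D"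
      using approx x by metis
    have "(\<lambda>n. norm (f (h n))) \<longlonglongrightarrow> norm (g x)"
      using h x by (intro lim tendsto_intros) auto
    moreover have "(\<lambda>n. C * norm (h n)) \<longlonglongrightarrow> C * norm x"
      by (intro tendsto_intros h)
    ultimately show ?thesis
      by (rule LIMSEQ_le) (use bound h in blast)
  qed
  let ?P = "Proj (closure D)"
  have "bounded_linear (\<lambda>x. g (app ?P x))"
  proof (rule bounded_linear_intro[where K = "\<bar>C\<bar>"])
    show "g (app ?P (x + y)) = g (app ?P x) + g (app ?P y)" for x y
      by (simp add: app.add_right gadd app_Proj_in[OF cD])
    show "g (app ?P (r *\<^sub>R x)) = r *\<^sub>R g (app ?P x)" for r x
      by (simp add: app.scaleR_right gscale app_Proj_in[OF cD])
    show "norm (g (app ?P x)) \<le> norm x * \<bar>C\<bar>" for x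
    proof -
      have "norm (g (app ?P x)) \<le> C * norm (app ?P x)"
        by (rule gbound[OF app_Proj_in[OF cD]])
      also have "\<dots> \<le> \<bar>C\<bar> * norm x"
        using norm_orth_proj_le[OF cD, of x] by (intro mult_mono) (auto simp: app_Proj[OF cD])
      finally show ?thesis
        by (simp add: mult.commute)
    qed
  qed
  note bl = app_Bop[OF this]
  show thesis
  proof (rule that[of "Bop (\<lambda>x. g (app ?P x))"])
    show "app (Bop (\<lambda>x. g (app ?P x))) x = f x" if "x \<in> D" for x
      using that closure_subset app_Proj_eq_iff[OF cD, of x] by (auto simp: bl gf)
    show "Bop (\<lambda>x. g (app ?P x)) * ?P = Bop (\<lambda>x. g (app ?P x))"
    proof (rule bop_eqI)
      have "app ?P (app ?P x) = app ?P x" for x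
        by (simp add: app_Proj_eq_iff[OF cD] app_Proj_in[OF cD])
      then show "app (Bop (\<lambda>x. g (app ?P x)) * ?P) x = app (Bop (\<lambda>x. g (app ?P x))) x" for x
        by (simp add: bl)
    qed
  qed
qed

subsection \<open>Riesz bases and the group algebra\<close>

text \<open>Riesz expansions need not converge absolutely, so their unordered sums are obtained from
  completeness along the filter of finite subsets.\<close>

lemma summable_on_Cauchy_criterion:
  fixes f :: "'i \<Rightarrow> 'b::banach"
  assumes "\<And>e. 0 < e \<Longrightarrow> \<exists>F0. finite F0 \<and> F0 \<subseteq> A \<and>
    (\<forall>F. finite F \<and> F0 \<subseteq> F \<and> F \<subseteq> A \<longrightarrow> norm (sum f (F - F0)) < e)"
  shows "f summable_on A"
proof -
  have "\<exists>P. eventually P (finite_subsets_at_top A) \<and> (\<forall>F1 F2. P F1 \<and> P F2 \<longrightarrow> dist (sum f F1) (sum f F2) < e)"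
    if e: "0 < e" for e
  proof -
    obtain F0 where F0: "finite F0" "F0 \<subseteq> A"
      and *: "\<And>F. finite F \<Longrightarrow> F0 \<subseteq> F \<Longrightarrow> F \<subseteq> A \<Longrightarrow> norm (sum f (F - F0)) < e / 2"
      using assms[of "e / 2"] e by auto
    define P where "P F \<longleftrightarrow> finite F \<and> F0 \<subseteq> F \<and> F \<subseteq> A" for F
    have "eventually P (finite_subsets_at_top A)"
      using F0 by (auto simp: eventually_finite_subsets_at_top P_def)
    moreover have "dist (sum f F1) (sum f F2) < e" if "P F1 \<and> P F2" for F1 F2
    proof -
      have "sum f F1 - sum f F0 = sum f (F1 - F0)" "sum f F2 - sum f F0 = sum f (F2 - F0)"
        using that by (auto simp: P_def intro!: sum_diff[symmetric])
      then have "dist (sum f F1) (sum f F0) < e / 2" "dist (sum f F2) (sum f F0) < e / 2"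
        using * that by (auto simp: P_def dist_norm)
      then show ?thesis
        by (rule dist_triangle_half_l)
    qed
    ultimately show ?thesis
      by blast
  qed
  then have "cauchy_filter (filtermap (sum f) (finite_subsets_at_top A))"
    by (simp add: cauchy_filter_metric_filtermap)
  moreover have "complete (UNIV :: 'b set)"
    by (rule complete_UNIV)
  ultimately obtain L where "(sum f \<longlongrightarrow> L) (finite_subsets_at_top A)"
    using complete_uniform[where S = UNIV] by (force simp add: filterlim_def)
  then show ?thesis
    using summable_on_def has_sum_def by blast
qed

lemma scaleC_zero_left [simp]: "0 *\<^sub>C x = (0 :: 'a::complex_vector)"
  using scaleR_scaleC[of 0 x] by simp

lemma riesz_basis_finite_bounds:
  fixes v :: "'i \<Rightarrow> 'a::chilbert_space"
  assumes "riesz_basis_for v J V"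
  obtains A B where "0 < A" "\<And>F c. finite F \<Longrightarrow> F \<subseteq> J \<Longrightarrow>
      A * (\<Sum>n\<in>F. (cmod (c n))\<^sup>2) \<le> (norm (\<Sum>n\<in>F. c n *\<^sub>C v n))\<^sup>2 \<and>
      (norm (\<Sum>n\<in>F. c n *\<^sub>C v n))\<^sup>2 \<le> B * (\<Sum>n\<in>F. (cmod (c n))\<^sup>2)"
proof -
  from assms obtain A B where A: "0 < A"
    and *: "\<And>a. (\<lambda>n. (cmod (a n))\<^sup>2) summable_on J \<Longrightarrow>
           (\<exists>s. ((\<lambda>n. a n *\<^sub>C v n) has_sum s) J \<and>
              A * (\<Sum>\<^sub>\<infinity>n\<in>J. (cmod (a n))\<^sup>2) \<le> (norm s)\<^sup>2 \<and>
              (norm s)\<^sup>2 \<le> B * (\<Sum>\<^sub>\<infinity>n\<in>J. (cmod (a n))\<^sup>2))"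
    unfolding riesz_basis_for_def by blast
  show thesis
  proof (rule that[OF A])
    fix F and c :: "'i \<Rightarrow> complex"
    assume F: "finite F" "F \<subseteq> J"
    define a where "a n = (if n \<in> F then c n else 0)" for n
    have 1: "((\<lambda>n. (cmod (a n))\<^sup>2) has_sum (\<Sum>n\<in>F. (cmod (c n))\<^sup>2)) J"
      using F by (intro has_sum_finite_neutralI[of F]) (auto simp: a_def)
    have 2: "((\<lambda>n. a n *\<^sub>C v n) has_sum (\<Sum>n\<in>F. c n *\<^sub>C v n)) J"
      using F by (intro has_sum_finite_neutralI[of F]) (auto simp: a_def)
    from *[OF has_sum_imp_summable[OF 1]] obtain s where s: "((\<lambda>n. a n *\<^sub>C v n) has_sum s) J"
      "A * (\<Sum>\<^sub>\<infinity>n\<in>J. (cmod (a n))\<^sup>2) \<le> (norm s)\<^sup>2"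
      "(norm s)\<^sup>2 \<le> B * (\<Sum>\<^sub>\<infinity>n\<in>J. (cmod (a n))\<^sup>2)"
      by blast
    have "s = (\<Sum>n\<in>F. c n *\<^sub>C v n)"
      using has_sum_unique[OF s(1) 2] .
    with s infsumI[OF 1]
    show "A * (\<Sum>n\<in>F. (cmod (c n))\<^sup>2) \<le> (norm (\<Sum>n\<in>F. c n *\<^sub>C v n))\<^sup>2 \<and>
      (norm (\<Sum>n\<in>F. c n *\<^sub>C v n))\<^sup>2 \<le> B * (\<Sum>n\<in>F. (cmod (c n))\<^sup>2)"
      by simp
  qed
qed

text \<open>With \<open>riesz_basis_finite_bounds\<close>, this reduces Riesz bases to inequalities
  for finite sums. The upper bound, applied to \<open>F - F0\<close>, provides the Cauchy property;
  both bounds then pass to the limit.\<close>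

lemma riesz_basis_forI:
  fixes v :: "'i \<Rightarrow> 'a::chilbert_space"
  assumes J: "countable J" and V: "V = ccspan (v ` J)" and AB: "0 < A" "A \<le> B"
    and lower: "\<And>F c. finite F \<Longrightarrow> F \<subseteq> J \<Longrightarrow>
      A * (\<Sum>n\<in>F. (cmod (c n))\<^sup>2) \<le> (norm (\<Sum>n\<in>F. c n *\<^sub>C v n))\<^sup>2"
    and upper: "\<And>F c. finite F \<Longrightarrow> F \<subseteq> J \<Longrightarrow>
      (norm (\<Sum>n\<in>F. c n *\<^sub>C v n))\<^sup>2 \<le> B * (\<Sum>n\<in>F. (cmod (c n))\<^sup>2)"
  shows "riesz_basis_for v J V"
  unfolding riesz_basis_for_def
proof (intro conjI J V, rule exI[of _ A], rule exI[of _ B], intro conjI AB allI impI)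
  fix a :: "'i \<Rightarrow> complex"
  define N where "N n = (cmod (a n))\<^sup>2" for n
  assume "(\<lambda>n. (cmod (a n))\<^sup>2) summable_on J"
  then have N: "(N has_sum infsum N J) J"
    by (simp add: N_def[abs_def] has_sum_infsum)
  have "(\<lambda>n. a n *\<^sub>C v n) summable_on J"
  proof (rule summable_on_Cauchy_criterion)
    fix e :: real
    assume e: "0 < e"
    define d where "d = e\<^sup>2 / (2 * B)"
    have d: "0 < d"
      using e AB by (simp add: d_def)
    obtain F0 where F0: "finite F0" "F0 \<subseteq> J" "dist (sum N F0) (infsum N J) \<le> d"
      using has_sum_finite_approximation[OF N d] by blast
    have "norm (\<Sum>n\<in>F - F0. a n *\<^sub>C v n) < e" if F: "finite F" "F0 \<subseteq> F" "F \<subseteq> J" for F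
    proof -
      have "sum N F \<le> infsum N J"
        by (rule finite_sum_le_has_sum[OF N F(1,3)]) (simp add: N_def)
      moreover have "sum N (F - F0) = sum N F - sum N F0"
        using F by (intro sum_diff) auto
      ultimately have "sum N (F - F0) \<le> d"
        using F0(3) by (simp add: dist_real_def)
      have "(norm (\<Sum>n\<in>F - F0. a n *\<^sub>C v n))\<^sup>2 \<le> B * sum N (F - F0)"
        unfolding N_def using F by (intro upper) auto
      also have "\<dots> \<le> B * d"
        using AB \<open>sum N (F - F0) \<le> d\<close> by (intro mult_left_mono) auto
      also have "\<dots> < e\<^sup>2"
        using AB e by (simp add: d_def)
      finally show ?thesis
        using e by (meson less_eq_real_def power_less_imp_less_base)
    qed
    then show "\<exists>F0. finite F0 \<and> F0 \<subseteq> J \<and>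
      (\<forall>F. finite F \<and> F0 \<subseteq> F \<and> F \<subseteq> J \<longrightarrow> norm (\<Sum>n\<in>F - F0. a n *\<^sub>C v n) < e)"
      using F0 by blast
  qed
  then obtain s where s: "((\<lambda>n. a n *\<^sub>C v n) has_sum s) J"
    using summable_on_def by blast
  have lims: "((\<lambda>F. (norm (\<Sum>n\<in>F. a n *\<^sub>C v n))\<^sup>2) \<longlongrightarrow> (norm s)\<^sup>2) (finite_subsets_at_top J)"
    using s unfolding has_sum_def by (intro tendsto_intros)
  have limN: "((\<lambda>F. c * sum N F) \<longlongrightarrow> c * infsum N J) (finite_subsets_at_top J)" for c
    using N unfolding has_sum_def by (intro tendsto_intros)
  have "A * infsum N J \<le> (norm s)\<^sup>2"
    by (rule tendsto_le[OF _ lims limN])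
      (auto intro!: eventually_finite_subsets_at_top_weakI lower simp: N_def)
  moreover have "(norm s)\<^sup>2 \<le> B * infsum N J"
    by (rule tendsto_le[OF _ limN lims])
      (auto intro!: eventually_finite_subsets_at_top_weakI upper simp: N_def)
  ultimately show "\<exists>s. ((\<lambda>n. a n *\<^sub>C v n) has_sum s) J \<and>
      A * (\<Sum>\<^sub>\<infinity>n\<in>J. (cmod (a n))\<^sup>2) \<le> (norm s)\<^sup>2 \<and>
      (norm s)\<^sup>2 \<le> B * (\<Sum>\<^sub>\<infinity>n\<in>J. (cmod (a n))\<^sup>2)"
    using s by (auto simp: N_def[abs_def])
qed

section \<open>Complex scalars, unitaries and complex spans\<close>

definition scaleop :: "complex \<Rightarrow> 'a::complex_inner bop" where
  "scaleop c = Bop ((*\<^sub>C) c)"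

lemma bounded_linear_scaleC: "bounded_linear (\<lambda>x::'a::complex_inner. c *\<^sub>C x)"
proof (rule bounded_linear_intro[where K = "cmod c"])
  show "c *\<^sub>C (r *\<^sub>R x) = r *\<^sub>R (c *\<^sub>C x)" for r and x :: 'a
    by (simp add: scaleR_scaleC scaleC_scaleC mult.commute)
qed (simp_all add: scaleC_add_right norm_scaleC mult.commute)

lemma scaleC_zero_right [simp]: "c *\<^sub>C 0 = (0 :: 'a::complex_vector)"
  using scaleC_add_right[of c 0 "0 :: 'a"] by simp

lemma scaleC_sum: "c *\<^sub>C (\<Sum>i\<in>I. f i) = (\<Sum>i\<in>I. c *\<^sub>C (f i :: 'a::complex_vector))"
  by (induction I rule: infinite_finite_induct) (simp_all add: scaleC_add_right)

lemma app_scaleop [simp]: "app (scaleop c) x = c *\<^sub>C x"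
  unfolding scaleop_def by (subst app_Bop) (auto intro: bounded_linear_scaleC)

lemma scaleop_mult: "scaleop b * scaleop c = scaleop (b * c)"
  by (rule bop_eqI) (simp add: scaleC_scaleC)

lemma adj_scaleop: "adj (scaleop c) = scaleop (cnj c)"
  by (rule adj_unique) (simp add: ip_scaleC_left)

lemma unitary_add: "unitary g \<Longrightarrow> g (x + y) = g x + g y"
  and unitary_scaleC: "unitary g \<Longrightarrow> g (c *\<^sub>C x) = c *\<^sub>C g x"
  and unitary_ip: "unitary g \<Longrightarrow> ip (g x) (g y) = ip x y"
  by (simp_all add: unitary_def clinear_def ip_def)

lemma unitary_norm: "unitary g \<Longrightarrow> norm (g x) = norm x"
  by (simp add: unitary_def norm_eq_sqrt_cinner)

lemma unitary_bounded_linear: "unitary g \<Longrightarrow> bounded_linear g"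
  by (rule bounded_linear_intro[where K = 1])
    (simp_all add: unitary_add unitary_scaleC unitary_norm scaleR_scaleC)

lemma app_Bop_unitary: "unitary g \<Longrightarrow> app (Bop g) = g"
  by (rule app_Bop[OF unitary_bounded_linear])

lemma csubspace_subspace: "csubspace S \<Longrightarrow> subspace S"
  by (simp add: csubspace_def subspace_def scaleR_scaleC)

lemma csubspace_sum:
  assumes "csubspace S" "\<And>i. i \<in> I \<Longrightarrow> f i \<in> S"
  shows "sum f I \<in> S"
  using assms by (intro subspace_sum csubspace_subspace)

lemma csubspace_cspan: "csubspace (cspan S)"
  unfolding csubspace_def
proof (intro conjI ballI allI)
  show "0 \<in> cspan S"
    unfolding cspan_def by (auto intro!: exI[of _ "{}"])
  show "x + y \<in> cspan S" if xy: "x \<in> cspan S" "y \<in> cspan S" for x y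
  proof -
    obtain F c where F: "finite F" "F \<subseteq> S" "x = (\<Sum>v\<in>F. c v *\<^sub>C v)"
      using xy(1) unfolding cspan_def by blast
    obtain H d where H: "finite H" "H \<subseteq> S" "y = (\<Sum>v\<in>H. d v *\<^sub>C v)"
      using xy(2) unfolding cspan_def by blast
    define e where "e v = (if v \<in> F then c v else 0) + (if v \<in> H then d v else 0)" for v
    have "x = (\<Sum>v\<in>F \<union> H. (if v \<in> F then c v else 0) *\<^sub>C v)"
      unfolding F(3) using F(1) H(1) by (intro sum.mono_neutral_cong_left) auto
    moreover have "y = (\<Sum>v\<in>F \<union> H. (if v \<in> H then d v else 0) *\<^sub>C v)"
      unfolding H(3) using F(1) H(1) by (intro sum.mono_neutral_cong_left) auto
    ultimately have "x + y = (\<Sum>v\<in>F \<union> H. e v *\<^sub>C v)"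
      by (simp add: e_def scaleC_add_left sum.distrib)
    then show ?thesis
      unfolding cspan_def using F H by (blast intro: finite_UnI)
  qed
  show "c *\<^sub>C x \<in> cspan S" if x: "x \<in> cspan S" for c x
  proof -
    obtain F d where F: "finite F" "F \<subseteq> S" "x = (\<Sum>v\<in>F. d v *\<^sub>C v)"
      using x unfolding cspan_def by blast
    then have "c *\<^sub>C x = (\<Sum>v\<in>F. (c * d v) *\<^sub>C v)"
      by (simp add: scaleC_sum scaleC_scaleC)
    then show ?thesis
      unfolding cspan_def mem_Collect_eq using F by (intro exI[of _ F] exI[of _ "\<lambda>v. c * d v"]) simp
  qed
qed

lemma cspan_superset: "S \<subseteq> cspan S"
proof
  fix x
  assume "x \<in> S"
  then show "x \<in> cspan S"
    unfolding cspan_def by (auto intro!: exI[of _ "{x}"] exI[of _ "\<lambda>_. 1"] simp: scaleC_one)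
qed

lemma cspan_minimal:
  assumes "csubspace V" "S \<subseteq> V"
  shows "cspan S \<subseteq> V"
proof
  fix x
  assume "x \<in> cspan S"
  then obtain F c where F: "F \<subseteq> S" "x = (\<Sum>v\<in>F. c v *\<^sub>C v)"
    unfolding cspan_def by blast
  have "c v *\<^sub>C v \<in> V" if "v \<in> F" for v
    using assms F that by (auto simp: csubspace_def)
  then show "x \<in> V"
    unfolding F(2) by (intro csubspace_sum[OF assms(1)])
qed

text \<open>The complex group algebra acting on the space. Closure under products and adjoints need
  not be generated, since \<open>G\<close> itself is closed under composition and inverses.\<close>

inductive_set group_algebra :: "('a \<Rightarrow> 'a) set \<Rightarrow> 'a::complex_inner bop set" for G where
  gen: "g \<in> G \<Longrightarrow> Bop g \<in> group_algebra G"
| scale: "T \<in> group_algebra G \<Longrightarrow> scaleop c * T \<in> group_algebra G"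
| add: "S \<in> group_algebra G \<Longrightarrow> T \<in> group_algebra G \<Longrightarrow> S + T \<in> group_algebra G"

locale abelian_unitary_group =
  fixes G :: "('a::chilbert_space \<Rightarrow> 'a) set"
  assumes G_group: "abelian_operator_group G" and G_unitary: "\<forall>g\<in>G. unitary g"
begin

abbreviation "U \<equiv> group_algebra G"

lemma app_gen: "g \<in> G \<Longrightarrow> app (Bop g) x = g x"
  using G_unitary by (simp add: app_Bop_unitary)

lemma gen_mult: "g \<in> G \<Longrightarrow> h \<in> G \<Longrightarrow> Bop g * Bop h = Bop (g \<circ> h)"
  using G_group by (intro bop_eqI) (simp add: app_gen abelian_operator_group_def)

lemma scaleop_central: "T \<in> U \<Longrightarrow> T * scaleop c = scaleop c * T"
proof (induction rule: group_algebra.induct)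
  case (gen g)
  then show ?case
    using G_unitary by (intro bop_eqI) (simp add: app_gen unitary_scaleC)
next
  case (scale T b)
  show ?case
  proof -
    have "scaleop b * T * scaleop c = (scaleop b * scaleop c) * T"
      by (simp add: mult.assoc scale.IH)
    also have "\<dots> = (scaleop c * scaleop b) * T"
      by (simp add: scaleop_mult mult.commute)
    finally show ?thesis
      by (simp add: mult.assoc)
  qed
qed (simp add: algebra_simps)

lemma group_algebra_comm:
  assumes "S \<in> U" "T \<in> U"
  shows "S * T = T * S"
proof -
  have *: "T * Bop g = Bop g * T" if "T \<in> U" "g \<in> G" for T g
    using that
  proof (induction rule: group_algebra.induct)
    case (gen h)
    then show ?case
      using G_group by (simp add: gen_mult abelian_operator_group_def)
  next
    case (scale T c)
    then show ?case
      using scaleop_central[OF group_algebra.gen[OF scale.prems], of c]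
      by (metis mult.assoc)
  qed (simp add: algebra_simps)
  show ?thesis
    using assms
  proof (induction S rule: group_algebra.induct)
    case (gen g)
    then show ?case
      using * by simp
  next
    case (scale S c)
    then show ?case
      using scaleop_central[OF scale.prems, of c] by (metis mult.assoc)
  qed (simp add: algebra_simps)
qed

lemma group_algebra_mult:
  assumes "S \<in> U" "T \<in> U"
  shows "S * T \<in> U"
proof -
  have *: "Bop g * T \<in> U" if "T \<in> U" "g \<in> G" for T g
    using that
  proof (induction rule: group_algebra.induct)
    case (gen h)
    then show ?case
      using G_group by (simp add: gen_mult abelian_operator_group_def group_algebra.gen)
  next
    case (scale T c)
    then have "Bop g * (scaleop c * T) = scaleop c * (Bop g * T)"
      using scaleop_central[OF group_algebra.gen[OF scale.prems], of c] by (metis mult.assoc)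
    then show ?case
      using scale by (simp add: group_algebra.scale)
  qed (simp add: distrib_left group_algebra.add)
  show ?thesis
    using assms
  proof (induction S rule: group_algebra.induct)
    case (scale S c)
    then show ?case
      by (simp add: mult.assoc group_algebra.scale)
  qed (simp_all add: * distrib_right group_algebra.add)
qed

lemma group_algebra_adj: "T \<in> U \<Longrightarrow> adj T \<in> U"
proof (induction rule: group_algebra.induct)
  case (gen g)
  then obtain h where h: "h \<in> G" "g \<circ> h = id"
    using G_group unfolding abelian_operator_group_def by blast
  have "adj (Bop g) = Bop h"
  proof (rule adj_unique)
    fix x y
    have "ip (g x) y = ip (g x) (g (h y))"
      using h(2) by (metis comp_apply id_apply)
    then show "ip (app (Bop g) x) y = ip x (app (Bop h) y)"
      using gen h G_unitary by (simp add: app_gen unitary_ip)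
  qed
  then show ?case
    using h by (simp add: group_algebra.gen)
next
  case (scale T c)
  then show ?case
    by (simp add: adj_times adj_scaleop scaleop_central group_algebra.scale)
qed (simp add: adj_add group_algebra.add)

sublocale commutative_star_algebra U
proof
  show "1 \<in> U"
  proof -
    have "id \<in> G"
      using G_group by (simp add: abelian_operator_group_def)
    moreover have "Bop id = (1 :: 'a bop)"
      by (rule bop_eqI) (simp add: app_gen calculation)
    ultimately show ?thesis
      using group_algebra.gen by metis
  qed
  show "r *\<^sub>R u \<in> U" if "u \<in> U" for r u
  proof -
    have "r *\<^sub>R u = scaleop (complex_of_real r) * u"
      by (rule bop_eqI) (simp add: app.scaleR_left scaleR_scaleC)
    then show ?thesis
      using that by (simp add: group_algebra.scale)
  qed
qed (auto intro: group_algebra.add group_algebra_mult group_algebra_comm group_algebra_adj)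

lemma group_algebra_sum_exists:
  assumes "finite F" "F \<subseteq> G"
  shows "\<exists>u\<in>U. \<forall>x. app u x = (\<Sum>g\<in>F. c g *\<^sub>C g x)"
  using assms
proof (induction F rule: finite_induct)
  case empty
  show ?case
    using U_zero by (intro bexI[of _ 0]) (simp_all add: app.zero_left)
next
  case (insert g F)
  then obtain u where u: "u \<in> U" "\<forall>x. app u x = (\<Sum>g\<in>F. c g *\<^sub>C g x)"
    by auto
  have "scaleop (c g) * Bop g + u \<in> U"
    using insert u by (auto intro!: group_algebra.intros)
  moreover have "app (scaleop (c g) * Bop g + u) x = (\<Sum>g\<in>insert g F. c g *\<^sub>C g x)" for x
    using insert u by (simp add: app.add_left app_gen)
  ultimately show ?case
    by blast
qed

text \<open>Vanishing of \<open>c\<close> off \<open>F\<close> allows several representations to be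
  written over the union of their index sets.\<close>

lemma group_algebra_rep:
  assumes "u \<in> U"
  obtains F c where "finite F" "F \<subseteq> G" "\<And>x. app u x = (\<Sum>g\<in>F. c g *\<^sub>C g x)" "\<And>g. g \<notin> F \<Longrightarrow> c g = 0"
proof -
  have "\<exists>F c. finite F \<and> F \<subseteq> G \<and> (\<forall>x. app u x = (\<Sum>g\<in>F. c g *\<^sub>C g x)) \<and> (\<forall>g. g \<notin> F \<longrightarrow> c g = 0)"
    using assms
  proof (induction rule: group_algebra.induct)
    case (gen g)
    then show ?case
      by (intro exI[of _ "{g}"] exI[of _ "\<lambda>h. if h = g then 1 else 0"]) (simp add: app_gen scaleC_one)
  next
    case (scale T b)
    then obtain F c where F: "finite F" "F \<subseteq> G" "\<forall>x. app T x = (\<Sum>g\<in>F. c g *\<^sub>C g x)"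
      "\<forall>g. g \<notin> F \<longrightarrow> c g = 0"
      by blast
    then show ?case
      by (intro exI[of _ F] exI[of _ "\<lambda>g. b * c g"]) (simp add: scaleC_sum scaleC_scaleC)
  next
    case (add S T)
    then obtain F c H d where F: "finite F" "F \<subseteq> G" "\<forall>x. app S x = (\<Sum>g\<in>F. c g *\<^sub>C g x)"
      "\<forall>g. g \<notin> F \<longrightarrow> c g = 0"
      and H: "finite H" "H \<subseteq> G" "\<forall>x. app T x = (\<Sum>g\<in>H. d g *\<^sub>C g x)"
      "\<forall>g. g \<notin> H \<longrightarrow> d g = 0"
      by blast
    have "app (S + T) x = (\<Sum>g\<in>F \<union> H. (c g + d g) *\<^sub>C g x)" for x
    proof -
      have "app S x = (\<Sum>g\<in>F \<union> H. c g *\<^sub>C g x)"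
        using F H by (simp, intro sum.mono_neutral_left) auto
      moreover have "app T x = (\<Sum>g\<in>F \<union> H. d g *\<^sub>C g x)"
        using F H by (simp, intro sum.mono_neutral_left) auto
      ultimately show ?thesis
        by (simp add: app.add_left scaleC_add_left sum.distrib)
    qed
    then show ?case
      using F H by (intro exI[of _ "F \<union> H"] exI[of _ "\<lambda>g. c g + d g"]) simp
  qed
  then show thesis
    using that by blast
qed

lemma app_in_invariant:
  assumes V: "csubspace V" and inv: "\<And>g x. g \<in> G \<Longrightarrow> x \<in> V \<Longrightarrow> g x \<in> V"
    and u: "u \<in> U" and x: "x \<in> V"
  shows "app u x \<in> V"
  using u
proof (induction rule: group_algebra.induct)
  case (gen g)
  then show ?case
    by (simp add: app_gen inv x)
qed (use V in \<open>simp_all add: app.add_left csubspace_def\<close>)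

end

subsection \<open>Frames of invariant subspaces\<close>

text \<open>\<open>p\<close> splits the orthogonal projection to \<open>E\<close> along the direct
  sum; it is bounded by \<open>direct_sum_projection_bound\<close>. The last property characterizes
  its values and serves to prove commutation with \<open>U\<close>.\<close>

lemma oblique_projection:
  fixes V W E :: "'a::chilbert_space set"
  assumes V: "subspace V" "closed V" and W: "subspace W" "closed W" and E: "direct_sum_eq V W E"
  obtains p where "\<And>x. app p x \<in> V" "\<And>x. app (Proj E - p) x \<in> W"
    "\<And>x. x \<in> V \<Longrightarrow> app p x = x"
    "\<And>x v. v \<in> V \<Longrightarrow> app (Proj E) x - v \<in> W \<Longrightarrow> app p x = v"
proof -
  have VW: "V \<inter> W = {0}" and E_eq: "E = {v + w | v w. v \<in> V \<and> w \<in> W}"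
    and cE: "closed E"
    using E by (auto simp: direct_sum_eq_def)
  have sE: "subspace E"
    unfolding E_eq by (rule subspace_sums[OF V(1) W(1)])
  obtain C where C: "0 \<le> C" "\<And>v w. v \<in> V \<Longrightarrow> w \<in> W \<Longrightarrow> norm v \<le> C * norm (v + w)"
    using direct_sum_projection_bound[OF V W VW] cE unfolding E_eq by blast
  have "\<exists>v. v \<in> V \<and> app (Proj E) x - v \<in> W" for x
    using app_Proj_in[OF sE cE, of x] unfolding E_eq by force
  then obtain f where f: "\<And>x. f x \<in> V" "\<And>x. app (Proj E) x - f x \<in> W"
    by metis
  have uniq: "f x = v" if v: "v \<in> V" "app (Proj E) x - v \<in> W" for x v
  proof -
    have "(app (Proj E) x - v) - (app (Proj E) x - f x) \<in> W"
      using v f W(1) by (simp only: subspace_diff)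
    then have "f x - v \<in> W"
      by (simp add: algebra_simps)
    moreover have "f x - v \<in> V"
      using v f V(1) by (simp add: subspace_diff)
    ultimately have "f x - v \<in> {0}"
      unfolding VW[symmetric] by blast
    then show ?thesis
      by simp
  qed
  have "bounded_linear f"
  proof (rule bounded_linear_intro[where K = C])
    show "f (x + y) = f x + f y" for x y
    proof (rule uniq)
      show "f x + f y \<in> V"
        using f V(1) by (simp add: subspace_add)
      have "(app (Proj E) x - f x) + (app (Proj E) y - f y) \<in> W"
        using f W(1) by (simp only: subspace_add)
      then show "app (Proj E) (x + y) - (f x + f y) \<in> W"
        by (simp add: app.add_right algebra_simps)
    qed
    show "f (r *\<^sub>R x) = r *\<^sub>R f x" for r x
    proof (rule uniq)
      show "r *\<^sub>R f x \<in> V"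
        using f V(1) by (simp add: subspace_scale)
      have "r *\<^sub>R (app (Proj E) x - f x) \<in> W"
        using f W(1) by (simp only: subspace_scale)
      then show "app (Proj E) (r *\<^sub>R x) - r *\<^sub>R f x \<in> W"
        by (simp add: app.scaleR_right algebra_simps)
    qed
    show "norm (f x) \<le> norm x * C" for x
    proof -
      have "norm (f x) \<le> C * norm (app (Proj E) x)"
        using C(2)[OF f(1) f(2), of x x] by simp
      also have "\<dots> \<le> C * norm x"
        using C(1) norm_orth_proj_le[OF sE cE] by (simp add: app_Proj[OF sE cE] mult_left_mono)
      finally show ?thesis
        by (simp add: mult.commute)
    qed
  qed
  then have appf: "app (Bop f) = f"
    by (rule app_Bop)
  show thesis
  proof (rule that[of "Bop f"])
    show "app (Proj E - Bop f) x \<in> W" for x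
      using f by (simp add: app.diff_left appf)
    show "app (Bop f) x = x" if x: "x \<in> V" for x
      unfolding appf
    proof (rule uniq[OF x])
      have "x \<in> E"
        unfolding E_eq using x W(1) subspace_0 by force
      then have "app (Proj E) x = x"
        using app_Proj_eq_iff[OF sE cE] by blast
      then show "app (Proj E) x - x \<in> W"
        using W(1) subspace_0 by simp
    qed
  qed (use f uniq in \<open>auto simp: appf\<close>)
qed

context commutative_star_algebra
begin

text \<open>Commutation passes from \<open>D\<close> to its closure by continuity. It holds globally
  because the closure is invariant under the *-closed algebra, so that its orthogonal projection
  commutes with \<open>U\<close> too.\<close>

lemma commutant_extension:
  assumes D: "subspace D" and inv: "\<And>u x. u \<in> U \<Longrightarrow> x \<in> D \<Longrightarrow> app u x \<in> D"
    and add: "\<And>x x'. x \<in> D \<Longrightarrow> x' \<in> D \<Longrightarrow> f (x + x') = f x + f x'"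
    and equiv: "\<And>u x. u \<in> U \<Longrightarrow> x \<in> D \<Longrightarrow> f (app u x) = app u (f x)"
    and bound: "\<And>x. x \<in> D \<Longrightarrow> norm (f x) \<le> C * norm x"
  obtains T where "T \<in> commutant" "\<And>x. x \<in> D \<Longrightarrow> app T x = f x" "T * Proj (closure D) = T"
proof -
  \<comment> \<open>Real multiples of 1 lie in \<open>U\<close>, so homogeneity is a case of
    equivariance.\<close>
  have scale: "f (r *\<^sub>R x) = r *\<^sub>R f x" if "x \<in> D" for r x
    using equiv[OF U_scaleR[OF U_one, of r] that] by (simp add: app.scaleR_left)
  obtain T where T: "\<And>x. x \<in> D \<Longrightarrow> app T x = f x" "T * Proj (closure D) = T"
    by (rule bop_extension[of D f C, OF D add scale bound]) auto
  have cD: "subspace (closure D)" "closed (closure D)"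
    using subspace_closure[OF D] by auto
  have P: "Proj (closure D) \<in> commutant"
    by (rule Proj_in_commutant[OF cD]) (use inv app_in_closure in blast)
  have "T * u = u * T" if u: "u \<in> U" for u
  proof (rule bop_eqI)
    fix x
    have "app (T * u) z = app (u * T) z" if "z \<in> D" for z
      using that u by (simp add: T inv equiv)
    then have "app (T * u) (app (Proj (closure D)) x) = app (u * T) (app (Proj (closure D)) x)"
      by (rule app_eq_on_closure[of D]) (simp_all add: app_Proj_in[OF cD])
    then have "app (T * Proj (closure D)) (app u x) = app u (app (T * Proj (closure D)) x)"
      using u by (simp add: commutant_app[OF P])
    then show "app (T * u) x = app (u * T) x"
      by (simp add: T(2))
  qed
  then have "T \<in> commutant"
    by (simp add: commutant_def)
  with T show thesis
    using that by blast
qed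

definition orbits :: "(nat \<Rightarrow> 'a) \<Rightarrow> nat \<Rightarrow> 'a set" where
  "orbits z k = {\<Sum>j<k. app (u j) (z j) | u. \<forall>j. u j \<in> U}"

lemma orbitsI: "(\<And>j. u j \<in> U) \<Longrightarrow> (\<Sum>j<k. app (u j) (z j)) \<in> orbits z k"
  by (auto simp: orbits_def)

lemma orbits_add:
  assumes "x \<in> orbits z k" "x' \<in> orbits z k"
  shows "x + x' \<in> orbits z k"
proof -
  obtain u u' where "\<forall>j. u j \<in> U" "\<forall>j. u' j \<in> U"
    "x = (\<Sum>j<k. app (u j) (z j))" "x' = (\<Sum>j<k. app (u' j) (z j))"
    using assms by (auto simp: orbits_def)
  then show ?thesis
    using orbitsI[of "\<lambda>j. u j + u' j" z k] by (simp add: U_add app.add_left sum.distrib)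
qed

lemma orbits_invariant:
  assumes "v \<in> U" "x \<in> orbits z k"
  shows "app v x \<in> orbits z k"
proof -
  obtain u where "\<forall>j. u j \<in> U" "x = (\<Sum>j<k. app (u j) (z j))"
    using assms by (auto simp: orbits_def)
  then show ?thesis
    using orbitsI[of "\<lambda>j. v * u j" z k] assms(1) by (simp add: U_mult app.sum_right)
qed

lemma subspace_orbits: "subspace (orbits z k)"
  unfolding subspace_def
proof (intro conjI ballI allI)
  show "0 \<in> orbits z k"
    using orbitsI[of "\<lambda>_. 0" z k] by (simp add: U_zero app.zero_left)
  show "r *\<^sub>R x \<in> orbits z k" if "x \<in> orbits z k" for r x
    using orbits_invariant[OF U_scaleR[OF U_one, of r] that] by (simp add: app.scaleR_left)
qed (rule orbits_add)

lemma orbits_component: "j < k \<Longrightarrow> u \<in> U \<Longrightarrow> app u (z j) \<in> orbits z k"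
  using orbitsI[of "\<lambda>i. if i = j then u else 0" z k]
  by (simp add: U_zero app_if app.zero_left cong: if_cong)

end

context cyclic_corner
begin

sublocale stable_range_corner commutant q
proof
  show "\<exists>t\<in>commutant. \<exists>d\<in>commutant. t * q = t \<and> q * t = t \<and> d * q = d \<and> q * d = d
        \<and> (a + (q - a * u) * t) * d = q \<and> d * (a + (q - a * u) * t) = q"
    if "a \<in> commutant" "q * a = a" "a * q = a" "u \<in> commutant" "q * u = u" "u * q = u" for a u
  proof -
    have "a \<in> corner" "u \<in> corner"
      using that by (simp_all add: corner_def)
    then obtain t d where "t \<in> corner" "d \<in> corner"
      "(a + (q - a * u) * t) * d = q" "d * (a + (q - a * u) * t) = q"
      using corner_stable_range by blast
    then show ?thesis
      using corner_commutant corner_left corner_right by blast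
  qed
qed (simp_all add: commutant_zero commutant_add commutant_diff commutant_mult q_commutant q_idem)

text \<open>The bounds make the rules sending \<open>u y\<close> to \<open>u (z j)\<close>, and a
  sum of the \<open>u j (z j)\<close> to \<open>u i y\<close>, well defined and bounded on dense
  subspaces. Their extensions \<open>\<alpha> j\<close> and \<open>\<tau> i\<close> are the
  embeddings and coordinates of a frame. Since \<open>p\<close> is any idempotent onto the closed
  span, oblique ones are covered.\<close>

lemma frame_of_bounds:
  assumes lower: "\<And>u i. (\<And>j. u j \<in> U) \<Longrightarrow> i < k \<Longrightarrow>
      norm (app (u i) y) \<le> C * norm (\<Sum>j<k. app (u j) (z j))"
    and upper: "\<And>u j. u \<in> U \<Longrightarrow> j < k \<Longrightarrow> norm (app u (z j)) \<le> C * norm (app u y)"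
    and p: "p \<in> commutant" "\<And>x. app p x \<in> closure (orbits z k)"
      "\<And>x. x \<in> closure (orbits z k) \<Longrightarrow> app p x = x"
  shows "\<exists>\<alpha> \<beta>. frame k \<alpha> \<beta> p"
proof -
  have "\<exists>T. T \<in> commutant \<and> T * q = T \<and> (\<forall>u\<in>U. app T (app u y) = app u (z j))" if j: "j < k" for j
  proof -
    \<comment> \<open>Independence of the representative: the bound applied to a difference with
      image 0.\<close>
    have wd: "app u (z j) = app u' (z j)" if "u \<in> U" "u' \<in> U" "app u y = app u' y" for u u'
      using upper[OF U_diff[OF that(1,2)] j] that(3) by (simp add: app.diff_left)
    define f where "f x = app (SOME u. u \<in> U \<and> app u y = x) (z j)" for x
    have f: "f (app u y) = app u (z j)" if "u \<in> U" for u
    proof -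
      have "\<exists>u'. u' \<in> U \<and> app u' y = app u y"
        using that by blast
      from someI_ex[OF this] show ?thesis
        unfolding f_def using that by (intro wd) auto
    qed
    obtain T where "T \<in> commutant" "\<And>x. x \<in> orbit y \<Longrightarrow> app T x = f x" "T * Proj (closure (orbit y)) = T"
    proof (rule commutant_extension[of "orbit y" f C])
      show "app v x \<in> orbit y" if "v \<in> U" "x \<in> orbit y" for v x
        using that U_mult by (auto simp: orbit_def simp flip: app_times)
      show "f (x + x') = f x + f x'" if "x \<in> orbit y" "x' \<in> orbit y" for x x'
        using that f U_add by (auto simp: orbit_def simp flip: app.add_left)
      show "f (app v x) = app v (f x)" if "v \<in> U" "x \<in> orbit y" for v x
      proof -
        obtain u where "u \<in> U" "x = app u y"
          using \<open>x \<in> orbit y\<close> by (auto simp: orbit_def)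
        then show ?thesis
          using f[of "v * u"] \<open>v \<in> U\<close> by (simp add: U_mult f)
      qed
      show "norm (f x) \<le> C * norm x" if "x \<in> orbit y" for x
        using that f upper j by (auto simp: orbit_def)
    qed (use subspace_orbit in auto)
    then show ?thesis
      using f by (intro exI[of _ T]) (auto simp: q_def cyclic_def orbit_def)
  qed
  then obtain \<alpha> where \<alpha>: "\<And>j. j < k \<Longrightarrow> \<alpha> j \<in> commutant" "\<And>j. j < k \<Longrightarrow> \<alpha> j * q = \<alpha> j"
    "\<And>j u. j < k \<Longrightarrow> u \<in> U \<Longrightarrow> app (\<alpha> j) (app u y) = app u (z j)"
    by metis
  have "\<exists>T. T \<in> commutant \<and> (\<forall>x. app T x \<in> cyclic y) \<and>
      (\<forall>u. (\<forall>j. u j \<in> U) \<longrightarrow> app T (\<Sum>j<k. app (u j) (z j)) = app (u i) y)" if i: "i < k" for i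
  proof -
    have wd: "app (u i) y = app (u' i) y" if "\<And>j. u j \<in> U" "\<And>j. u' j \<in> U"
      "(\<Sum>j<k. app (u j) (z j)) = (\<Sum>j<k. app (u' j) (z j))" for u u'
      using lower[of "\<lambda>j. u j - u' j", OF _ i] that by (simp add: U_diff app.diff_left sum_subtractf)
    define f where "f x = app ((SOME u. (\<forall>j. u j \<in> U) \<and> (\<Sum>j<k. app (u j) (z j)) = x) i) y" for x
    have f: "f (\<Sum>j<k. app (u j) (z j)) = app (u i) y" if "\<forall>j. u j \<in> U" for u
    proof -
      have "\<exists>u'. (\<forall>j. u' j \<in> U) \<and> (\<Sum>j<k. app (u' j) (z j)) = (\<Sum>j<k. app (u j) (z j))"
        using that by blast
      from someI_ex[OF this] show ?thesis
        unfolding f_def using that by (intro wd) auto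
    qed
    obtain T where T: "T \<in> commutant" "\<And>x. x \<in> orbits z k \<Longrightarrow> app T x = f x"
      "T * Proj (closure (orbits z k)) = T"
    proof (rule commutant_extension[of "orbits z k" f C])
      show "f (x + x') = f x + f x'" if xx: "x \<in> orbits z k" "x' \<in> orbits z k" for x x'
      proof -
        obtain u u' where u: "\<forall>j. u j \<in> U" "\<forall>j. u' j \<in> U"
          "x = (\<Sum>j<k. app (u j) (z j))" "x' = (\<Sum>j<k. app (u' j) (z j))"
          using xx by (auto simp: orbits_def)
        have "x + x' = (\<Sum>j<k. app (u j + u' j) (z j))"
          by (simp add: u app.add_left sum.distrib)
        then show ?thesis
          using f[of "\<lambda>j. u j + u' j"] u by (simp add: U_add f app.add_left)
      qed
      show "f (app v x) = app v (f x)" if vx: "v \<in> U" "x \<in> orbits z k" for v x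
      proof -
        obtain u where u: "\<forall>j. u j \<in> U" "x = (\<Sum>j<k. app (u j) (z j))"
          using vx by (auto simp: orbits_def)
        have "app v x = (\<Sum>j<k. app (v * u j) (z j))"
          by (simp add: u app.sum_right)
        then show ?thesis
          using f[of "\<lambda>j. v * u j"] u vx by (simp add: U_mult f)
      qed
      show "norm (f x) \<le> C * norm x" if "x \<in> orbits z k" for x
        using that f lower i by (auto simp: orbits_def)
    qed (use subspace_orbits orbits_invariant in auto)
    have "app T x \<in> cyclic y" for x
    proof -
      have cD: "subspace (closure (orbits z k))" "closed (closure (orbits z k))"
        using subspace_closure[OF subspace_orbits] by auto
      have "app T x = app (q * T) x" if "x \<in> closure (orbits z k)" for x
      proof (rule app_eq_on_closure[OF _ that])
        fix x
        assume x: "x \<in> orbits z k"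
        then have "f x \<in> cyclic y"
          using f app_in_cyclic by (auto simp: orbits_def)
        then show "app T x = app (q * T) x"
          by (simp add: T(2)[OF x] app_q_eq)
      qed
      from this[OF app_Proj_in[OF cD, of x]] have "app (T * Proj (closure (orbits z k))) x = app q (app (T * Proj (closure (orbits z k))) x)"
        by simp
      then show ?thesis
        by (metis T(3) app_q_in)
    qed
    then show ?thesis
      using T(1) T(2)[OF orbitsI] f by (intro exI[of _ T]) simp
  qed
  then obtain \<tau> where \<tau>: "\<And>j. j < k \<Longrightarrow> \<tau> j \<in> commutant" "\<And>j x. j < k \<Longrightarrow> app (\<tau> j) x \<in> cyclic y"
    "\<And>i u. i < k \<Longrightarrow> (\<And>j. u j \<in> U) \<Longrightarrow> app (\<tau> i) (\<Sum>j<k. app (u j) (z j)) = app (u i) y"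
    by metis
  have pz: "app p (z j) = z j" if "j < k" for j
    using p(3) orbits_component[OF that U_one, of z] closure_subset by force
  have \<tau>z: "app (\<tau> i) (z j) = (if i = j then y else 0)" if "i < k" "j < k" for i j
    using \<tau>(3)[OF that(1), of "\<lambda>l. if l = j then 1 else 0"] that
    by (simp add: U_zero U_one app_if app.zero_left cong: if_cong)
  \<comment> \<open>\<open>\<tau> j\<close> vanishes on the orthogonal complement of the closed
    span, whereas the coordinates of a possibly oblique \<open>p\<close> must vanish on the kernel
    of \<open>p\<close>; hence the factor \<open>p\<close>.\<close>
  have "frame k \<alpha> (\<lambda>j. \<tau> j * p) p"
    unfolding frame_def
  proof (intro conjI allI impI)
    fix j
    assume j: "j < k"
    show "\<alpha> j \<in> commutant" "\<alpha> j * q = \<alpha> j" "\<tau> j * p \<in> commutant"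
      using j \<alpha> \<tau> p by (auto intro: commutant_mult)
    show "q * (\<tau> j * p) = \<tau> j * p"
      using \<tau>(2)[OF j] by (simp add: q_left_iff)
    fix i
    assume i: "i < k"
    have \<alpha>y: "app (\<alpha> j) y = z j"
      using \<alpha>(3)[OF j U_one] by simp
    show "\<tau> i * p * \<alpha> j = (if i = j then q else 0)"
    proof (rule eq_on_generator)
      show "\<tau> i * p * \<alpha> j \<in> commutant"
        by (intro commutant_mult \<alpha> \<tau> p i j)
      show "\<tau> i * p * \<alpha> j * q = \<tau> i * p * \<alpha> j"
        by (simp add: \<alpha> j mult.assoc)
      show "(if i = j then q else 0) \<in> commutant" "(if i = j then q else 0) * q = (if i = j then q else 0)"
        by (simp_all add: q_commutant commutant_zero q_idem)
      show "app (\<tau> i * p * \<alpha> j) y = app (if i = j then q else 0) y"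
        using i j by (simp add: \<alpha>y pz \<tau>z app_q_eq[OF self_in_cyclic] app.zero_left)
    qed
  next
    have *: "app (\<Sum>j<k. \<alpha> j * \<tau> j) x = app 1 x" if "x \<in> closure (orbits z k)" for x
    proof (rule app_eq_on_closure[OF _ that])
      fix x
      assume "x \<in> orbits z k"
      then obtain u where u: "\<And>j. u j \<in> U" "x = (\<Sum>j<k. app (u j) (z j))"
        by (auto simp: orbits_def)
      then show "app (\<Sum>j<k. \<alpha> j * \<tau> j) x = app 1 x"
        by (simp add: app.sum_left \<tau>(3) \<alpha>(3))
    qed
    show "p = (\<Sum>j<k. \<alpha> j * (\<tau> j * p))"
    proof (rule bop_eqI)
      fix x
      show "app p x = app (\<Sum>j<k. \<alpha> j * (\<tau> j * p)) x"
        using *[OF p(2), of x] by (simp add: app.sum_left)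
    qed
  qed
  then show ?thesis
    by blast
qed

end

lemma norm_le_sqrt_mult:
  assumes "(norm a)\<^sup>2 \<le> D * (norm b)\<^sup>2" "0 \<le> D"
  shows "norm a \<le> sqrt D * norm b"
  by (rule power2_le_imp_le) (use assms in \<open>simp_all add: power_mult_distrib\<close>)

lemma sum_index_split:
  assumes "finite F" "F \<subseteq> A \<times> {..<k::nat}"
  shows "(\<Sum>n\<in>F. h n) = (\<Sum>j<k. \<Sum>g\<in>fst ` F. if (g, j) \<in> F then h (g, j) else 0)"
proof -
  have "F \<subseteq> fst ` F \<times> {..<k}"
    using assms(2) by force
  then have "(\<Sum>n\<in>F. h n) = (\<Sum>(g, j)\<in>fst ` F \<times> {..<k}. if (g, j) \<in> F then h (g, j) else 0)"
    using assms(1) by (intro sum.mono_neutral_cong_left) auto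
  also have "\<dots> = (\<Sum>j<k. \<Sum>g\<in>fst ` F. if (g, j) \<in> F then h (g, j) else 0)"
    by (subst sum.swap) (simp add: sum.cartesian_product)
  finally show ?thesis .
qed

context abelian_unitary_group
begin

abbreviation family :: "(nat \<Rightarrow> 'a) \<Rightarrow> nat \<Rightarrow> 'a set" where
  "family z k \<equiv> (\<lambda>(g, j). g (z j)) ` (G \<times> {..<k})"

lemma id_in_G: "id \<in> G"
  using G_group by (simp add: abelian_operator_group_def)

lemma cspan_family_invariant:
  assumes g: "g \<in> G" and x: "x \<in> cspan (family z k)"
  shows "g x \<in> cspan (family z k)"
proof -
  let ?V = "{x. g x \<in> cspan (family z k)}"
  have ug: "unitary g"
    using g G_unitary by blast
  have g0: "g 0 = 0"
    using unitary_scaleC[OF ug, of 0 0] by simp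
  have "csubspace ?V"
    using csubspace_cspan[of "family z k"] by (simp add: csubspace_def unitary_add[OF ug] unitary_scaleC[OF ug] g0)
  moreover have "family z k \<subseteq> ?V"
  proof clarify
    fix h j
    assume h: "h \<in> G" "j < k"
    have "g \<circ> h \<in> G"
      using g h G_group by (simp add: abelian_operator_group_def)
    then have "g (h (z j)) \<in> family z k"
      using h by (intro image_eqI[where x = "(g \<circ> h, j)"]) auto
    then show "g (h (z j)) \<in> cspan (family z k)"
      by (rule subsetD[OF cspan_superset])
  qed
  ultimately have "cspan (family z k) \<subseteq> ?V"
    by (rule cspan_minimal)
  then show ?thesis
    using x by blast
qed

lemma ccspan_family_invariant:
  assumes "g \<in> G"
  shows "g ` ccspan (family z k) \<subseteq> ccspan (family z k)"
  unfolding ccspan_def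
proof (rule image_closure_subset)
  show "continuous_on (closure (cspan (family z k))) g"
    using assms G_unitary by (intro linear_continuous_on unitary_bounded_linear) auto
  show "g ` cspan (family z k) \<subseteq> closure (cspan (family z k))"
    using cspan_family_invariant[OF assms] closure_subset by blast
qed simp

text \<open>Connects the module-style sums of orbits with the closed complex spans in the theorem;
  complex scalars are absorbed as elements of \<open>U\<close>.\<close>

lemma closure_orbits: "closure (orbits z k) = ccspan (family z k)"
proof -
  have "orbits z k \<subseteq> cspan (family z k)"
  proof
    fix x
    assume "x \<in> orbits z k"
    then obtain u where u: "\<forall>j. u j \<in> U" "x = (\<Sum>j<k. app (u j) (z j))"
      by (auto simp: orbits_def)
    have "app (u j) (z j) \<in> cspan (family z k)" if "j < k" for j
    proof (rule app_in_invariant[OF csubspace_cspan])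
      have "z j \<in> family z k"
        using that id_in_G by (intro image_eqI[where x = "(id, j)"]) auto
      then show "z j \<in> cspan (family z k)"
        by (rule subsetD[OF cspan_superset])
      show "g x \<in> cspan (family z k)" if "g \<in> G" "x \<in> cspan (family z k)" for g x
        using that by (rule cspan_family_invariant)
    qed (use u in simp)
    then show "x \<in> cspan (family z k)"
      unfolding u(2) by (intro csubspace_sum[OF csubspace_cspan]) auto
  qed
  moreover have "cspan (family z k) \<subseteq> orbits z k"
  proof (rule cspan_minimal)
    have "c *\<^sub>C x \<in> orbits z k" if "x \<in> orbits z k" for c x
    proof -
      have "scaleop c * 1 \<in> U"
        by (rule group_algebra.scale[OF U_one])
      then show ?thesis
        using orbits_invariant[OF _ that, of "scaleop c"] by simp
    qed
    then show "csubspace (orbits z k)"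
      using subspace_orbits[of z k] by (simp add: csubspace_def subspace_def)
    show "family z k \<subseteq> orbits z k"
    proof clarify
      fix g j
      assume "g \<in> G" "j < k"
      then show "g (z j) \<in> orbits z k"
        using orbits_component[of j k "Bop g" z] by (simp add: app_gen group_algebra.gen)
    qed
  qed
  ultimately show ?thesis
    by (auto simp: ccspan_def)
qed

lemma riesz_orbit_bounds:
  assumes "riesz_basis_for (orbit_family G z k) (orbit_index G k) V"
  obtains A B where "0 < A" "0 \<le> B"
    "\<And>F c. finite F \<Longrightarrow> F \<subseteq> G \<Longrightarrow>
      A * (\<Sum>j<k. \<Sum>g\<in>F. (cmod (c j g))\<^sup>2) \<le> (norm (\<Sum>j<k. \<Sum>g\<in>F. c j g *\<^sub>C g (z j)))\<^sup>2"
    "\<And>F c j. finite F \<Longrightarrow> F \<subseteq> G \<Longrightarrow> j < k \<Longrightarrow>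
      A * (\<Sum>g\<in>F. (cmod (c g))\<^sup>2) \<le> (norm (\<Sum>g\<in>F. c g *\<^sub>C g (z j)))\<^sup>2"
    "\<And>F c j. finite F \<Longrightarrow> F \<subseteq> G \<Longrightarrow> j < k \<Longrightarrow>
      (norm (\<Sum>g\<in>F. c g *\<^sub>C g (z j)))\<^sup>2 \<le> B * (\<Sum>g\<in>F. (cmod (c g))\<^sup>2)"
proof -
  obtain A B where A: "0 < A" and *: "\<And>F c. finite F \<Longrightarrow> F \<subseteq> orbit_index G k \<Longrightarrow>
      A * (\<Sum>n\<in>F. (cmod (c n))\<^sup>2) \<le> (norm (\<Sum>n\<in>F. c n *\<^sub>C orbit_family G z k n))\<^sup>2 \<and>
      (norm (\<Sum>n\<in>F. c n *\<^sub>C orbit_family G z k n))\<^sup>2 \<le> B * (\<Sum>n\<in>F. (cmod (c n))\<^sup>2)"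
    using riesz_basis_finite_bounds[OF assms] by blast
  have prod: "(\<Sum>n\<in>F \<times> {..<k}. h n) = (\<Sum>j<k. \<Sum>g\<in>F. h (g, j))"
    for F and h :: "('a \<Rightarrow> 'a) \<times> nat \<Rightarrow> 'c::comm_monoid_add"
    by (subst sum.swap) (simp add: sum.cartesian_product)
  have multi: "A * (\<Sum>j<k. \<Sum>g\<in>F. (cmod (c j g))\<^sup>2) \<le> (norm (\<Sum>j<k. \<Sum>g\<in>F. c j g *\<^sub>C g (z j)))\<^sup>2"
    "(norm (\<Sum>j<k. \<Sum>g\<in>F. c j g *\<^sub>C g (z j)))\<^sup>2 \<le> B * (\<Sum>j<k. \<Sum>g\<in>F. (cmod (c j g))\<^sup>2)"
    if "finite F" "F \<subseteq> G" for F c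
    using *[of "F \<times> {..<k}" "\<lambda>(g, j). c j g"] that
    by (auto simp: prod orbit_family_def orbit_index_def)
  have single: "A * (\<Sum>g\<in>F. (cmod (c g))\<^sup>2) \<le> (norm (\<Sum>g\<in>F. c g *\<^sub>C g (z j)))\<^sup>2"
    "(norm (\<Sum>g\<in>F. c g *\<^sub>C g (z j)))\<^sup>2 \<le> B * (\<Sum>g\<in>F. (cmod (c g))\<^sup>2)"
    if F: "finite F" "F \<subseteq> G" "j < k" for F c j
  proof -
    define c' where "c' i g = (if i = j then c g else 0)" for i g
    have "(\<Sum>i<k. \<Sum>g\<in>F. (cmod (c' i g))\<^sup>2) = (\<Sum>i<k. if i = j then \<Sum>g\<in>F. (cmod (c g))\<^sup>2 else 0)"
      "(\<Sum>i<k. \<Sum>g\<in>F. c' i g *\<^sub>C g (z i)) = (\<Sum>i<k. if i = j then \<Sum>g\<in>F. c g *\<^sub>C g (z j) else 0)"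
      by (rule sum.cong[OF refl]; simp add: c'_def)+
    then show "A * (\<Sum>g\<in>F. (cmod (c g))\<^sup>2) \<le> (norm (\<Sum>g\<in>F. c g *\<^sub>C g (z j)))\<^sup>2"
      "(norm (\<Sum>g\<in>F. c g *\<^sub>C g (z j)))\<^sup>2 \<le> B * (\<Sum>g\<in>F. (cmod (c g))\<^sup>2)"
      using multi[OF F(1,2), of c'] F(3) by simp_all
  qed
  show thesis
  \<comment> \<open>The finite bounds carry no sign for \<open>B\<close>, while the comparison of
    norms needs a nonnegative constant.\<close>
  proof (rule that[of A "\<bar>B\<bar>"])
    show "(norm (\<Sum>g\<in>F. c g *\<^sub>C g (z j)))\<^sup>2 \<le> \<bar>B\<bar> * (\<Sum>g\<in>F. (cmod (c g))\<^sup>2)"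
      if F: "finite F" "F \<subseteq> G" "j < k" for F c j
      by (rule order_trans[OF single(2)[OF F]]) (intro mult_right_mono, auto intro: sum_nonneg)
  qed (use A multi(1) single(1) in simp_all)
qed

lemma group_algebra_common_rep:
  fixes k :: nat
  assumes u: "\<And>j. u j \<in> U"
  obtains F c where "finite F" "F \<subseteq> G" "\<And>j x. j < k \<Longrightarrow> app (u j) x = (\<Sum>g\<in>F. c j g *\<^sub>C g x)"
proof -
  have "\<forall>j. \<exists>F c. finite F \<and> F \<subseteq> G \<and> (\<forall>x. app (u j) x = (\<Sum>g\<in>F. c g *\<^sub>C g x)) \<and> (\<forall>g. g \<notin> F \<longrightarrow> c g = 0)"
    using group_algebra_rep[OF u] by metis
  then obtain F c where F: "\<And>j. finite (F j)" "\<And>j. F j \<subseteq> G"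
    "\<And>j x. app (u j) x = (\<Sum>g\<in>F j. c j g *\<^sub>C g x)" "\<And>j g. g \<notin> F j \<Longrightarrow> c j g = 0"
    unfolding choice_iff by blast
  show thesis
  proof (rule that[of "\<Union>j<k. F j" c])
    show "app (u j) x = (\<Sum>g\<in>(\<Union>j<k. F j). c j g *\<^sub>C g x)" if "j < k" for j x
      unfolding F(3) using F that by (intro sum.mono_neutral_left) auto
  qed (use F in auto)
qed

text \<open>The l2 norm of the coefficients of \<open>u\<close> controls, and is controlled by, the
  norms on both sides. Eliminating it compares the orbit of \<open>y 0\<close> directly with the
  orbits of the \<open>z j\<close>, as \<open>frame_of_bounds\<close> requires.\<close>

lemma riesz_orbit_comparison:
  assumes y: "riesz_basis_for (orbit_family G y s) (orbit_index G s) V1" "0 < s"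
    and z: "riesz_basis_for (orbit_family G z k) (orbit_index G k) V"
  obtains C where
    "\<And>u i. (\<And>j. u j \<in> U) \<Longrightarrow> i < k \<Longrightarrow>
      norm (app (u i) (y 0)) \<le> C * norm (\<Sum>j<k. app (u j) (z j))"
    "\<And>u j. u \<in> U \<Longrightarrow> j < k \<Longrightarrow> norm (app u (z j)) \<le> C * norm (app u (y 0))"
proof -
  obtain A B where A: "0 < A" "0 \<le> B"
    and lower: "\<And>F c. finite F \<Longrightarrow> F \<subseteq> G \<Longrightarrow>
      A * (\<Sum>j<k. \<Sum>g\<in>F. (cmod (c j g))\<^sup>2) \<le> (norm (\<Sum>j<k. \<Sum>g\<in>F. c j g *\<^sub>C g (z j)))\<^sup>2"
    and upper: "\<And>F c j. finite F \<Longrightarrow> F \<subseteq> G \<Longrightarrow> j < k \<Longrightarrow>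
      (norm (\<Sum>g\<in>F. c g *\<^sub>C g (z j)))\<^sup>2 \<le> B * (\<Sum>g\<in>F. (cmod (c g))\<^sup>2)"
    by (rule riesz_orbit_bounds[OF z]) (rule that)
  obtain A' B' where A': "0 < A'" "0 \<le> B'"
    and lower': "\<And>F c j. finite F \<Longrightarrow> F \<subseteq> G \<Longrightarrow> j < s \<Longrightarrow>
      A' * (\<Sum>g\<in>F. (cmod (c g))\<^sup>2) \<le> (norm (\<Sum>g\<in>F. c g *\<^sub>C g (y j)))\<^sup>2"
    and upper': "\<And>F c j. finite F \<Longrightarrow> F \<subseteq> G \<Longrightarrow> j < s \<Longrightarrow>
      (norm (\<Sum>g\<in>F. c g *\<^sub>C g (y j)))\<^sup>2 \<le> B' * (\<Sum>g\<in>F. (cmod (c g))\<^sup>2)"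
    by (rule riesz_orbit_bounds[OF y(1)]) (rule that)
  define C where "C = max (sqrt (B' / A)) (sqrt (B / A'))"
  show thesis
  proof (rule that[of C])
    fix u :: "nat \<Rightarrow> 'a bop" and i
    assume u: "\<And>j. u j \<in> U" and i: "i < k"
    obtain F c where F: "finite F" "F \<subseteq> G" "\<And>j x. j < k \<Longrightarrow> app (u j) x = (\<Sum>g\<in>F. c j g *\<^sub>C g x)"
      by (rule group_algebra_common_rep[OF u, of k]) (rule that)
    let ?X = "\<Sum>j<k. app (u j) (z j)"
    have X: "?X = (\<Sum>j<k. \<Sum>g\<in>F. c j g *\<^sub>C g (z j))"
      by (simp add: F(3))
    have "(norm (app (u i) (y 0)))\<^sup>2 \<le> B' * (\<Sum>g\<in>F. (cmod (c i g))\<^sup>2)"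
      using upper'[OF F(1,2) y(2)] by (simp add: F(3)[OF i])
    also have "\<dots> \<le> B' * (\<Sum>j<k. \<Sum>g\<in>F. (cmod (c j g))\<^sup>2)"
      using i A' by (intro mult_left_mono member_le_sum[of i "{..<k}" "\<lambda>j. \<Sum>g\<in>F. (cmod (c j g))\<^sup>2"]) (auto intro: sum_nonneg)
    also have "\<dots> \<le> B' * ((norm ?X)\<^sup>2 / A)"
      using lower[OF F(1,2), of c] A A' by (intro mult_left_mono) (auto simp: X field_simps)
    finally have "norm (app (u i) (y 0)) \<le> sqrt (B' / A) * norm ?X"
      using A A' by (intro norm_le_sqrt_mult) auto
    also have "\<dots> \<le> C * norm ?X"
      by (intro mult_right_mono) (auto simp: C_def)
    finally show "norm (app (u i) (y 0)) \<le> C * norm ?X" .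
  next
    fix u j
    assume u: "u \<in> U" and j: "j < k"
    obtain F c where F: "finite F" "F \<subseteq> G" "\<And>x. app u x = (\<Sum>g\<in>F. c g *\<^sub>C g x)"
      by (rule group_algebra_rep[OF u]) (rule that)
    have "(norm (app u (z j)))\<^sup>2 \<le> B * (\<Sum>g\<in>F. (cmod (c g))\<^sup>2)"
      using upper[OF F(1,2) j] by (simp add: F(3))
    also have "\<dots> \<le> B * ((norm (app u (y 0)))\<^sup>2 / A')"
      using lower'[OF F(1,2) y(2), of c] A A' by (intro mult_left_mono) (auto simp: F(3) field_simps)
    finally have "norm (app u (z j)) \<le> sqrt (B / A') * norm (app u (y 0))"
      using A A' by (intro norm_le_sqrt_mult) auto
    also have "\<dots> \<le> C * norm (app u (y 0))"
      by (intro mult_right_mono) (auto simp: C_def)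
    finally show "norm (app u (z j)) \<le> C * norm (app u (y 0))" .
  qed
qed

lemma csubspace_invariant:
  assumes "csubspace W" "\<forall>g\<in>G. g ` W \<subseteq> W" "u \<in> U" "x \<in> W"
  shows "app u x \<in> W"
  using assms by (intro app_in_invariant) auto

lemma ccspan_family_app: "u \<in> U \<Longrightarrow> x \<in> ccspan (family z k) \<Longrightarrow> app u x \<in> ccspan (family z k)"
  unfolding closure_orbits[symmetric] by (rule app_in_closure[OF orbits_invariant])

lemma subspace_ccspan_family: "subspace (ccspan (family z k))"
  unfolding closure_orbits[symmetric] by (rule subspace_closure[OF subspace_orbits])

lemma closed_ccspan: "closed (ccspan S)"
  by (simp add: ccspan_def)

end

locale based_unitary_group = abelian_unitary_group +
  fixes y0 :: 'a
begin

sublocale cyclic_corner U y0 ..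

text \<open>The embedding \<open>\<gamma> j\<close> carries the orbit of \<open>y0\<close> to that
  of \<open>z j\<close>, so the lower and upper bounds transfer through \<open>\<gamma>'\<close> and
  \<open>\<gamma>\<close> respectively.\<close>

lemma frame_imp_riesz_basis:
  assumes G: "countable G"
    and A: "0 < A" "\<And>F c. finite F \<Longrightarrow> F \<subseteq> G \<Longrightarrow>
      A * (\<Sum>g\<in>F. (cmod (c g))\<^sup>2) \<le> (norm (\<Sum>g\<in>F. c g *\<^sub>C g y0))\<^sup>2"
    and B: "0 \<le> B" "\<And>F c. finite F \<Longrightarrow> F \<subseteq> G \<Longrightarrow>
      (norm (\<Sum>g\<in>F. c g *\<^sub>C g y0))\<^sup>2 \<le> B * (\<Sum>g\<in>F. (cmod (c g))\<^sup>2)"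
    and w: "frame k \<gamma> \<gamma>' w" "\<And>x. app w x \<in> W" "\<And>x. x \<in> W \<Longrightarrow> app w x = x"
    and W: "subspace W" "closed W" "\<And>u x. u \<in> U \<Longrightarrow> x \<in> W \<Longrightarrow> app u x \<in> W"
  defines "z \<equiv> \<lambda>j. app (\<gamma> j) y0"
  shows "riesz_basis_for (orbit_family G z k) (orbit_index G k) W"
proof -
  have \<gamma>: "\<gamma> j \<in> commutant" "q * \<gamma>' j = \<gamma>' j" if "j < k" for j
    using w(1) that by (simp_all add: frame_def)
  have \<gamma>\<gamma>: "\<gamma>' i * \<gamma> j = (if i = j then q else 0)" if "i < k" "j < k" for i j
    using w(1) that by (simp add: frame_def)
  have \<gamma>u: "app (\<gamma> j) (app u y0) = app u (z j)" if "j < k" "u \<in> U" for j u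
    using commutant_app[OF \<gamma>(1)] that by (simp add: z_def)
  have zW: "z j \<in> W" if "j < k" for j
    by (metis app_times frame_mult_left[OF w(1) that] w(2) z_def)
  have W_eq: "W = ccspan (family z k)"
  proof
    show "W \<subseteq> ccspan (family z k)"
    proof
      fix x
      assume "x \<in> W"
      then have "x = app w x"
        by (simp add: w(3))
      also have "\<dots> = (\<Sum>j<k. app (\<gamma> j) (app (\<gamma>' j) x))"
        using w(1) by (simp add: frame_def app.sum_left)
      also have "\<dots> \<in> ccspan (family z k)"
      proof (rule subspace_sum[OF subspace_ccspan_family])
        fix j
        assume "j \<in> {..<k}"
        then have j: "j < k"
          by simp
        have "app (\<gamma>' j) x \<in> closure (orbit y0)"
          using q_left_iff \<gamma>(2)[OF j] by (auto simp: cyclic_def)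
        then show "app (\<gamma> j) (app (\<gamma>' j) x) \<in> ccspan (family z k)"
          unfolding closure_orbits[symmetric]
          by (rule app_in_closure[rotated]) (auto simp: orbit_def \<gamma>u j orbits_component)
      qed
      finally show "x \<in> ccspan (family z k)" .
    qed
    have "orbits z k \<subseteq> W"
      using W zW by (auto simp: orbits_def intro!: subspace_sum)
    then show "ccspan (family z k) \<subseteq> W"
      unfolding closure_orbits[symmetric] using W(2) by (rule closure_minimal)
  qed
  \<comment> \<open>The squared norms come from Cauchy-Schwarz over \<open>j\<close>; the summand 1
    keeps \<open>M'\<close> positive even when \<open>k = 0\<close>.\<close>
  define M M' where "M = (\<Sum>j<k. (norm (\<gamma> j))\<^sup>2)" and "M' = 1 + (\<Sum>j<k. (norm (\<gamma>' j))\<^sup>2)"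
  have M: "0 \<le> M" "0 < M'"
    by (auto simp: M_def M'_def intro!: sum_nonneg add_pos_nonneg)
  have bounds: "A / M' * (\<Sum>n\<in>F. (cmod (c n))\<^sup>2) \<le> (norm (\<Sum>n\<in>F. c n *\<^sub>C orbit_family G z k n))\<^sup>2 \<and>
      (norm (\<Sum>n\<in>F. c n *\<^sub>C orbit_family G z k n))\<^sup>2 \<le> M * B * (\<Sum>n\<in>F. (cmod (c n))\<^sup>2)"
    if F: "finite F" "F \<subseteq> orbit_index G k" for F c
  proof -
    define H where "H = fst ` F"
    \<comment> \<open>Coefficients padded by 0 to the rectangle \<open>H \<times> {..<k}\<close>, so
      that each \<open>j\<close> yields one element \<open>u j\<close> of the group algebra.\<close>
    define d where "d j g = (if (g, j) \<in> F then c (g, j) else 0)" for j g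
    have H: "finite H" "H \<subseteq> G"
      using F by (auto simp: H_def orbit_index_def)
    have "\<forall>j. \<exists>u\<in>U. \<forall>x. app u x = (\<Sum>g\<in>H. d j g *\<^sub>C g x)"
      using group_algebra_sum_exists[OF H] by blast
    then obtain u where u: "\<And>j. u j \<in> U" "\<And>j x. app (u j) x = (\<Sum>g\<in>H. d j g *\<^sub>C g x)"
      by metis
    define X where "X = (\<Sum>n\<in>F. c n *\<^sub>C orbit_family G z k n)"
    define N where "N j = (\<Sum>g\<in>H. (cmod (d j g))\<^sup>2)" for j
    have "X = (\<Sum>j<k. \<Sum>g\<in>H. d j g *\<^sub>C g (z j))"
      unfolding X_def H_def
      by (subst sum_index_split[OF F(1) F(2)[unfolded orbit_index_def]], intro sum.cong refl)
        (auto simp: d_def orbit_family_def)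
    then have X: "X = (\<Sum>j<k. app (\<gamma> j) (app (u j) y0))"
      using u(1) by (simp add: \<gamma>u) (simp add: u(2))
    have S: "(\<Sum>n\<in>F. (cmod (c n))\<^sup>2) = (\<Sum>j<k. N j)"
      unfolding N_def H_def
      by (subst sum_index_split[OF F(1) F(2)[unfolded orbit_index_def]], intro sum.cong refl)
        (auto simp: d_def)
    have lo: "A * N j \<le> (norm (app (u j) y0))\<^sup>2" and up: "(norm (app (u j) y0))\<^sup>2 \<le> B * N j" for j
      unfolding N_def u(2) using A(2)[OF H] B(2)[OF H] by blast+
    have \<gamma>'X: "app (\<gamma>' i) X = app (u i) y0" if i: "i < k" for i
    proof -
      have "app (\<gamma>' i) X = (\<Sum>j<k. app (\<gamma>' i * \<gamma> j) (app (u j) y0))"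
        by (simp add: X app.sum_right)
      also have "\<dots> = (\<Sum>j<k. if i = j then app (u i) y0 else 0)"
        using i u(1) by (intro sum.cong refl) (auto simp: \<gamma>\<gamma> app_q_eq app_in_cyclic app.zero_left)
      finally show ?thesis
        using i by simp
    qed
    have "A * (\<Sum>j<k. N j) \<le> (\<Sum>j<k. (norm (app (u j) y0))\<^sup>2)"
      unfolding sum_distrib_left by (rule sum_mono) (rule lo)
    also have "\<dots> \<le> (\<Sum>j<k. (norm (\<gamma>' j))\<^sup>2 * (norm X)\<^sup>2)"
    proof (rule sum_mono)
      fix j
      assume "j \<in> {..<k}"
      then have "norm (app (u j) y0) \<le> norm (\<gamma>' j) * norm X"
        using norm_app_le[of "\<gamma>' j" X] by (simp add: \<gamma>'X)
      then show "(norm (app (u j) y0))\<^sup>2 \<le> (norm (\<gamma>' j))\<^sup>2 * (norm X)\<^sup>2"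
        using power_mono[of _ _ 2] by (fastforce simp: power_mult_distrib)
    qed
    also have "\<dots> \<le> M' * (norm X)\<^sup>2"
      unfolding sum_distrib_right[symmetric] M'_def by (intro mult_right_mono) auto
    finally have "A / M' * (\<Sum>n\<in>F. (cmod (c n))\<^sup>2) \<le> (norm X)\<^sup>2"
      using M by (simp add: S field_simps)
    moreover have "(norm X)\<^sup>2 \<le> M * B * (\<Sum>n\<in>F. (cmod (c n))\<^sup>2)"
    proof -
      have "norm X \<le> (\<Sum>j<k. norm (\<gamma> j) * norm (app (u j) y0))"
        unfolding X by (rule sum_norm_le) (rule norm_app_le)
      then have "(norm X)\<^sup>2 \<le> (\<Sum>j<k. norm (\<gamma> j) * norm (app (u j) y0))\<^sup>2"
        by (rule power_mono) simp
      also have "\<dots> \<le> M * (\<Sum>j<k. (norm (app (u j) y0))\<^sup>2)"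
        unfolding M_def by (rule Cauchy_Schwarz_ineq_sum)
      also have "\<dots> \<le> M * (\<Sum>j<k. B * N j)"
        using M up by (intro mult_left_mono sum_mono) auto
      finally show ?thesis
        by (simp add: S sum_distrib_left mult.assoc)
    qed
    ultimately show ?thesis
      by (simp add: X_def)
  qed
  show ?thesis
  \<comment> \<open>The maximum guarantees that the upper constant is not below the lower
    one.\<close>
  proof (rule riesz_basis_forI[where A = "A / M'" and B = "max (A / M') (M * B)"])
    show "countable (orbit_index G k)"
      using G by (simp add: orbit_index_def)
    show "W = ccspan (orbit_family G z k ` orbit_index G k)"
      using W_eq by (simp add: orbit_family_def orbit_index_def)
    show "(norm (\<Sum>n\<in>F. c n *\<^sub>C orbit_family G z k n))\<^sup>2
        \<le> max (A / M') (M * B) * (\<Sum>n\<in>F. (cmod (c n))\<^sup>2)"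
      if "finite F" "F \<subseteq> orbit_index G k" for F c
      using bounds[OF that, of c] mult_right_mono[of "M * B" "max (A / M') (M * B)" "\<Sum>n\<in>F. (cmod (c n))\<^sup>2"]
      by (simp add: sum_nonneg del: max_less_iff_conj)
  qed (use A M bounds in auto)
qed

end

theorem theorem3p1:
  fixes G :: "('a::chilbert_space \<Rightarrow> 'a) set"
    and x y :: "nat \<Rightarrow> 'a"
    and r s :: nat
    and V0 V1 W0 :: "'a set"
  assumes sep: "separable_space (euclidean :: 'a topology)"
    and G_count: "countable G" and G_inf: "infinite G"
    and G_group: "abelian_operator_group G"
    and G_unitary: "\<forall>g\<in>G. unitary g"
    and rs: "r < s"
    and V0_def: "V0 = ccspan ((\<lambda>(g, j). g (x j)) ` (G \<times> {..<r}))"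
    and V1_def: "V1 = ccspan ((\<lambda>(g, j). g (y j)) ` (G \<times> {..<s}))"
    and V0V1: "V0 \<subseteq> V1"
    and W0_sub: "csubspace W0" "closed W0" "W0 \<subseteq> V1"
    and dsum: "direct_sum_eq V0 W0 V1"
    and RX: "riesz_basis_for (orbit_family G x r) (orbit_index G r) V0"
    and RY: "riesz_basis_for (orbit_family G y s) (orbit_index G s) V1"
  shows "(\<exists>z :: nat \<Rightarrow> 'a. (\<forall>j < s - r. z j \<in> W0) \<and>
            riesz_basis_for (orbit_family G z (s - r)) (orbit_index G (s - r)) W0)
         \<longleftrightarrow> (\<forall>g\<in>G. g ` W0 \<subseteq> W0)"
proof -
  interpret based_unitary_group G "y 0"
    using G_group G_unitary by unfold_locales
  show ?thesis
  proof
    assume "\<exists>z :: nat \<Rightarrow> 'a. (\<forall>j < s - r. z j \<in> W0) \<and>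
            riesz_basis_for (orbit_family G z (s - r)) (orbit_index G (s - r)) W0"
    then obtain z where "W0 = ccspan (family z (s - r))"
      by (auto simp: riesz_basis_for_def orbit_family_def orbit_index_def)
    then show "\<forall>g\<in>G. g ` W0 \<subseteq> W0"
      using ccspan_family_invariant by blast
  next
    assume inv: "\<forall>g\<in>G. g ` W0 \<subseteq> W0"
    have s: "0 < s"
      using rs by simp
    have sV0: "subspace V0" and sV1: "subspace V1"
      unfolding V0_def V1_def by (rule subspace_ccspan_family)+
    have cV0: "closed V0" and cV1: "closed V1"
      unfolding V0_def V1_def by (rule closed_ccspan)+
    have sW: "subspace W0"
      by (rule csubspace_subspace[OF W0_sub(1)])
    have uV0: "app u a \<in> V0" if "u \<in> U" "a \<in> V0" for u a
      using that unfolding V0_def by (rule ccspan_family_app)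
    have uV1: "app u a \<in> V1" if "u \<in> U" "a \<in> V1" for u a
      using that unfolding V1_def by (rule ccspan_family_app)
    have uW: "app u a \<in> W0" if "u \<in> U" "a \<in> W0" for u a
      using W0_sub(1) inv that by (rule csubspace_invariant)
    define P where "P = Proj V1"
    have P: "P \<in> commutant"
      unfolding P_def by (rule Proj_in_commutant[OF sV1 cV1 uV1])
    have Pin: "app P a \<in> V1" for a
      unfolding P_def by (rule app_Proj_in[OF sV1 cV1])
    have Pfix: "app P a = a" if "a \<in> V1" for a
      unfolding P_def using app_Proj_eq_iff[OF sV1 cV1] that by blast
    obtain v where vV: "\<And>a. app v a \<in> V0" and vW: "\<And>a. app (P - v) a \<in> W0"
      and vfix: "\<And>a. a \<in> V0 \<Longrightarrow> app v a = a"
      and vuniq: "\<And>a b. b \<in> V0 \<Longrightarrow> app P a - b \<in> W0 \<Longrightarrow> app v a = b"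
      by (rule oblique_projection[OF sV0 cV0 sW W0_sub(2) dsum, folded P_def]) (rule that)
    \<comment> \<open>Invariance of \<open>W0\<close> enters here: \<open>u (v a)\<close> lies in
      \<open>V0\<close> and \<open>P (u a) - u (v a) = u ((P - v) a)\<close> lies in
      \<open>W0\<close>, so uniqueness of the splitting gives
      \<open>v (u a) = u (v a)\<close>.\<close>
    have "v * u = u * v" if u: "u \<in> U" for u
    proof (rule bop_eqI)
      fix a
      have "app v (app u a) = app u (app v a)"
      proof (rule vuniq)
        show "app u (app v a) \<in> V0"
          by (rule uV0[OF u vV])
        have "app u (app (P - v) a) \<in> W0"
          by (rule uW[OF u vW])
        then show "app P (app u a) - app u (app v a) \<in> W0"
          by (simp add: app.diff_left app.diff_right commutant_app[OF P u])
      qed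
      then show "app (v * u) a = app (u * v) a"
        by simp
    qed
    then have v: "v \<in> commutant"
      by (simp add: commutant_def)
    define w where "w = P - v"
    have w: "w \<in> commutant"
      unfolding w_def by (rule commutant_diff[OF P v])
    have wfix: "app w a = a" if a: "a \<in> W0" for a
    proof -
      have Pa: "app P a = a"
        using Pfix a W0_sub(3) by blast
      have "app v a = 0"
        using subspace_0[OF sV0] a by (intro vuniq) (simp_all add: Pa)
      then show ?thesis
        by (simp add: w_def app.diff_left Pa)
    qed
    have wW: "app w a \<in> W0" for a
      unfolding w_def by (rule vW)
    have wV: "app w a = 0" if "a \<in> V0" for a
      using that V0V1 Pfix vfix by (auto simp: w_def app.diff_left)
    have ww: "w * w = w"
      by (rule bop_eqI) (simp add: wfix wW)
    have wv: "w * v = 0"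
      by (rule bop_eqI) (simp add: wV vV app.zero_left)
    have vw: "v * w = 0"
    proof (rule bop_eqI)
      fix a
      have "app w (app w a) = app P (app w a) - app v (app w a)"
        by (simp add: w_def app.diff_left)
      moreover have "app P (app w a) = app w a"
        using Pfix wW W0_sub(3) by blast
      ultimately show "app (v * w) a = app 0 a"
        by (simp add: wfix wW app.zero_left)
    qed
    \<comment> \<open>Stated for an arbitrary idempotent onto the span, as it is used for the
      oblique \<open>v\<close> on \<open>V0\<close> and the orthogonal \<open>P\<close> on
      \<open>V1\<close>. Both frames refer to the same cyclic subspace of \<open>y 0\<close>, which
      makes cancellation applicable.\<close>
    have frame_exists: "\<exists>\<alpha> \<beta>. frame k \<alpha> \<beta> p"
      if z: "riesz_basis_for (orbit_family G z k) (orbit_index G k) V" "V = ccspan (family z k)"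
        and p: "p \<in> commutant" "\<And>a. app p a \<in> V" "\<And>a. a \<in> V \<Longrightarrow> app p a = a" for z k V p
    proof (rule riesz_orbit_comparison[OF RY s z(1)])
      fix C
      assume C: "\<And>u i. (\<And>j. u j \<in> U) \<Longrightarrow> i < k \<Longrightarrow>
          norm (app (u i) (y 0)) \<le> C * norm (\<Sum>j<k. app (u j) (z j))"
        "\<And>u j. u \<in> U \<Longrightarrow> j < k \<Longrightarrow> norm (app u (z j)) \<le> C * norm (app u (y 0))"
      show ?thesis
        by (rule frame_of_bounds[OF C p(1)]) (use p z(2) in \<open>simp_all add: closure_orbits\<close>)
    qed
    obtain \<xi> \<xi>' where \<xi>: "frame r \<xi> \<xi>' v"
      using frame_exists[OF RX V0_def v vV vfix] by blast
    obtain \<alpha> \<beta> where \<alpha>: "frame s \<alpha> \<beta> P"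
      using frame_exists[OF RY V1_def P Pin Pfix] by blast
    have "P = v + w"
      by (simp add: w_def)
    then obtain \<gamma> \<gamma>' where \<gamma>: "frame (s - r) \<gamma> \<gamma>' w"
      using complement_frame[OF \<xi> \<alpha> _ _ w ww vw wv] rs by auto
    obtain A B where AB: "0 < A" "0 \<le> B"
      and lower: "\<And>F c j. finite F \<Longrightarrow> F \<subseteq> G \<Longrightarrow> j < s \<Longrightarrow>
        A * (\<Sum>g\<in>F. (cmod (c g))\<^sup>2) \<le> (norm (\<Sum>g\<in>F. c g *\<^sub>C g (y j)))\<^sup>2"
      and upper: "\<And>F c j. finite F \<Longrightarrow> F \<subseteq> G \<Longrightarrow> j < s \<Longrightarrow>
        (norm (\<Sum>g\<in>F. c g *\<^sub>C g (y j)))\<^sup>2 \<le> B * (\<Sum>g\<in>F. (cmod (c g))\<^sup>2)"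
      by (rule riesz_orbit_bounds[OF RY]) (rule that)
    let ?z = "\<lambda>j. app (\<gamma> j) (y 0)"
    have "riesz_basis_for (orbit_family G ?z (s - r)) (orbit_index G (s - r)) W0"
      by (rule frame_imp_riesz_basis[OF G_count AB(1) lower AB(2) upper \<gamma> wW wfix sW W0_sub(2) uW])
        (simp_all add: s)
    moreover have "?z j \<in> W0" if "j < s - r" for j
      by (metis app_times frame_mult_left[OF \<gamma> that] wW)
    ultimately show "\<exists>z :: nat \<Rightarrow> 'a. (\<forall>j < s - r. z j \<in> W0) \<and>
        riesz_basis_for (orbit_family G z (s - r)) (orbit_index G (s - r)) W0"
      by (intro exI[of _ ?z]) simp
  qed
qed

end
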